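(* Let $g\in H^\infty(\mathbb{D})$ be non-constant and such that $g(\mathbb{D})\cap\mathbb{D}=\varnothing$ and the set $\{z\in\mathbb{T}:|g(z)|=1\}$ has positive Lebesgue measure. Then the coanalytic Toeplitz operator $T_g^*$ is weakly hypercyclic on $H^2(\mathbb{D})$.
   Context: $\mathbb{D}$ is the open unit disk, $\mathbb{T}$ the unit circle with normalized Lebesgue measure $\lambda$; functions in $H^\infty(\mathbb{D})$ are identified with their (a.e. defined) non-tangential boundary values on $\mathbb{T}$. $H^2(\mathbb{D})$ is regarded as the closed subspace of $L^2(\mathbb{T})$. For $g\in L^\infty(\mathbb{T})$, the Toeplitz operator is $T_g=PM_g$ on $H^2(\mathbb{D})$, where $M_g$ is multiplication by $g$ and $P$ is the orthogonal projection of $L^2(\mathbb{T})$ onto $H^2(\mathbb{D})$; $T_g^*$ is its Hilbert space adjoint. A bounded operator $T$ on a Banach space $X$ is weakly hypercyclic if there is $x\in X$ such that $\{T^nx:n\geq 0\}$ is dense in $X$ in the weak topology. *)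

theory Defs
  imports "HOL-Analysis.Analysis"
begin

text \<open>The unit circle T is parametrised by t in [0,1] via t |-> cis (2 pi t); the
  normalised Lebesgue measure on T is Lebesgue measure on [0,1].\<close>

definition circ_meas :: "real measure" where
  "circ_meas = lebesgue_on {0..1}"

text \<open>Boundary function of g (radial limit, which coincides with the non-tangential
  limit a.e. for g in H-infinity).\<close>
definition bdry :: "(complex \<Rightarrow> complex) \<Rightarrow> real \<Rightarrow> complex" where
  "bdry g t = Lim (at_left 1) (\<lambda>r::real. g (complex_of_real r * cis (2 * pi * t)))"

definition Hinf :: "(complex \<Rightarrow> complex) \<Rightarrow> bool" where
  "Hinf g \<longleftrightarrow> g holomorphic_on ball 0 1 \<and> bounded (g ` ball 0 1)"

definition L2T :: "(real \<Rightarrow> complex) \<Rightarrow> bool" where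
  "L2T f \<longleftrightarrow> f \<in> borel_measurable circ_meas \<and>
              integrable circ_meas (\<lambda>t. (cmod (f t))\<^sup>2)"

definition fourier_coeff :: "(real \<Rightarrow> complex) \<Rightarrow> int \<Rightarrow> complex" where
  "fourier_coeff f n = (LINT t|circ_meas. f t * cis (- 2 * pi * of_int n * t))"

definition H2 :: "(real \<Rightarrow> complex) set" where
  "H2 = {f. L2T f \<and> (\<forall>n<0. fourier_coeff f n = 0)}"

definition ip :: "(real \<Rightarrow> complex) \<Rightarrow> (real \<Rightarrow> complex) \<Rightarrow> complex" where
  "ip f h = (LINT t|circ_meas. f t * cnj (h t))"

definition norm2 :: "(real \<Rightarrow> complex) \<Rightarrow> real" where
  "norm2 f = sqrt (LINT t|circ_meas. (cmod (f t))\<^sup>2)"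

text \<open>Orthogonal projection P of L^2(T) onto H^2: P u is the element q of H^2 with
  u - q orthogonal to H^2 (unique up to a.e. equality).\<close>
definition projH2 :: "(real \<Rightarrow> complex) \<Rightarrow> (real \<Rightarrow> complex)" where
  "projH2 u = (SOME q. q \<in> H2 \<and> (\<forall>k\<in>H2. ip u k = ip q k))"

definition toeplitz :: "(real \<Rightarrow> complex) \<Rightarrow> (real \<Rightarrow> complex) \<Rightarrow> (real \<Rightarrow> complex)" where
  "toeplitz gb h = projH2 (\<lambda>t. gb t * h t)"

definition toeplitz_adj :: "(real \<Rightarrow> complex) \<Rightarrow> (real \<Rightarrow> complex) \<Rightarrow> (real \<Rightarrow> complex)" where
  "toeplitz_adj gb f = (SOME p. p \<in> H2 \<and> (\<forall>h\<in>H2. ip p h = ip f (toeplitz gb h)))"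

definition dual_H2 :: "((real \<Rightarrow> complex) \<Rightarrow> complex) set" where
  "dual_H2 = {\<phi>. (\<forall>f\<in>H2. \<forall>h\<in>H2. \<forall>a b. \<phi> (\<lambda>t. a * f t + b * h t) = a * \<phi> f + b * \<phi> h)
               \<and> (\<exists>C. \<forall>f\<in>H2. cmod (\<phi> f) \<le> C * norm2 f)}"

definition weakly_dense_H2 :: "(real \<Rightarrow> complex) set \<Rightarrow> bool" where
  "weakly_dense_H2 S \<longleftrightarrow>
     (\<forall>h\<in>H2. \<forall>e>0. \<forall>F. finite F \<and> F \<subseteq> dual_H2 \<longrightarrow>
        (\<exists>f\<in>S. \<forall>\<phi>\<in>F. cmod (\<phi> f - \<phi> h) < e))"

definition weakly_hypercyclic_H2 :: "((real \<Rightarrow> complex) \<Rightarrow> (real \<Rightarrow> complex)) \<Rightarrow> bool" where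
  "weakly_hypercyclic_H2 T \<longleftrightarrow>
     (\<exists>x\<in>H2. weakly_dense_H2 {(T ^^ n) x | n. True})"

end

theory Submission
  imports Defs "HOL-Complex_Analysis.Complex_Analysis"
begin

text \<open>
  Put \<open>h = 1/g\<close>, \<open>T = T\<^sub>g\<^sup>*\<close>, \<open>R = T\<^sub>h\<^sup>*\<close>. By the maximum principle \<open>\<bar>h\<bar> < 1\<close> in the disc, so \<open>T R = 1\<close> and
  the powers of \<open>R\<close> tend strongly to \<open>0\<close>. Let \<open>A\<close> be the set of positive measure where the
  boundary values of \<open>g\<close> are unimodular. For bounded \<open>\<psi>\<close> the vector \<open>u = P(1\<^sub>A \<psi>)\<close> satisfies
  \<open>T\<^sup>m u = P(h\<^sup>m 1\<^sub>A \<psi>)\<close>, since \<open>cnj g = h\<close> on \<open>A\<close>. Composition with \<open>h\<close> is bounded on the Hardy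
  space, hence \<open>(T\<^sup>m u)\<close> is a Bessel sequence. Such vectors are dense: there are outer functions
  equal to \<open>1\<close> at the origin that are arbitrarily small off \<open>A\<close>.

  For a dense sequence \<open>(u\<^sub>i)\<close> of such vectors and a rapidly growing sequence \<open>(n\<^sub>j)\<close>, consider
  \<open>x = \<Sum>\<^sub>j R\<^bsup>n\<^sub>j\<^esup> v\<^sub>j\<close>, where \<open>(v\<^sub>j)\<close> lists each \<open>u\<^sub>i\<close> along a set of indices of positive density. Up to
  a small error, \<open>T\<^bsup>n\<^sub>k\<^esup> x\<close> is \<open>v\<^sub>k\<close> plus the cross terms \<open>\<Sum>\<^sub>j\<^sub><\<^sub>k T\<^bsup>n\<^sub>k - n\<^sub>j\<^esup> v\<^sub>j\<close>. The Bessel property makes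
  the squares of any functional on the cross terms summable against the weights \<open>1/k\<close>, while the sum
  of \<open>1/k\<close> over each index class diverges. Hence the cross terms are weakly small for some \<open>k\<close> in
  each class.
\<close>

section \<open>A criterion for weak hypercyclicity\<close>

text \<open>\<open>R\<close> is a contraction and inverts \<open>T\<close>, so norms do not decrease
  along an orbit and no orbit of a nonzero vector enters a small ball at the origin: the cross terms
  cannot be made small in norm. Against finitely many functionals they only have to be small for one
  \<open>k\<close> at a time, and square summability suffices for that. Cauchy-Schwarz over the
  cross terms of step \<open>k\<close> costs a factor of order \<open>k\<close>; hence the weight
  \<open>1/k\<close> and the demand that every index class have a divergent harmonic sum. Class
  \<open>e\<close> has density \<open>2 ^ -(e + 1)\<close>; a Cauchy-Schwarz weight
  \<open>b ^ e\<close> with \<open>5/4 < b < 2\<close> makes both resulting geometric series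
  converge, and \<open>b = 3/2\<close> is used. The boundary function is a pointwise
  \<open>Lim\<close>, so Fatou's theorem is needed. One integration gives access to it: the
  primitive of \<open>g\<close> is continuous on the closed disc, Lebesgue differentiation applies
  to it on the circle, and the derivative is then followed along radii.\<close>

function val2 :: "nat \<Rightarrow> nat" where
  "val2 k = (if even k then 0 else Suc (val2 (k div 2)))"
  by auto
termination by (relation "Wellfounded.measure id") (auto elim: oddE)

declare val2.simps [simp del]

text \<open>By these rules \<open>val2 k\<close> counts the trailing binary ones of
  \<open>k\<close>, so it is the 2-adic valuation of \<open>k + 1\<close>, not of \<open>k\<close>.
  The shift makes it total at 0 and turns class \<open>e\<close> into an arithmetic progression of
  difference \<open>2 ^ (e + 1)\<close>.\<close>

lemma val2_double [simp]: "val2 (2 * l) = 0" "val2 (Suc (2 * l)) = Suc (val2 l)"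
  by (subst val2.simps; simp)+

lemma val2_le: "val2 k \<le> k"
proof (induction k rule: less_induct)
  case (less k)
  show ?case
  proof (cases "even k")
    case False
    then obtain l where "k = Suc (2 * l)" by (auto elim: oddE)
    with less[of l] show ?thesis by simp
  qed (simp add: val2.simps)
qed

lemma sum_lessThan_double: "(\<Sum>j<2 * l. f j) = (\<Sum>j<l. f (2 * j) + f (Suc (2 * j)) :: real)"
  by (induction l) auto

text \<open>The average of \<open>(3/2) ^ val2 j\<close> is the series of
  \<open>(3/2) ^ e / 2 ^ (e + 1)\<close>, whose value is the constant 2. In the recursion, even
  indices contribute 1 each and odd ones \<open>3/2\<close> times the sum over half the range:
  \<open>l + 3/2 * (2 * l) = 4 * l\<close>.\<close>

lemma sum_val2_weight_le: "(\<Sum>j<k. (3/2) ^ val2 j) \<le> 2 * real k"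
proof (induction k rule: less_induct)
  case (less k)
  have *: "(\<Sum>j<2 * l. (3/2) ^ val2 j) \<le> 2 * real (2 * l)" if "l < k" for l
  proof -
    have "(\<Sum>j<2 * l. (3/2) ^ val2 j) = real l + 3/2 * (\<Sum>j<l. (3/2::real) ^ val2 j)"
      by (simp add: sum_lessThan_double sum.distrib sum_distrib_left)
    thus ?thesis using less[OF that] by simp
  qed
  show ?case
  proof (cases "even k")
    case True
    then obtain l where k: "k = 2 * l" by blast
    show ?thesis using * k by (cases "l = 0") auto
  next
    case False
    then obtain l where k: "k = Suc (2 * l)" by (auto elim: oddE)
    show ?thesis using *[of l] k by simp
  qed
qed

text \<open>The map \<open>l\<close> to \<open>2 * l + 1\<close> carries class \<open>e\<close> onto
  class \<open>e + 1\<close> and halves the terms \<open>1 / (k + 1)\<close>, so divergence is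
  inherited from the even indices, where the terms dominate half the harmonic series.\<close>

lemma not_summable_inverse_val2: "\<not> summable (\<lambda>k. if val2 k = e then 1 / real (Suc k) else 0)"
proof (induction e)
  case 0
  show ?case
  proof
    assume s: "summable (\<lambda>k. if val2 k = 0 then 1 / real (Suc k) else 0)"
    have "summable ((\<lambda>k. if val2 k = 0 then 1 / real (Suc k) else 0) \<circ> (\<lambda>l. 2 * l))"
      by (rule summable_reindex[OF s]) (auto simp: inj_on_def)
    hence s1: "summable (\<lambda>l. 2 * (1 / real (Suc (2 * l))))"
      unfolding o_def val2_double by (intro summable_mult) simp
    have "summable (\<lambda>l. 1 / real (Suc l))"
      by (rule summable_comparison_test[OF _ s1]) (auto simp: field_simps intro!: exI[of _ 0])
    hence "summable (\<lambda>n. inverse (real n))"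
      by (subst summable_Suc_iff[symmetric]) (simp only: inverse_eq_divide)
    thus False using not_summable_harmonic[where 'a=real] by blast
  qed
next
  case (Suc e)
  show ?case
  proof
    assume s: "summable (\<lambda>k. if val2 k = Suc e then 1 / real (Suc k) else 0)"
    have "summable ((\<lambda>k. if val2 k = Suc e then 1 / real (Suc k) else 0) \<circ> (\<lambda>l. Suc (2 * l)))"
      by (rule summable_reindex[OF s]) (auto simp: inj_on_def)
    hence "summable (\<lambda>l. 2 * (if val2 l = e then 1 / real (Suc (Suc (2 * l))) else 0))"
      unfolding o_def val2_double by (intro summable_mult) simp
    moreover have "2 * (if val2 l = e then 1 / real (Suc (Suc (2 * l))) else 0)
        = (if val2 l = e then 1 / real (Suc l) else 0)" for l
      by (simp add: field_simps)
    ultimately show False using Suc by simp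
  qed
qed

text \<open>Dual form of the Bessel bound: with the coefficients \<open>c m = \<psi> (w m)\<close>
  the sum of squares \<open>s\<close> is itself a value of \<open>\<psi>\<close>, which gives
  \<open>s * s <= K^2 * C * s\<close>, and one factor \<open>s\<close> cancels.\<close>

lemma functional_square_sum_le:
  fixes \<psi> :: "'a::real_normed_vector \<Rightarrow> real"
  assumes \<psi>: "bounded_linear \<psi>" and K: "\<And>x. \<bar>\<psi> x\<bar> \<le> K * norm x" "K \<ge> 0"
    and bessel: "\<And>N c. (norm (\<Sum>m<N. c m *\<^sub>R w m))\<^sup>2 \<le> C * (\<Sum>m<N. (c m)\<^sup>2)"
    and M: "finite (M :: nat set)"
  shows "(\<Sum>m\<in>M. (\<psi> (w m))\<^sup>2) \<le> K\<^sup>2 * C"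
proof -
  interpret \<psi>: bounded_linear \<psi> by fact
  have "0 \<le> C * (\<Sum>m<Suc 0. (1::real)\<^sup>2)" by (rule order_trans[OF zero_le_power2 bessel])
  hence C0: "0 \<le> C" by simp
  have *: "(\<Sum>m<N. (\<psi> (w m))\<^sup>2) \<le> K\<^sup>2 * C" for N
  proof -
    define s where "s = (\<Sum>m<N. (\<psi> (w m))\<^sup>2)"
    have s0: "0 \<le> s" unfolding s_def by (intro sum_nonneg) auto
    have "s = \<psi> (\<Sum>m<N. \<psi> (w m) *\<^sub>R w m)"
      by (simp add: s_def \<psi>.sum \<psi>.scaleR power2_eq_square)
    hence "\<bar>s\<bar> \<le> K * norm (\<Sum>m<N. \<psi> (w m) *\<^sub>R w m)" using K(1) by metis
    hence "s\<^sup>2 \<le> (K * norm (\<Sum>m<N. \<psi> (w m) *\<^sub>R w m))\<^sup>2" using s0 by (intro power_mono) auto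
    also have "\<dots> \<le> K\<^sup>2 * (C * s)"
      unfolding power_mult_distrib s_def by (intro mult_left_mono bessel) auto
    finally have "s * s \<le> (K\<^sup>2 * C) * s" by (simp add: power2_eq_square mult_ac)
    thus ?thesis unfolding s_def[symmetric]
      using s0 C0 by (cases "s = 0") (auto simp: mult_le_cancel_right)
  qed
  obtain N where "M \<subseteq> {..<N}" using M by (meson finite_nat_bounded)
  hence "(\<Sum>m\<in>M. (\<psi> (w m))\<^sup>2) \<le> (\<Sum>m<N. (\<psi> (w m))\<^sup>2)" by (intro sum_mono2) auto
  with * show ?thesis by (meson order_trans)
qed

section \<open>Powers of a map and of its right inverse\<close>

lemma funpow_right_inverse:
  fixes T R :: "'a \<Rightarrow> 'a"
  assumes "\<And>x. T (R x) = x"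
  shows "(T ^^ n) ((R ^^ n) x) = x"
  by (induction n arbitrary: x) (auto simp: funpow_swap1 assms)

lemma funpow_right_inverse_le:
  fixes T R :: "'a \<Rightarrow> 'a"
  assumes "\<And>x. T (R x) = x" "m \<le> n"
  shows "(T ^^ n) ((R ^^ m) x) = (T ^^ (n - m)) x" "(T ^^ m) ((R ^^ n) x) = (R ^^ (n - m)) x"
proof -
  have "(T ^^ n) ((R ^^ m) x) = (T ^^ (n - m)) ((T ^^ m) ((R ^^ m) x))"
    using assms(2) by (metis comp_apply funpow_add le_add_diff_inverse2)
  thus "(T ^^ n) ((R ^^ m) x) = (T ^^ (n - m)) x" using assms(1) by (simp add: funpow_right_inverse)
  have "(T ^^ m) ((R ^^ n) x) = (T ^^ m) ((R ^^ m) ((R ^^ (n - m)) x))"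
    using assms(2) by (metis comp_apply funpow_add le_add_diff_inverse)
  thus "(T ^^ m) ((R ^^ n) x) = (R ^^ (n - m)) x" using assms(1) by (simp add: funpow_right_inverse)
qed

text \<open>Cauchy--Schwarz with the weights \<open>(3/2) ^ val2 j\<close>, whose sum over \<open>j < k\<close> is \<open>O(k)\<close>.
  Sparseness of \<open>n\<close> makes the differences \<open>n k - n j\<close> pairwise distinct, so that each
  Bessel bound is used once.\<close>

lemma summable_cross_terms:
  fixes T :: "'a::real_normed_vector \<Rightarrow> 'a" and \<psi> :: "'a \<Rightarrow> real" and n :: "nat \<Rightarrow> nat"
  assumes \<psi>: "bounded_linear \<psi>"
    and bessel: "\<And>e N c. (norm (\<Sum>m<N. c m *\<^sub>R (T ^^ m) (u e)))\<^sup>2 \<le> (5/4) ^ e * (\<Sum>m<N. (c m)\<^sup>2)"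
    and n: "\<And>j. n (Suc j) > 2 * n j"
  shows "summable (\<lambda>k. (\<psi> (\<Sum>j<k. (T ^^ (n k - n j)) (u (val2 j))))\<^sup>2 / real (Suc k))"
proof -
  interpret \<psi>: bounded_linear \<psi> by fact
  obtain K where K: "\<And>x. \<bar>\<psi> x\<bar> \<le> K * norm x" "K \<ge> 0"
    using \<psi>.nonneg_bounded by (metis real_norm_def mult.commute)
  have sm: "strict_mono n" unfolding strict_mono_Suc_iff
  proof
    show "n j < n (Suc j)" for j using n[of j] by linarith
  qed
  have inj: "k = k' \<and> j = j'" if "j < k" "j' < k'" "n k - n j = n k' - n j'" for j k j' k'
  proof -
    \<comment> \<open>With \<open>l = k' - 1\<close>, growth by more than a factor 2 gives
      \<open>n k' - n j' >= n k' - n l > n l >= n k\<close>, so a difference determines its larger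
      index.\<close>
    have aux: "n k - n j < n k' - n j'" if "j < k" "j' < k'" "k < k'" for j k j' k'
    proof -
      obtain l where l: "k' = Suc l" using \<open>j' < k'\<close> by (auto dest: less_imp_Suc_add)
      have "n j' \<le> n l" "n k \<le> n l" using that l sm by (auto simp: strict_mono_less_eq)
      moreover have "2 * n l < n k'" using n l by simp
      ultimately show ?thesis by linarith
    qed
    have "k = k'" using aux[OF that(1,2)] aux[OF that(2,1)] that(3) by (metis less_irrefl nat_neq_iff)
    moreover have "n j < n k" "n j' < n k'" using that sm by (auto simp: strict_mono_less)
    ultimately have "n j = n j'" using that(3) by simp
    thus ?thesis using \<open>k = k'\<close> sm by (simp add: strict_mono_eq)
  qed
  define a where "a j k = \<psi> ((T ^^ (n k - n j)) (u (val2 j)))" for j k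
  have CS: "(\<psi> (\<Sum>j<k. (T ^^ (n k - n j)) (u (val2 j))))\<^sup>2 / real (Suc k)
      \<le> 2 * (\<Sum>j<k. (a j k)\<^sup>2 * (2/3) ^ val2 j)" for k
  proof -
    have "(\<psi> (\<Sum>j<k. (T ^^ (n k - n j)) (u (val2 j))))\<^sup>2
        = (\<Sum>j<k. sqrt ((3/2) ^ val2 j) * (a j k * sqrt ((2/3) ^ val2 j)))\<^sup>2"
    proof -
      have "sqrt ((3/2) ^ e) * sqrt ((2/3) ^ e) = 1" for e
        by (simp flip: real_sqrt_mult power_mult_distrib)
      hence "sqrt ((3/2) ^ val2 j) * (a j k * sqrt ((2/3) ^ val2 j)) = a j k" for j
        by (metis mult.assoc mult.commute mult.right_neutral)
      thus ?thesis by (simp only: \<psi>.sum a_def)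
    qed
    also have "\<dots> \<le> (\<Sum>j<k. (sqrt ((3/2) ^ val2 j))\<^sup>2) * (\<Sum>j<k. (a j k * sqrt ((2/3) ^ val2 j))\<^sup>2)"
      by (rule Cauchy_Schwarz_ineq_sum)
    also have "\<dots> = (\<Sum>j<k. (3/2) ^ val2 j) * (\<Sum>j<k. (a j k)\<^sup>2 * (2/3) ^ val2 j)"
      by (simp add: power_mult_distrib)
    also have "\<dots> \<le> (2 * real (Suc k)) * (\<Sum>j<k. (a j k)\<^sup>2 * (2/3) ^ val2 j)"
      using sum_val2_weight_le[of k] by (intro mult_right_mono sum_nonneg) auto
    finally show ?thesis by (subst divide_le_eq) (simp add: algebra_simps)
  qed
  have bound: "(\<Sum>k<N. \<Sum>j<k. (a j k)\<^sup>2 * (2/3) ^ val2 j) \<le> K\<^sup>2 * 6" for N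
  proof -
    define I where "I = (SIGMA k:{..<N}. {..<k})"
    have fin: "finite I" unfolding I_def by auto
    have "(\<Sum>k<N. \<Sum>j<k. (a j k)\<^sup>2 * (2/3) ^ val2 j) = (\<Sum>(k, j)\<in>I. (a j k)\<^sup>2 * (2/3) ^ val2 j)"
      unfolding I_def by (subst sum.Sigma) auto
    also have "\<dots> = (\<Sum>e<N. \<Sum>(k, j)\<in>{p\<in>I. val2 (snd p) = e}. (a j k)\<^sup>2 * (2/3) ^ val2 j)"
    proof (rule sum.group[symmetric, OF fin])
      show "(\<lambda>p. val2 (snd p)) ` I \<subseteq> {..<N}"
      proof (rule image_subsetI)
        fix p assume "p \<in> I"
        hence "snd p < fst p" "fst p < N" by (auto simp: I_def)
        thus "val2 (snd p) \<in> {..<N}" using val2_le[of "snd p"] by simp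
      qed
    qed auto
    \<comment> \<open>The Cauchy-Schwarz weight leaves \<open>(2/3) ^ e\<close> against the Bessel
      constant \<open>(5/4) ^ e\<close>; the product has ratio 5/6, whose geometric series sums to
      6.\<close>
    also have "\<dots> \<le> (\<Sum>e<N. K\<^sup>2 * (5/6) ^ e)"
    proof (rule sum_mono)
      fix e
      define J where "J = {p\<in>I. val2 (snd p) = e}"
      have finJ: "finite J" using fin by (simp add: J_def)
      have injJ: "inj_on (\<lambda>(k, j). n k - n j) J"
        using inj by (auto simp: inj_on_def J_def I_def)
      have "(\<Sum>(k, j)\<in>J. (a j k)\<^sup>2 * (2/3) ^ val2 j) = (2/3) ^ e * (\<Sum>(k, j)\<in>J. (\<psi> ((T ^^ (n k - n j)) (u e)))\<^sup>2)"
        unfolding sum_distrib_left a_def by (rule sum.cong) (auto simp: J_def)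
      also have "(\<Sum>(k, j)\<in>J. (\<psi> ((T ^^ (n k - n j)) (u e)))\<^sup>2)
          = (\<Sum>m\<in>(\<lambda>(k, j). n k - n j) ` J. (\<psi> ((T ^^ m) (u e)))\<^sup>2)"
        by (subst sum.reindex[OF injJ]) (auto intro!: sum.cong)
      also have "\<dots> \<le> K\<^sup>2 * (5/4) ^ e"
        by (rule functional_square_sum_le[OF \<psi> K bessel]) (use finJ in auto)
      finally have "(\<Sum>(k, j)\<in>J. (a j k)\<^sup>2 * (2/3) ^ val2 j) \<le> (2/3) ^ e * (K\<^sup>2 * (5/4) ^ e)" by simp
      also have "\<dots> = K\<^sup>2 * (2/3 * (5/4)) ^ e" by (simp only: power_mult_distrib mult_ac)
      finally show "(\<Sum>(k, j)\<in>{p\<in>I. val2 (snd p) = e}. (a j k)\<^sup>2 * (2/3) ^ val2 j) \<le> K\<^sup>2 * (5/6) ^ e"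
        by (simp add: J_def)
    qed
    also have "\<dots> = K\<^sup>2 * (\<Sum>e<N. (5/6) ^ e)" by (simp add: sum_distrib_left)
    also have "\<dots> \<le> K\<^sup>2 * 6"
      by (intro mult_left_mono) (auto simp: sum_gp_strict)
    finally show ?thesis .
  qed
  show ?thesis
  proof (rule bounded_imp_summable)
    fix N
    have "(\<Sum>k\<le>N. (\<psi> (\<Sum>j<k. (T ^^ (n k - n j)) (u (val2 j))))\<^sup>2 / real (Suc k))
        \<le> (\<Sum>k\<le>N. 2 * (\<Sum>j<k. (a j k)\<^sup>2 * (2/3) ^ val2 j))" by (intro sum_mono CS)
    also have "\<dots> = 2 * (\<Sum>k<Suc N. \<Sum>j<k. (a j k)\<^sup>2 * (2/3) ^ val2 j)"
      by (simp only: sum_distrib_left lessThan_Suc_atMost)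
    also have "\<dots> \<le> 2 * (K\<^sup>2 * 6)" using bound[of "Suc N"] by linarith
    finally show "(\<Sum>k\<le>N. (\<psi> (\<Sum>j<k. (T ^^ (n k - n j)) (u (val2 j))))\<^sup>2 / real (Suc k)) \<le> 2 * (K\<^sup>2 * 6)" .
  qed auto
qed

text \<open>Here the number of a class bounds the Bessel constant of its vector; an arbitrary
  sequence is brought into this form afterwards by relisting it. The functionals are real because
  complex ones can be split into real and imaginary parts.\<close>

lemma weakly_hypercyclic_criterion_normalized:
  fixes T R :: "'a::banach \<Rightarrow> 'a"
  assumes T: "bounded_linear T" and TR: "\<And>x. T (R x) = x"
    and R: "\<And>y. (\<lambda>m. (R ^^ m) y) \<longlonglongrightarrow> 0"
    and bessel: "\<And>e N c. (norm (\<Sum>m<N. c m *\<^sub>R (T ^^ m) (u e)))\<^sup>2 \<le> (5/4) ^ e * (\<Sum>m<N. (c m)\<^sup>2)"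
  obtains x where "\<And>F e \<epsilon>. finite F \<Longrightarrow> (\<And>\<psi>. \<psi> \<in> F \<Longrightarrow> bounded_linear (\<psi> :: 'a \<Rightarrow> real)) \<Longrightarrow> \<epsilon> > 0
    \<Longrightarrow> \<exists>n. \<forall>\<psi>\<in>F. \<bar>\<psi> ((T ^^ n) x) - \<psi> (u e)\<bar> < \<epsilon>"
proof -
  define v where "v j = u (val2 j)" for j
  have "\<exists>L. \<forall>l\<ge>L. norm ((R ^^ l) (v j)) \<le> (1/2) ^ j" for j
  proof -
    have "eventually (\<lambda>l. norm ((R ^^ l) (v j)) < (1/2) ^ j) sequentially"
      using tendstoD[OF R[of "v j"], of "(1/2) ^ j"] by simp
    thus ?thesis by (auto simp: eventually_sequentially intro: less_imp_le)
  qed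
  then obtain L where L: "\<And>j l. l \<ge> L j \<Longrightarrow> norm ((R ^^ l) (v j)) \<le> (1/2) ^ j" by metis
  \<comment> \<open>\<open>2 * r + 1\<close> provides the sparseness that separates the differences.
    The summand \<open>L (Suc j)\<close> makes \<open>n j\<close> and every gap
    \<open>n j - n k\<close> with \<open>k < j\<close> at least \<open>L j\<close>, so the
    corresponding powers of \<open>R\<close> send \<open>v j\<close> below
    \<open>(1/2) ^ j\<close>.\<close>
  define n where "n = rec_nat (L 0) (\<lambda>j r. 2 * r + 1 + L (Suc j))"
  have n0: "n 0 = L 0" and nS: "n (Suc j) = 2 * n j + 1 + L (Suc j)" for j
    by (auto simp: n_def)
  have sm: "strict_mono n" by (simp add: strict_mono_Suc_iff nS)
  have nL: "n j \<ge> L j" for j by (cases j) (auto simp: n0 nS)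
  have nd: "n j - n k \<ge> L j" if "k < j" for j k
  proof -
    obtain i where i: "j = Suc i" using \<open>k < j\<close> by (auto dest: less_imp_Suc_add)
    have "n k \<le> n i" using that i sm by (simp add: strict_mono_less_eq)
    thus ?thesis using nS[of i] i by simp
  qed
  have sg: "summable (\<lambda>j. (1/2::real) ^ j)" by simp
  define f where "f j = (R ^^ n j) (v j)" for j
  have sf: "summable f"
    by (rule summable_norm_cancel, rule summable_comparison_test[OF _ sg])
      (auto simp: f_def intro!: exI[of _ 0] L nL)
  define x where "x = suminf f"
  define y where "y k = (\<Sum>j<k. (T ^^ (n k - n j)) (v j))" for k
  have Tn: "bounded_linear (T ^^ m)" for m
  proof (induction m)
    case 0 show ?case by (simp add: id_def bounded_linear_ident)
  next
    case (Suc m) show ?case using bounded_linear_compose[OF T Suc] by (simp add: o_def)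
  qed
  \<comment> \<open>Under \<open>T ^^ n k\<close> the terms with \<open>j < k\<close> become the
    cross terms \<open>y k\<close>, the term \<open>j = k\<close> becomes \<open>v k\<close>, and
    those with \<open>j > k\<close> remain images under powers of \<open>R\<close>; the bound is the
    geometric tail of the latter.\<close>
  have near: "norm ((T ^^ n k) x - v k - y k) \<le> 2 * (1/2) ^ Suc k" for k
  proof -
    have s: "summable (\<lambda>j. (T ^^ n k) (f j))" by (rule bounded_linear.summable[OF Tn sf])
    have "(T ^^ n k) x = (\<Sum>j. (T ^^ n k) (f j))"
      unfolding x_def by (rule bounded_linear.suminf[OF Tn sf])
    also have "\<dots> = (\<Sum>j. (T ^^ n k) (f (j + Suc k))) + (\<Sum>j<Suc k. (T ^^ n k) (f j))"
      by (rule suminf_split_initial_segment[OF s])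
    also have "(\<Sum>j<Suc k. (T ^^ n k) (f j)) = y k + v k"
    proof -
      have "(T ^^ n k) (f j) = (T ^^ (n k - n j)) (v j)" if "j \<le> k" for j
        unfolding f_def by (rule funpow_right_inverse_le(1)[of T R, OF TR]) (use that sm in \<open>simp add: strict_mono_less_eq\<close>)
      thus ?thesis by (simp add: y_def)
    qed
    also have "(\<lambda>j. (T ^^ n k) (f (j + Suc k))) = (\<lambda>j. (R ^^ (n (j + Suc k) - n k)) (v (j + Suc k)))"
    proof
      fix j
      have "n k \<le> n (j + Suc k)" using sm by (simp add: strict_mono_less_eq)
      thus "(T ^^ n k) (f (j + Suc k)) = (R ^^ (n (j + Suc k) - n k)) (v (j + Suc k))"
        unfolding f_def by (rule funpow_right_inverse_le(2)[of T R, OF TR])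
    qed
    finally have eq: "(T ^^ n k) x - v k - y k = (\<Sum>j. (R ^^ (n (j + Suc k) - n k)) (v (j + Suc k)))" by simp
    have b: "norm ((R ^^ (n (j + Suc k) - n k)) (v (j + Suc k))) \<le> (1/2) ^ (j + Suc k)" for j
      by (intro L nd) auto
    have s2: "summable (\<lambda>j. (1/2::real) ^ (j + Suc k))" by (simp only: summable_iff_shift sg)
    have s1: "summable (\<lambda>j. norm ((R ^^ (n (j + Suc k) - n k)) (v (j + Suc k))))"
      by (rule summable_comparison_test[OF _ s2]) (use b in auto)
    have "norm ((T ^^ n k) x - v k - y k) \<le> (\<Sum>j. (1/2::real) ^ (j + Suc k))"
      unfolding eq by (rule order_trans[OF summable_norm[OF s1] suminf_le[OF b s1 s2]])
    also have "\<dots> = (\<Sum>j. (1/2) ^ j) * (1/2) ^ Suc k"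
      using suminf_mult2[of "\<lambda>j. (1/2::real) ^ j" "(1/2) ^ Suc k"] by (simp add: power_add)
    also have "(\<Sum>j. (1/2::real) ^ j) = 2" by (simp add: suminf_geometric)
    finally show ?thesis .
  qed
  show ?thesis
  proof (rule that[of x])
    fix F :: "('a \<Rightarrow> real) set" and e :: nat and \<epsilon> :: real
    assume F: "finite F" "\<And>\<psi>. \<psi> \<in> F \<Longrightarrow> bounded_linear \<psi>" and \<epsilon>: "\<epsilon> > 0"
    have near0: "(\<lambda>k. (T ^^ n k) x - v k - y k) \<longlonglongrightarrow> 0"
    proof (rule Lim_null_comparison)
      show "eventually (\<lambda>k. norm ((T ^^ n k) x - v k - y k) \<le> 2 * (1/2) ^ Suc k) sequentially"
        using near by simp
      show "(\<lambda>k. 2 * (1/2::real) ^ Suc k) \<longlonglongrightarrow> 0"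
        using LIMSEQ_power_zero[of "1/2::real"] by (simp add: LIMSEQ_power_zero)
    qed
    have "eventually (\<lambda>k. \<forall>\<psi>\<in>F. \<bar>\<psi> ((T ^^ n k) x - v k - y k)\<bar> < \<epsilon> / 2) sequentially"
    proof (intro eventually_ball_finite F ballI)
      fix \<psi> assume "\<psi> \<in> F"
      hence "(\<lambda>k. \<psi> ((T ^^ n k) x - v k - y k)) \<longlonglongrightarrow> 0"
        using bounded_linear.tendsto_zero[OF F(2) near0] by simp
      thus "eventually (\<lambda>k. \<bar>\<psi> ((T ^^ n k) x - v k - y k)\<bar> < \<epsilon> / 2) sequentially"
        by (rule order_tendstoD(2)[OF tendsto_rabs_zero]) (use \<epsilon> in simp)
    qed
    then obtain k0 where k0: "\<And>k \<psi>. k \<ge> k0 \<Longrightarrow> \<psi> \<in> F \<Longrightarrow> \<bar>\<psi> ((T ^^ n k) x - v k - y k)\<bar> < \<epsilon> / 2"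
      by (auto simp: eventually_sequentially)
    have sy: "summable (\<lambda>k. (2 / \<epsilon>)\<^sup>2 * (\<Sum>\<psi>\<in>F. (\<psi> (y k))\<^sup>2 / real (Suc k)))"
      unfolding y_def v_def
      by (intro summable_mult summable_sum summable_cross_terms F bessel) (auto simp: nS)
    \<comment> \<open>If every late \<open>k\<close> of class \<open>e\<close> failed, some
      functional in \<open>F\<close> would be at least \<open>\<epsilon> / 2\<close> on
      \<open>y k\<close>, and \<open>1 / (k + 1)\<close> restricted to the class would be dominated
      by the summable series \<open>sy\<close>.\<close>
    have "\<exists>k\<ge>k0. val2 k = e \<and> (\<forall>\<psi>\<in>F. \<bar>\<psi> (y k)\<bar> < \<epsilon> / 2)"
    proof (rule ccontr)
      assume neg: "\<not> ?thesis"
      have "norm (if val2 k = e then 1 / real (Suc k) else 0) \<le> (2 / \<epsilon>)\<^sup>2 * (\<Sum>\<psi>\<in>F. (\<psi> (y k))\<^sup>2 / real (Suc k))"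
        if "k \<ge> k0" for k
      proof (cases "val2 k = e")
        case True
        then obtain \<psi> where \<psi>: "\<psi> \<in> F" "\<bar>\<psi> (y k)\<bar> \<ge> \<epsilon> / 2" using neg \<open>k \<ge> k0\<close> by (force simp: not_less)
        have "(\<epsilon> / 2)\<^sup>2 \<le> (\<psi> (y k))\<^sup>2" using \<psi>(2) \<epsilon> by (simp add: abs_le_square_iff[symmetric])
        hence "(\<epsilon> / 2)\<^sup>2 / real (Suc k) \<le> (\<psi> (y k))\<^sup>2 / real (Suc k)" by (intro divide_right_mono) auto
        also have "\<dots> \<le> (\<Sum>\<psi>\<in>F. (\<psi> (y k))\<^sup>2 / real (Suc k))"
          using \<psi>(1) F(1) by (intro member_le_sum) auto
        finally have "(2 / \<epsilon>)\<^sup>2 * ((\<epsilon> / 2)\<^sup>2 / real (Suc k)) \<le> (2 / \<epsilon>)\<^sup>2 * (\<Sum>\<psi>\<in>F. (\<psi> (y k))\<^sup>2 / real (Suc k))"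
          by (intro mult_left_mono) auto
        moreover have "(2 / \<epsilon>)\<^sup>2 * ((\<epsilon> / 2)\<^sup>2 / real (Suc k)) = 1 / real (Suc k)"
          using \<epsilon> by (simp add: power_divide field_simps)
        ultimately show ?thesis using True by simp
      qed (auto intro!: mult_nonneg_nonneg sum_nonneg)
      hence "summable (\<lambda>k. if val2 k = e then 1 / real (Suc k) else 0)"
        by (intro summable_comparison_test[OF _ sy]) blast
      with not_summable_inverse_val2 show False by blast
    qed
    then obtain k where k: "k \<ge> k0" "val2 k = e" "\<forall>\<psi>\<in>F. \<bar>\<psi> (y k)\<bar> < \<epsilon> / 2" by blast
    have "\<bar>\<psi> ((T ^^ n k) x) - \<psi> (u e)\<bar> < \<epsilon>" if "\<psi> \<in> F" for \<psi>
    proof -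
      interpret \<psi>: bounded_linear \<psi> by (rule F(2)[OF that])
      have "\<psi> ((T ^^ n k) x) - \<psi> (u e) = \<psi> ((T ^^ n k) x - v k - y k) + \<psi> (y k)"
        using k(2) by (simp add: \<psi>.diff v_def)
      thus ?thesis using k0[OF k(1) that] k(3) that by fastforce
    qed
    thus "\<exists>n. \<forall>\<psi>\<in>F. \<bar>\<psi> ((T ^^ n) x) - \<psi> (u e)\<bar> < \<epsilon>" by blast
  qed
qed

lemma weakly_hypercyclic_criterion:
  fixes T R :: "'a::banach \<Rightarrow> 'a"
  assumes T: "bounded_linear T" and TR: "\<And>x. T (R x) = x"
    and R: "\<And>y. (\<lambda>m. (R ^^ m) y) \<longlonglongrightarrow> 0"
    and dense: "\<And>y \<epsilon>. \<epsilon> > 0 \<Longrightarrow> \<exists>i. norm (u i - y) < \<epsilon>"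
    and bessel: "\<And>i N c. (norm (\<Sum>m<N. c m *\<^sub>R (T ^^ m) (u (i::nat))))\<^sup>2 \<le> C i * (\<Sum>m<N. (c m)\<^sup>2)"
  obtains x where "\<And>F y \<epsilon>. finite F \<Longrightarrow> (\<And>\<psi>. \<psi> \<in> F \<Longrightarrow> bounded_linear (\<psi> :: 'a \<Rightarrow> real)) \<Longrightarrow> \<epsilon> > 0
    \<Longrightarrow> \<exists>n. \<forall>\<psi>\<in>F. \<bar>\<psi> ((T ^^ n) x) - \<psi> y\<bar> < \<epsilon>"
proof -
  have Tn0: "(T ^^ m) 0 = 0" for m
    by (induction m) (auto simp: linear_0[OF bounded_linear.linear[OF T]])
  \<comment> \<open>Each \<open>u i\<close> is listed infinitely often; the occurrences before its Bessel constant
    drops below \<open>(5/4) ^ e\<close> are replaced by \<open>0\<close>.\<close>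
  define u' where "u' e = (let i = fst (prod_decode e) in if C i \<le> (5/4) ^ e then u i else 0)" for e
  have b': "(norm (\<Sum>m<N. c m *\<^sub>R (T ^^ m) (u' e)))\<^sup>2 \<le> (5/4) ^ e * (\<Sum>m<N. (c m)\<^sup>2)" for e N c
  proof (cases "C (fst (prod_decode e)) \<le> (5/4) ^ e")
    case True
    hence "(norm (\<Sum>m<N. c m *\<^sub>R (T ^^ m) (u' e)))\<^sup>2 \<le> C (fst (prod_decode e)) * (\<Sum>m<N. (c m)\<^sup>2)"
      using bessel by (simp add: u'_def Let_def)
    also have "\<dots> \<le> (5/4) ^ e * (\<Sum>m<N. (c m)\<^sup>2)" using True by (intro mult_right_mono sum_nonneg) auto
    finally show ?thesis .
  qed (auto simp: u'_def Let_def Tn0 intro!: mult_nonneg_nonneg sum_nonneg)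
  obtain x where x: "\<And>F e \<epsilon>. finite F \<Longrightarrow> (\<And>\<psi>. \<psi> \<in> F \<Longrightarrow> bounded_linear (\<psi> :: 'a \<Rightarrow> real)) \<Longrightarrow> \<epsilon> > 0
    \<Longrightarrow> \<exists>n. \<forall>\<psi>\<in>F. \<bar>\<psi> ((T ^^ n) x) - \<psi> (u' e)\<bar> < \<epsilon>"
    using weakly_hypercyclic_criterion_normalized[OF T TR R b'] by blast
  \<comment> \<open>The code of a pair \<open>(i, l)\<close> is at least \<open>l\<close>, so a pair
    with large second component passes the threshold on the Bessel constant of
    \<open>u i\<close>.\<close>
  have ex: "\<exists>e. u' e = u i" for i
  proof -
    obtain l where l: "C i \<le> (5/4) ^ l" using real_arch_pow[of "5/4" "C i"] by (auto intro: less_imp_le)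
    have "(5/4::real) ^ l \<le> (5/4) ^ prod_encode (i, l)"
      by (intro power_increasing le_prod_encode_2) auto
    with l have "C i \<le> (5/4) ^ prod_encode (i, l)" by linarith
    hence "u' (prod_encode (i, l)) = u i" by (simp add: u'_def)
    thus ?thesis by blast
  qed
  show ?thesis
  proof (rule that[of x])
    fix F :: "('a \<Rightarrow> real) set" and y :: 'a and \<epsilon> :: real
    assume F: "finite F" "\<And>\<psi>. \<psi> \<in> F \<Longrightarrow> bounded_linear \<psi>" and \<epsilon>: "\<epsilon> > 0"
    have "\<exists>K>0. \<forall>x. \<bar>\<psi> x\<bar> \<le> K * norm x" if "\<psi> \<in> F" for \<psi>
      using bounded_linear.pos_bounded[OF F(2)[OF that]] by (metis mult.commute real_norm_def)
    then obtain K where K: "\<And>\<psi>. \<psi> \<in> F \<Longrightarrow> K \<psi> > 0" "\<And>\<psi> x. \<psi> \<in> F \<Longrightarrow> \<bar>\<psi> x\<bar> \<le> K \<psi> * norm x" by metis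
    define B where "B = 1 + sum K F"
    have B0: "B > 0" unfolding B_def by (intro add_pos_nonneg sum_nonneg) (use K(1) in \<open>auto simp: less_imp_le\<close>)
    have KB: "K \<psi> \<le> B" if "\<psi> \<in> F" for \<psi>
    proof -
      have "K \<psi> \<le> sum K F" using F(1) that K(1) by (intro member_le_sum) (auto simp: less_imp_le)
      thus ?thesis by (simp add: B_def)
    qed
    obtain i where i: "norm (u i - y) < \<epsilon> / (2 * B)" using dense[of "\<epsilon> / (2 * B)"] \<epsilon> B0 by auto
    obtain e where e: "u' e = u i" using ex by blast
    obtain n where n: "\<And>\<psi>. \<psi> \<in> F \<Longrightarrow> \<bar>\<psi> ((T ^^ n) x) - \<psi> (u' e)\<bar> < \<epsilon> / 2"
      using x[OF F, of "\<epsilon> / 2"] \<epsilon> by fastforce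
    have "\<bar>\<psi> ((T ^^ n) x) - \<psi> y\<bar> < \<epsilon>" if "\<psi> \<in> F" for \<psi>
    proof -
      have "\<bar>\<psi> (u i) - \<psi> y\<bar> \<le> K \<psi> * norm (u i - y)"
        using K(2)[OF that, of "u i - y"] linear_diff[OF bounded_linear.linear[OF F(2)[OF that]]] by simp
      also have "\<dots> \<le> B * norm (u i - y)" using KB[OF that] by (intro mult_right_mono) auto
      also have "\<dots> < \<epsilon> / 2" using i B0 by (simp add: field_simps)
      finally show ?thesis using n[OF that] unfolding e by linarith
    qed
    thus "\<exists>n. \<forall>\<psi>\<in>F. \<bar>\<psi> ((T ^^ n) x) - \<psi> y\<bar> < \<epsilon>" by blast
  qed
qed

section \<open>The space of square integrable functions on the circle\<close>

lemma space_circ [simp]: "space circ_meas = {0..1}"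
  by (simp add: circ_meas_def)

interpretation circ: finite_measure circ_meas
  by standard (simp add: circ_meas_def emeasure_restrict_space)

lemma measure_circ_space [simp]: "measure circ_meas {0..1} = 1"
  by (simp add: circ_meas_def measure_restrict_space)

lemma circ_continuous_measurable:
  assumes "continuous_on {0..1} f"
  shows "(f :: real \<Rightarrow> 'a::{euclidean_space}) \<in> borel_measurable circ_meas"
  unfolding circ_meas_def by (rule continuous_imp_measurable_on_sets_lebesgue[OF assms]) auto

text \<open>This rests on the completeness of Lebesgue measure. It serves functions given pointwise,
  such as \<open>bdry g\<close>, which are known only to agree almost everywhere with a measurable
  one.\<close>

lemma circ_AE_measurable:
  fixes f :: "real \<Rightarrow> complex"
  assumes "f \<in> borel_measurable circ_meas" "AE t in circ_meas. f t = g t"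
  shows "g \<in> borel_measurable circ_meas"
proof (rule measurableI)
  interpret complete_measure circ_meas
  proof
    fix A B :: "real set"
    assume "B \<subseteq> A" "A \<in> null_sets circ_meas"
    hence "B \<in> null_sets lebesgue" "B \<subseteq> {0..1}"
      by (auto simp: circ_meas_def null_sets_restrict_space intro: completion.complete2)
    thus "B \<in> sets circ_meas" by (auto simp: circ_meas_def sets_restrict_space)
  qed
  fix S :: "complex set" assume S: "S \<in> sets borel"
  show "g -` S \<inter> space circ_meas \<in> sets circ_meas"
  proof (rule in_sets_AE)
    show "f -` S \<inter> space circ_meas \<in> sets circ_meas" using assms(1) S by (rule measurable_sets)
    show "AE t in circ_meas. (t \<in> f -` S \<inter> space circ_meas) = (t \<in> g -` S \<inter> space circ_meas)"
      using assms(2) by eventually_elim auto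
  qed auto
qed auto

lemma borel_measurable_cnj [measurable]:
  "f \<in> borel_measurable M \<Longrightarrow> (\<lambda>t. cnj (f t)) \<in> borel_measurable M"
  by (rule measurable_compose[OF _ borel_measurable_continuous_onI]) (auto intro: continuous_intros)

lemma integrable_L2T_mult:
  assumes "L2T f" "L2T g"
  shows "integrable circ_meas (\<lambda>t. f t * g t)"
proof (rule Bochner_Integration.integrable_bound)
  show "integrable circ_meas (\<lambda>t. (cmod (f t))\<^sup>2 + (cmod (g t))\<^sup>2)"
    using assms by (auto simp: L2T_def)
  show "(\<lambda>t. f t * g t) \<in> borel_measurable circ_meas" using assms by (auto simp: L2T_def)
  have "a * b \<le> a\<^sup>2 + b\<^sup>2" if "0 \<le> a" "0 \<le> b" for a b :: real
  proof -
    have "a * b \<le> 2 * a * b" using that by (simp add: mult_le_cancel_right1)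
    thus ?thesis using sum_squares_bound[of a b] by linarith
  qed
  thus "AE t in circ_meas. norm (f t * g t) \<le> norm ((cmod (f t))\<^sup>2 + (cmod (g t))\<^sup>2)"
    by (simp add: norm_mult)
qed

lemma L2T_measurable: "L2T f \<Longrightarrow> f \<in> borel_measurable circ_meas"
  by (simp add: L2T_def)

lemma L2T_cnj: "L2T f \<Longrightarrow> L2T (\<lambda>t. cnj (f t))"
  by (auto simp: L2T_def borel_measurable_cnj)

lemma L2T_mult_bounded:
  assumes "L2T f" "m \<in> borel_measurable circ_meas" "AE t in circ_meas. cmod (m t) \<le> B"
  shows "L2T (\<lambda>t. m t * f t)"
  unfolding L2T_def
proof
  show "(\<lambda>t. m t * f t) \<in> borel_measurable circ_meas" using assms by (auto simp: L2T_def)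
  show "integrable circ_meas (\<lambda>t. (cmod (m t * f t))\<^sup>2)"
  proof (rule Bochner_Integration.integrable_bound)
    show "integrable circ_meas (\<lambda>t. B\<^sup>2 * (cmod (f t))\<^sup>2)" using assms by (auto simp: L2T_def)
    show "(\<lambda>t. (cmod (m t * f t))\<^sup>2) \<in> borel_measurable circ_meas" using assms by (auto simp: L2T_def)
    show "AE t in circ_meas. norm ((cmod (m t * f t))\<^sup>2) \<le> norm (B\<^sup>2 * (cmod (f t))\<^sup>2)"
      using assms(3) by eventually_elim (auto simp: norm_mult power_mult_distrib intro!: mult_right_mono power_mono)
  qed
qed

lemma L2T_const [simp]: "L2T (\<lambda>_. c)"
  by (simp add: L2T_def)

lemma L2T_bounded:
  assumes "m \<in> borel_measurable circ_meas" "AE t in circ_meas. cmod (m t) \<le> B"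
  shows "L2T m"
  using L2T_mult_bounded[OF L2T_const[of 1] assms] by simp

lemma L2T_scale: "L2T f \<Longrightarrow> L2T (\<lambda>t. c * f t)"
  by (rule L2T_mult_bounded[where B="cmod c"]) auto

lemma L2T_add:
  assumes "L2T f" "L2T g"
  shows "L2T (\<lambda>t. f t + g t)"
  unfolding L2T_def
proof
  show "(\<lambda>t. f t + g t) \<in> borel_measurable circ_meas" using assms by (auto simp: L2T_def)
  show "integrable circ_meas (\<lambda>t. (cmod (f t + g t))\<^sup>2)"
  proof (rule Bochner_Integration.integrable_bound)
    show "integrable circ_meas (\<lambda>t. 2 * (cmod (f t))\<^sup>2 + 2 * (cmod (g t))\<^sup>2)" using assms by (auto simp: L2T_def)
    show "(\<lambda>t. (cmod (f t + g t))\<^sup>2) \<in> borel_measurable circ_meas" using assms by (auto simp: L2T_def)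
    have "(cmod (a + b))\<^sup>2 \<le> 2 * (cmod a)\<^sup>2 + 2 * (cmod b)\<^sup>2" for a b
    proof -
      have "(cmod (a + b))\<^sup>2 \<le> (cmod a + cmod b)\<^sup>2" by (intro power_mono norm_triangle_ineq) auto
      thus ?thesis using sum_squares_bound[of "cmod a" "cmod b"] by (simp add: power2_sum)
    qed
    thus "AE t in circ_meas. norm ((cmod (f t + g t))\<^sup>2) \<le> norm (2 * (cmod (f t))\<^sup>2 + 2 * (cmod (g t))\<^sup>2)"
      by simp
  qed
qed

lemma L2T_diff: "L2T f \<Longrightarrow> L2T g \<Longrightarrow> L2T (\<lambda>t. f t - g t)"
  using L2T_add[of f "\<lambda>t. (-1) * g t"] L2T_scale[of g "-1"] by simp

lemma L2T_sum: "(\<And>i. i \<in> I \<Longrightarrow> L2T (f i)) \<Longrightarrow> L2T (\<lambda>t. \<Sum>i\<in>I. f i t)"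
  by (induction I rule: infinite_finite_induct) (auto intro: L2T_add)

lemma integrable_L2T: "L2T f \<Longrightarrow> integrable circ_meas f"
  using integrable_L2T_mult[of f "\<lambda>_. 1"] by simp

lemma integrable_ip: "L2T f \<Longrightarrow> L2T g \<Longrightarrow> integrable circ_meas (\<lambda>t. f t * cnj (g t))"
  by (intro integrable_L2T_mult L2T_cnj)

lemma ip_add_left: "L2T f \<Longrightarrow> L2T g \<Longrightarrow> L2T h \<Longrightarrow> ip (\<lambda>t. f t + g t) h = ip f h + ip g h"
  by (simp add: ip_def distrib_right integrable_ip)

lemma ip_diff_left: "L2T f \<Longrightarrow> L2T g \<Longrightarrow> L2T h \<Longrightarrow> ip (\<lambda>t. f t - g t) h = ip f h - ip g h"
  by (simp add: ip_def left_diff_distrib integrable_ip)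

lemma ip_scale_left: "ip (\<lambda>t. c * f t) h = c * ip f h"
  by (simp add: ip_def mult.assoc)

lemma ip_cnj: "ip g f = cnj (ip f g)"
  unfolding ip_def by (simp add: mult.commute flip: Bochner_Integration.integral_cnj)

lemma ip_add_right:
  assumes "L2T f" "L2T g" "L2T h"
  shows "ip h (\<lambda>t. f t + g t) = ip h f + ip h g"
  unfolding ip_cnj[of h] ip_add_left[OF assms] by simp

lemma ip_sum_left: "(\<And>i. i \<in> I \<Longrightarrow> L2T (f i)) \<Longrightarrow> L2T h \<Longrightarrow> ip (\<lambda>t. \<Sum>i\<in>I. f i t) h = (\<Sum>i\<in>I. ip (f i) h)"
  unfolding ip_def sum_distrib_right by (rule Bochner_Integration.integral_sum) (auto intro: integrable_ip)

lemma norm2_nonneg [simp]: "norm2 f \<ge> 0"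
  by (simp add: norm2_def)

lemma norm2_power2: "(norm2 f)\<^sup>2 = (LINT t|circ_meas. (cmod (f t))\<^sup>2)"
  by (simp add: norm2_def)

lemma ip_self: "ip f f = of_real ((norm2 f)\<^sup>2)"
  unfolding norm2_power2 ip_def complex_norm_square[symmetric] by (rule integral_complex_of_real)

lemma norm2_cong_AE:
  assumes "f \<in> borel_measurable circ_meas" "g \<in> borel_measurable circ_meas" "AE t in circ_meas. f t = g t"
  shows "norm2 f = norm2 g"
  unfolding norm2_def by (rule arg_cong[where f=sqrt], rule integral_cong_AE) (use assms in \<open>auto elim: eventually_mono\<close>)

lemma ip_cong_AE:
  assumes "f \<in> borel_measurable circ_meas" "g \<in> borel_measurable circ_meas" "AE t in circ_meas. f t = g t"
    "h \<in> borel_measurable circ_meas"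
  shows "ip f h = ip g h"
  unfolding ip_def by (rule integral_cong_AE) (use assms in \<open>auto elim: eventually_mono\<close>)

lemma norm2_eq_0_iff: "L2T f \<Longrightarrow> norm2 f = 0 \<longleftrightarrow> (AE t in circ_meas. f t = 0)"
  unfolding norm2_def L2T_def by (simp add: integral_nonneg_eq_0_iff_AE)

lemma norm2_scale: "norm2 (\<lambda>t. c * f t) = cmod c * norm2 f"
  by (simp add: norm2_def norm_mult power_mult_distrib real_sqrt_mult)

lemma norm2_minus_commute: "norm2 (\<lambda>t. f t - g t) = norm2 (\<lambda>t. g t - f t)"
  by (simp add: norm2_def norm_minus_commute)

lemma Cauchy_Schwarz_norm2:
  assumes "L2T f" "L2T g"
  shows "(LINT t|circ_meas. cmod (f t * g t)) \<le> norm2 f * norm2 g"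
proof (cases "norm2 f = 0 \<or> norm2 g = 0")
  case True
  have "(LINT t|circ_meas. cmod (f t * g t)) = (LINT t|circ_meas. 0)"
  proof (rule integral_cong_AE)
    show "AE t in circ_meas. cmod (f t * g t) = 0"
      using True assms by (auto simp: norm2_eq_0_iff elim: eventually_mono)
  qed (use assms in \<open>auto simp: L2T_def\<close>)
  thus ?thesis by simp
next
  case False
  hence pos: "norm2 f > 0" "norm2 g > 0" using norm2_nonneg[of f] norm2_nonneg[of g] by linarith+
  \<comment> \<open>The scaling balances the two sides: the inequality
    \<open>a * b <= (s * a^2 + b^2 / s) / 2\<close> integrates to exactly the product of the
    norms.\<close>
  define s where "s = norm2 g / norm2 f"
  have s: "s > 0" using pos by (simp add: s_def)
  have "a * b \<le> (s * a\<^sup>2 + b\<^sup>2 / s) / 2" for a b :: real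
  proof -
    have "0 \<le> (s * a - b)\<^sup>2 / s" using s by simp
    also have "\<dots> = s * a\<^sup>2 + b\<^sup>2 / s - 2 * (a * b)" using s by (simp add: field_simps power2_eq_square)
    finally show ?thesis by simp
  qed
  hence "(LINT t|circ_meas. cmod (f t * g t)) \<le> (LINT t|circ_meas. (s * (cmod (f t))\<^sup>2 + (cmod (g t))\<^sup>2 / s) / 2)"
    using assms integrable_norm[OF integrable_L2T_mult[OF assms]]
    by (intro integral_mono) (auto simp: norm_mult L2T_def)
  also have "\<dots> = (s * (norm2 f)\<^sup>2 + (norm2 g)\<^sup>2 / s) / 2"
    using assms by (simp add: norm2_power2 L2T_def)
  also have "\<dots> = norm2 f * norm2 g" using pos by (simp add: s_def field_simps power2_eq_square)
  finally show ?thesis .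
qed

lemma ip_le_norm2:
  assumes "L2T f" "L2T g"
  shows "cmod (ip f g) \<le> norm2 f * norm2 g"
proof -
  have "cmod (ip f g) \<le> (LINT t|circ_meas. cmod (f t * cnj (g t)))"
    unfolding ip_def by (rule integral_norm_bound)
  also have "\<dots> = (LINT t|circ_meas. cmod (f t * g t))" by (simp add: norm_mult)
  also have "\<dots> \<le> norm2 f * norm2 g" by (rule Cauchy_Schwarz_norm2[OF assms])
  finally show ?thesis .
qed

lemma norm2_add_power2:
  assumes "L2T f" "L2T g"
  shows "(norm2 (\<lambda>t. f t + g t))\<^sup>2 = (norm2 f)\<^sup>2 + (norm2 g)\<^sup>2 + 2 * Re (ip f g)"
proof -
  have "complex_of_real ((norm2 (\<lambda>t. f t + g t))\<^sup>2) = ip f f + ip g g + (ip f g + ip g f)"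
  proof -
    have "ip (\<lambda>t. f t + g t) (\<lambda>t. f t + g t) = ip f (\<lambda>t. f t + g t) + ip g (\<lambda>t. f t + g t)"
      using assms by (intro ip_add_left L2T_add)
    also have "ip f (\<lambda>t. f t + g t) = ip f f + ip f g"
      using assms by (intro ip_add_right)
    also have "ip g (\<lambda>t. f t + g t) = ip g f + ip g g"
      using assms by (intro ip_add_right)
    finally show ?thesis unfolding ip_self by simp
  qed
  also have "\<dots> = complex_of_real ((norm2 f)\<^sup>2 + (norm2 g)\<^sup>2 + 2 * Re (ip f g))"
    unfolding ip_self ip_cnj[of g f] by (simp add: complex_add_cnj)
  finally show ?thesis using of_real_eq_iff by blast
qed

lemma norm2_triangle:
  assumes "L2T f" "L2T g"
  shows "norm2 (\<lambda>t. f t + g t) \<le> norm2 f + norm2 g"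
proof (rule power2_le_imp_le)
  have "Re (ip f g) \<le> norm2 f * norm2 g" using ip_le_norm2[OF assms] complex_Re_le_cmod order_trans by blast
  thus "(norm2 (\<lambda>t. f t + g t))\<^sup>2 \<le> (norm2 f + norm2 g)\<^sup>2"
    using norm2_add_power2[OF assms] by (simp add: power2_sum)
qed simp

lemma norm2_triangle_diff:
  assumes "L2T f" "L2T g" "L2T h"
  shows "norm2 (\<lambda>t. f t - h t) \<le> norm2 (\<lambda>t. f t - g t) + norm2 (\<lambda>t. g t - h t)"
  using norm2_triangle[OF L2T_diff[OF assms(1,2)] L2T_diff[OF assms(2,3)]] by simp

lemma integral_norm_le_norm2:
  assumes "L2T f"
  shows "(LINT t|circ_meas. cmod (f t)) \<le> norm2 f"
  using Cauchy_Schwarz_norm2[OF assms L2T_const[of 1]] by (simp add: norm2_def)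

lemma norm2_mult_le:
  assumes "L2T f" "m \<in> borel_measurable circ_meas" "AE t in circ_meas. cmod (m t) \<le> B"
  shows "norm2 (\<lambda>t. m t * f t) \<le> B * norm2 f"
proof -
  \<comment> \<open>A negative \<open>B\<close> would force the bound to fail everywhere,
    contradicting total mass 1.\<close>
  have B0: "0 \<le> B"
  proof (rule ccontr)
    assume "\<not> 0 \<le> B"
    hence "\<not> cmod (m t) \<le> B" for t by (meson norm_ge_zero order_trans)
    hence "AE t in circ_meas. False" using assms(3) by simp
    hence "emeasure circ_meas (space circ_meas) = 0" by (simp only: eventually_False ae_filter_eq_bot_iff)
    thus False using measure_circ_space by (simp add: measure_def del: measure_circ_space)
  qed
  show ?thesis
  proof (rule power2_le_imp_le)
    have "(norm2 (\<lambda>t. m t * f t))\<^sup>2 \<le> (LINT t|circ_meas. B\<^sup>2 * (cmod (f t))\<^sup>2)"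
      unfolding norm2_power2
    proof (rule integral_mono_AE)
      show "AE t in circ_meas. (cmod (m t * f t))\<^sup>2 \<le> B\<^sup>2 * (cmod (f t))\<^sup>2"
        using assms(3) by eventually_elim (auto simp: norm_mult power_mult_distrib intro!: mult_right_mono power_mono)
    qed (use assms L2T_mult_bounded[OF assms] in \<open>auto simp: L2T_def\<close>)
    thus "(norm2 (\<lambda>t. m t * f t))\<^sup>2 \<le> (B * norm2 f)\<^sup>2" by (simp add: power_mult_distrib norm2_power2)
  qed (use B0 in auto)
qed

lemma nn_integral_norm2:
  assumes "L2T f"
  shows "(\<integral>\<^sup>+t. ennreal ((cmod (f t))\<^sup>2) \<partial>circ_meas) = ennreal ((norm2 f)\<^sup>2)"
  unfolding norm2_power2 by (rule nn_integral_eq_integral) (use assms in \<open>auto simp: L2T_def\<close>)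

text \<open>Along a fast subsequence the increments have norms below \<open>(1/2) ^ k\<close>; the
  mean of a modulus is at most its quadratic mean, so they are absolutely summable almost
  everywhere. Fatou's lemma for integrals then carries the Cauchy bound of the full sequence over to
  the pointwise limit.\<close>

lemma L2T_complete:
  assumes f: "\<And>n. L2T (f n)"
    and cauchy: "\<And>e. e > 0 \<Longrightarrow> \<exists>N. \<forall>m\<ge>N. \<forall>n\<ge>N. norm2 (\<lambda>t. f m t - f n t) < e"
  obtains l where "L2T l" "(\<lambda>n. norm2 (\<lambda>t. f n t - l t)) \<longlonglongrightarrow> 0"
proof -
  have "\<exists>N. \<forall>m\<ge>N. \<forall>n\<ge>N. norm2 (\<lambda>t. f m t - f n t) < (1/2) ^ k" for k
    by (rule cauchy) simp
  then obtain N where N: "\<And>k m n. m \<ge> N k \<Longrightarrow> n \<ge> N k \<Longrightarrow> norm2 (\<lambda>t. f m t - f n t) < (1/2) ^ k" by metis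
  \<comment> \<open>Partial sums give monotonicity together with \<open>r k >= N k\<close>; the
    extra \<open>k\<close> ensures that \<open>r k\<close> eventually exceeds every fixed
    \<open>N j\<close>.\<close>
  define r where "r k = (\<Sum>i\<le>k. N i) + k" for k
  have rN: "r k \<ge> N k" for k
  proof -
    have "N k \<le> (\<Sum>i\<le>k. N i)" by (rule member_le_sum) auto
    thus ?thesis by (simp add: r_def)
  qed
  have rN': "r (Suc k) \<ge> N k" for k using rN[of k] by (simp add: r_def)
  have rk: "r k \<ge> k" for k by (simp add: r_def)
  define d where "d k t = cmod (f (r (Suc k)) t - f (r k) t)" for k t
  have fm [measurable]: "f n \<in> borel_measurable circ_meas" for n using f by (simp add: L2T_def)
  have dm [measurable]: "d k \<in> borel_measurable circ_meas" for k
    unfolding d_def by measurable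
  have "(\<integral>\<^sup>+t. ennreal (d k t) \<partial>circ_meas) \<le> ennreal ((1/2) ^ k)" for k
  proof -
    have L: "L2T (\<lambda>t. f (r (Suc k)) t - f (r k) t)" by (intro L2T_diff f)
    have "(\<integral>\<^sup>+t. ennreal (d k t) \<partial>circ_meas) = ennreal (LINT t|circ_meas. d k t)"
      unfolding d_def by (rule nn_integral_eq_integral) (use integrable_norm[OF integrable_L2T[OF L]] in auto)
    also have "\<dots> \<le> ennreal ((1/2) ^ k)"
      unfolding d_def using integral_norm_le_norm2[OF L] N[of k "r (Suc k)" "r k"] rN rN'
      by (intro ennreal_leI) (meson less_imp_le order_trans)
    finally show ?thesis .
  qed
  hence "(\<integral>\<^sup>+t. (\<Sum>k. ennreal (d k t)) \<partial>circ_meas) \<le> (\<Sum>k. ennreal ((1/2) ^ k))"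
    by (subst nn_integral_suminf) (auto intro!: suminf_le)
  also have "\<dots> = ennreal (\<Sum>k. (1/2) ^ k)" by (intro suminf_ennreal2) auto
  also have "\<dots> < \<infinity>" by simp
  finally have "AE t in circ_meas. (\<Sum>k. ennreal (d k t)) \<noteq> \<infinity>"
    by (intro nn_integral_PInf_AE) auto
  hence conv: "AE t in circ_meas. convergent (\<lambda>k. f (r k) t)"
  proof eventually_elim
    case (elim t)
    hence "summable (\<lambda>k. d k t)" by (intro summable_suminf_not_top) (auto simp: d_def)
    hence "summable (\<lambda>k. f (r (Suc k)) t - f (r k) t)" unfolding d_def by (rule summable_norm_cancel)
    hence "convergent (\<lambda>n. (\<Sum>k<n. f (r (Suc k)) t - f (r k) t) + f (r 0) t)"
      by (intro convergent_add convergent_const) (simp add: summable_iff_convergent)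
    moreover have "(\<Sum>k<n. f (r (Suc k)) t - f (r k) t) + f (r 0) t = f (r n) t" for n
      using sum_lessThan_telescope[of "\<lambda>k. f (r k) t" n] by simp
    ultimately show ?case by simp
  qed
  define l where "l t = lim (\<lambda>k. f (r k) t)" for t
  have lm: "l \<in> borel_measurable circ_meas"
    unfolding l_def by (rule borel_measurable_lim_metric) measurable
  have lim: "AE t in circ_meas. (\<lambda>k. f (r k) t) \<longlonglongrightarrow> l t"
    using conv by eventually_elim (simp add: l_def convergent_LIMSEQ_iff)
  have key: "L2T (\<lambda>t. f n t - l t) \<and> norm2 (\<lambda>t. f n t - l t) \<le> (1/2) ^ j" if n: "n \<ge> N j" for n j
  proof -
    have "(\<integral>\<^sup>+t. ennreal ((cmod (f n t - l t))\<^sup>2) \<partial>circ_meas)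
        = (\<integral>\<^sup>+t. liminf (\<lambda>k. ennreal ((cmod (f n t - f (r k) t))\<^sup>2)) \<partial>circ_meas)"
    proof (rule nn_integral_cong_AE)
      show "AE t in circ_meas. ennreal ((cmod (f n t - l t))\<^sup>2) = liminf (\<lambda>k. ennreal ((cmod (f n t - f (r k) t))\<^sup>2))"
        using lim
      proof eventually_elim
        case (elim t)
        hence "(\<lambda>k. ennreal ((cmod (f n t - f (r k) t))\<^sup>2)) \<longlonglongrightarrow> ennreal ((cmod (f n t - l t))\<^sup>2)"
          by (intro tendsto_ennrealI tendsto_intros)
        thus ?case by (rule lim_imp_Liminf[symmetric, rotated]) simp
      qed
    qed
    also have "\<dots> \<le> liminf (\<lambda>k. \<integral>\<^sup>+t. ennreal ((cmod (f n t - f (r k) t))\<^sup>2) \<partial>circ_meas)"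
      by (rule nn_integral_liminf) measurable
    also have "\<dots> \<le> ennreal (((1/2) ^ j)\<^sup>2)"
    proof (rule Liminf_le)
      have "norm2 (\<lambda>t. f n t - f (r k) t) \<le> (1/2) ^ j" if "k \<ge> N j" for k
        using N[OF n, of "r k"] rk[of k] that by (simp add: less_imp_le)
      hence "(\<integral>\<^sup>+t. ennreal ((cmod (f n t - f (r k) t))\<^sup>2) \<partial>circ_meas) \<le> ennreal (((1/2) ^ j)\<^sup>2)" if "k \<ge> N j" for k
        using that by (subst nn_integral_norm2) (auto intro!: L2T_diff f ennreal_leI power_mono)
      thus "\<forall>\<^sub>F k in sequentially. (\<integral>\<^sup>+t. ennreal ((cmod (f n t - f (r k) t))\<^sup>2) \<partial>circ_meas) \<le> ennreal (((1/2) ^ j)\<^sup>2)"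
        by (auto simp: eventually_sequentially)
    qed simp
    finally have le: "(\<integral>\<^sup>+t. ennreal ((cmod (f n t - l t))\<^sup>2) \<partial>circ_meas) \<le> ennreal (((1/2) ^ j)\<^sup>2)" .
    have L: "L2T (\<lambda>t. f n t - l t)"
      unfolding L2T_def
    proof
      show m: "(\<lambda>t. f n t - l t) \<in> borel_measurable circ_meas" using lm by measurable
      show "integrable circ_meas (\<lambda>t. (cmod (f n t - l t))\<^sup>2)"
        by (rule integrableI_bounded) (use m le in \<open>auto intro: le_less_trans\<close>)
    qed
    have "(norm2 (\<lambda>t. f n t - l t))\<^sup>2 \<le> ((1/2) ^ j)\<^sup>2" using le unfolding nn_integral_norm2[OF L]
      by (subst (asm) ennreal_le_iff) auto
    with L show ?thesis by (auto intro: power2_le_imp_le)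
  qed
  have "L2T (\<lambda>t. f (N 0) t - (f (N 0) t - l t))" by (rule L2T_diff[OF f]) (use key[OF order_refl] in auto)
  hence Ll: "L2T l" by simp
  have "(\<lambda>n. norm2 (\<lambda>t. f n t - l t)) \<longlonglongrightarrow> 0"
  proof (rule LIMSEQ_I)
    fix e :: real assume "e > 0"
    then obtain j where j: "(1/2) ^ j < e" using real_arch_pow_inv[of e "1/2"] by auto
    show "\<exists>no. \<forall>n\<ge>no. norm (norm2 (\<lambda>t. f n t - l t) - 0) < e"
      using key j by (intro exI[of _ "N j"]) (auto intro: le_less_trans)
  qed
  with Ll show ?thesis by (rule that)
qed

section \<open>Fourier series and the Hardy space\<close>

definition tchar :: "int \<Rightarrow> real \<Rightarrow> complex" where
  "tchar n t = cis (2 * pi * of_int n * t)"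

lemma continuous_on_tchar: "continuous_on S (tchar n)"
  unfolding tchar_def cis_conv_exp by (intro continuous_intros)

lemma tchar_measurable [measurable]: "tchar n \<in> borel_measurable circ_meas"
  by (rule circ_continuous_measurable[OF continuous_on_tchar])

lemma norm_tchar [simp]: "cmod (tchar n t) = 1"
  by (simp add: tchar_def)

lemma L2T_tchar [simp]: "L2T (tchar n)"
  by (rule L2T_bounded[where B=1]) auto

lemma tchar_0 [simp]: "tchar 0 t = 1"
  by (simp add: tchar_def)

lemma tchar_add: "tchar (m + n) t = tchar m t * tchar n t"
  by (simp add: tchar_def cis_mult algebra_simps)

lemma cnj_tchar: "cnj (tchar n t) = tchar (- n) t"
  by (simp add: tchar_def flip: cis_cnj)

lemma tchar_of_nat: "tchar (int n) t = cis (2 * pi * t) ^ n"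
proof -
  have "2 * pi * of_int (int n) * t = real n * (2 * pi * t)" by simp
  thus ?thesis unfolding tchar_def by (simp only: Complex.DeMoivre)
qed

lemma fourier_coeff_eq_ip: "fourier_coeff f n = ip f (tchar n)"
  by (simp add: fourier_coeff_def ip_def cnj_tchar) (simp add: tchar_def)

lemma integral_circ_tchar: "(LINT t|circ_meas. tchar n t) = (if n = 0 then 1 else 0)"
proof (cases "n = 0")
  case False
  have eq: "(LINT t|circ_meas. tchar n t) = integral {0..1} (tchar n)"
    using integrable_L2T[OF L2T_tchar[of n]] unfolding circ_meas_def
    by (intro lebesgue_integral_eq_integral) auto
  define c where "c = 2 * complex_of_real pi * \<i> * of_int n"
  have c: "c \<noteq> 0" using False by (simp add: c_def)
  have te: "tchar n t = exp (c * of_real t)" for t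
    by (simp add: tchar_def cis_conv_exp c_def mult_ac)
  have "((\<lambda>t. exp (c * of_real t)) has_integral (exp (c * of_real 1) / c - exp (c * of_real 0) / c)) {0..1}"
  proof (rule fundamental_theorem_of_calculus)
    fix t :: real assume "t \<in> {0..1}"
    have "((\<lambda>z. exp (c * z) / c) has_field_derivative exp (c * of_real t)) (at (of_real t))"
      using c by (auto intro!: derivative_eq_intros)
    hence "((\<lambda>t. exp (c * of_real t) / c) has_vector_derivative exp (c * of_real t)) (at t within {0..1})"
      by (rule has_vector_derivative_real_field)
    thus "((\<lambda>t. exp (c * of_real t) / c) has_vector_derivative exp (c * of_real t)) (at t within {0..1})" .
  qed auto
  moreover have "exp (c * of_real 1) = 1"
    using te[of 1, symmetric] by (simp add: tchar_def cis_multiple_2pi)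
  ultimately have "integral {0..1} (\<lambda>t. tchar n t) = 0" unfolding te[abs_def]
    by (subst integral_unique) (assumption, simp)
  thus ?thesis using eq False by simp
qed simp

lemma ip_tchar: "ip (tchar m) (tchar n) = (if m = n then 1 else 0)"
  using integral_circ_tchar[of "m - n"] by (simp add: ip_def cnj_tchar flip: tchar_add)

text \<open>A continuous map from a compact set into a Hausdorff space is closed, hence a quotient
  map onto its image. It is used to let functions on \<open>{0..1}\<close> with equal end values
  descend to the circle.\<close>

lemma continuous_on_compact_quotient:
  fixes p :: "'a::t2_space \<Rightarrow> 'b::t2_space" and \<phi> :: "'b \<Rightarrow> 'c::t1_space"
  assumes K: "compact K" and p: "continuous_on K p" and \<phi>: "continuous_on K (\<lambda>x. \<phi> (p x))"
  shows "continuous_on (p ` K) \<phi>"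
proof -
  have "closed (p ` K)" by (intro compact_imp_closed compact_continuous_image K p)
  moreover have "closed (\<phi> -` B \<inter> p ` K)" if "closed B" for B
  proof -
    have "closed ((\<lambda>x. \<phi> (p x)) -` B \<inter> K)"
      using \<phi> that compact_imp_closed[OF K] by (simp add: continuous_on_closed_vimage)
    hence "compact (K \<inter> ((\<lambda>x. \<phi> (p x)) -` B \<inter> K))" by (intro compact_Int_closed K)
    hence "compact (p ` (K \<inter> ((\<lambda>x. \<phi> (p x)) -` B \<inter> K)))"
      by (rule compact_continuous_image[rotated]) (use p in \<open>auto intro: continuous_on_subset\<close>)
    moreover have "\<phi> -` B \<inter> p ` K = p ` (K \<inter> ((\<lambda>x. \<phi> (p x)) -` B \<inter> K))" by auto
    ultimately show ?thesis by (simp add: compact_imp_closed)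
  qed
  ultimately show ?thesis by (simp add: continuous_on_closed_vimage)
qed

lemma cis_circle_inj:
  assumes "s \<in> {0..1}" "t \<in> {0..1}" "cis (2 * pi * s) = cis (2 * pi * t)"
  shows "s = t \<or> {s, t} = {0, 1}"
proof -
  have "cis (2 * pi * (s - t)) = 1" using assms(3) by (simp add: right_diff_distrib flip: cis_divide)
  hence "exp (\<i> * of_real (2 * pi * (s - t))) = 1" by (simp add: cis_conv_exp)
  then obtain n :: int where "2 * pi * (s - t) = of_int (2 * n) * pi" by (auto simp: exp_eq_1)
  hence n: "s - t = of_int n" by simp
  hence "\<bar>real_of_int n\<bar> \<le> 1" using assms by auto
  hence "n = -1 \<or> n = 0 \<or> n = 1" by linarith
  thus ?thesis using n assms by auto
qed

lemma cis_circle_surj: "(\<lambda>t. cis (2 * pi * t)) ` {0..1} = sphere 0 1"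
proof
  show "sphere 0 1 \<subseteq> (\<lambda>t. cis (2 * pi * t)) ` {0..1}"
  proof
    fix z :: complex assume "z \<in> sphere 0 1"
    hence "z = cis (2 * pi * (Arg2pi z / (2 * pi)))"
      using Arg2pi_eq[of z] by (simp add: cis_conv_exp)
    thus "z \<in> (\<lambda>t. cis (2 * pi * t)) ` {0..1}"
      using Arg2pi_ge_0[of z] Arg2pi_lt_2pi[of z] by (intro image_eqI[of _ _ "Arg2pi z / (2 * pi)"]) auto
  qed
qed auto

text \<open>A measurable function is an almost everywhere limit of continuous ones; after truncation
  these live on the circle, where Stone-Weierstrass applies. The bound 2 is 1 plus an approximation
  error of at most 1, and is what later dominated convergence relies on.\<close>

lemma circ_polynomial_approx:
  fixes m :: "real \<Rightarrow> real"
  assumes m: "m \<in> borel_measurable circ_meas" and m1: "\<And>t. \<bar>m t\<bar> \<le> 1"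
  obtains p :: "nat \<Rightarrow> complex \<Rightarrow> real"
    where "\<And>n. real_polynomial_function (p n)" "\<And>n z. cmod z = 1 \<Longrightarrow> \<bar>p n z\<bar> \<le> 2"
      "AE t in circ_meas. (\<lambda>n. p n (cis (2 * pi * t))) \<longlonglongrightarrow> m t"
proof -
  have "m measurable_on {0..1}" using m by (simp add: measurable_on_iff_borel_measurable circ_meas_def)
  then obtain N g where N: "negligible N" and g: "\<And>n. continuous_on UNIV (g n)"
    and lim: "\<And>x. x \<notin> N \<Longrightarrow> (\<lambda>n. g n x) \<longlonglongrightarrow> (if x \<in> {0..1} then m x else 0)"
    unfolding measurable_on_def by blast
  \<comment> \<open>Clamping keeps the values in \<open>[-1, 1]\<close>. The second factor vanishes
    at 0 and 1, so that the function is periodic, and it equals 1 from some \<open>n\<close> on at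
    each interior point.\<close>
  define c where "c n t = max (-1) (min 1 (g n t)) * min 1 (real n * (t * (1 - t)))" for n t
  have cc: "continuous_on {0..1} (c n)" for n
    unfolding c_def by (intro continuous_intros continuous_on_subset[OF g]) auto
  have c1: "\<bar>c n t\<bar> \<le> 1" if "t \<in> {0..1}" for n t
  proof -
    have "0 \<le> real n * (t * (1 - t))" using that by auto
    hence "\<bar>max (-1) (min 1 (g n t))\<bar> * \<bar>min 1 (real n * (t * (1 - t)))\<bar> \<le> 1 * 1"
      by (intro mult_mono) auto
    thus ?thesis by (simp add: c_def abs_mult)
  qed
  define \<phi> where "\<phi> n z = c n (SOME t. t \<in> {0..1} \<and> cis (2 * pi * t) = z)" for n z
  have \<phi>c: "\<phi> n (cis (2 * pi * t)) = c n t" if "t \<in> {0..1}" for n t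
  proof -
    define s where "s = (SOME s. s \<in> {0..1} \<and> cis (2 * pi * s) = cis (2 * pi * t))"
    have "s \<in> {0..1} \<and> cis (2 * pi * s) = cis (2 * pi * t)"
      unfolding s_def by (rule someI[of _ t]) (use that in auto)
    hence "s = t \<or> {s, t} = {0, 1}" using that by (intro cis_circle_inj) auto
    hence "c n s = c n t" by (auto simp: c_def doubleton_eq_iff)
    thus ?thesis by (simp add: \<phi>_def s_def)
  qed
  have \<phi>cont: "continuous_on (sphere 0 1) (\<phi> n)" for n
    unfolding cis_circle_surj[symmetric]
  proof (rule continuous_on_compact_quotient)
    show "continuous_on {0..1} (\<lambda>t. cis (2 * pi * t))" unfolding cis_conv_exp by (intro continuous_intros)
    show "continuous_on {0..1} (\<lambda>t. \<phi> n (cis (2 * pi * t)))"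
      using cc[of n] by (rule continuous_on_eq) (simp add: \<phi>c)
  qed simp
  have "\<exists>q. real_polynomial_function q \<and> (\<forall>z\<in>sphere 0 1. \<bar>\<phi> n z - q z\<bar> < 1 / real (Suc n))" for n
  proof -
    have pos: "0 < 1 / real (Suc n)" by simp
    show ?thesis
      by (rule Stone_Weierstrass_real_polynomial_function[OF compact_sphere \<phi>cont[of n] pos]) blast
  qed
  then obtain p where p: "\<And>n. real_polynomial_function (p n)"
      "\<And>n z. cmod z = 1 \<Longrightarrow> \<bar>\<phi> n z - p n z\<bar> < 1 / real (Suc n)"
    by (metis mem_sphere_0)
  show ?thesis
  proof (rule that[of p])
    show "real_polynomial_function (p n)" for n by (rule p)
    show "\<bar>p n z\<bar> \<le> 2" if "cmod z = 1" for n z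
    proof -
      have "z \<in> (\<lambda>t. cis (2 * pi * t)) ` {0..1}" using that by (simp add: cis_circle_surj)
      then obtain t where "t \<in> {0..1}" "z = cis (2 * pi * t)" by blast
      hence "\<bar>\<phi> n z\<bar> \<le> 1" using c1 \<phi>c by simp
      moreover have "1 / real (Suc n) \<le> 1" by simp
      ultimately show ?thesis using p(2)[OF that, of n] by linarith
    qed
    have "negligible (N \<union> {0, 1})" using N by (simp add: negligible_Un)
    hence "N \<union> {0, 1} \<in> null_sets lebesgue" by (simp add: negligible_iff_null_sets)
    hence "AE t in lebesgue. t \<notin> N \<union> {0, 1}" by (rule AE_not_in)
    hence "AE t in circ_meas. t \<notin> N \<union> {0, 1}"
      unfolding circ_meas_def by (subst AE_restrict_space_iff) (auto elim: eventually_mono)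
    moreover have "AE t in circ_meas. t \<in> {0..1}" using AE_space[of circ_meas] by simp
    ultimately show "AE t in circ_meas. (\<lambda>n. p n (cis (2 * pi * t))) \<longlonglongrightarrow> m t"
    proof eventually_elim
      case (elim t)
      have "(\<lambda>n. g n t) \<longlonglongrightarrow> m t" using lim[of t] elim by simp
      hence "(\<lambda>n. max (-1) (min 1 (g n t))) \<longlonglongrightarrow> max (-1) (min 1 (m t))" by (intro tendsto_intros)
      moreover have "max (-1) (min 1 (m t)) = m t" using m1[of t] by auto
      moreover have "(\<lambda>n. min 1 (real n * (t * (1 - t)))) \<longlonglongrightarrow> 1"
      proof (rule tendsto_eventually)
        have "t * (1 - t) > 0" using elim by simp
        then obtain k where "1 < real k * (t * (1 - t))" using reals_Archimedean3 by blast
        moreover have "real k * (t * (1 - t)) \<le> real n * (t * (1 - t))" if "n \<ge> k" for n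
          using that \<open>t * (1 - t) > 0\<close> by (intro mult_right_mono) auto
        ultimately show "\<forall>\<^sub>F n in sequentially. min 1 (real n * (t * (1 - t))) = 1"
          unfolding eventually_sequentially by (intro exI[of _ k]) fastforce
      qed
      ultimately have "(\<lambda>n. c n t) \<longlonglongrightarrow> m t * 1" unfolding c_def by (intro tendsto_mult) auto
      moreover have "(\<lambda>n. \<phi> n (cis (2 * pi * t)) - p n (cis (2 * pi * t))) \<longlonglongrightarrow> 0"
      proof (rule Lim_null_comparison)
        show "\<forall>\<^sub>F n in sequentially. norm (\<phi> n (cis (2 * pi * t)) - p n (cis (2 * pi * t))) \<le> 1 / real (Suc n)"
          using p(2)[of "cis (2 * pi * t)"] by (intro always_eventually) (auto intro: less_imp_le)
        show "(\<lambda>n. 1 / real (Suc n)) \<longlonglongrightarrow> 0" by (rule LIMSEQ_Suc[OF lim_1_over_n])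
      qed
      ultimately have "(\<lambda>n. c n t - (\<phi> n (cis (2 * pi * t)) - p n (cis (2 * pi * t)))) \<longlonglongrightarrow> m t * 1 - 0"
        by (rule tendsto_diff)
      thus ?case using elim by (simp add: \<phi>c)
    qed
  qed
qed

text \<open>A trigonometric polynomial is written as \<open>z \<mapsto> poly q z / z ^ N\<close> on the circle,
  which makes closure under products immediate.\<close>

lemma real_polynomial_trig:
  fixes p :: "complex \<Rightarrow> real"
  assumes "real_polynomial_function p"
  shows "\<exists>N q. \<forall>z. cmod z = 1 \<longrightarrow> complex_of_real (p z) * z ^ N = poly q z"
  using assms
proof (induction rule: real_polynomial_function.induct)
  case (linear f)
  interpret f: bounded_linear f by fact
  define a b where "a = complex_of_real (f 1)" and "b = complex_of_real (f \<i>)"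
  \<comment> \<open>On the circle \<open>cnj z\<close> is the inverse of \<open>z\<close>, so real
    and imaginary part become Laurent polynomials with exponents 1 and -1, and one factor
    \<open>z\<close> clears the pole.\<close>
  have "complex_of_real (f z) * z ^ 1 = poly [:a / 2 - b / (2 * \<i>), 0, a / 2 + b / (2 * \<i>):] z" if "cmod z = 1" for z
  proof -
    have zz: "z * cnj z = 1" using that complex_norm_square[of z] by simp
    have "z = Re z *\<^sub>R 1 + Im z *\<^sub>R \<i>" by (simp add: complex_eq_iff)
    hence "f z = Re z * f 1 + Im z * f \<i>" by (metis f.add f.scaleR real_scaleR_def)
    hence "complex_of_real (f z) = of_real (Re z) * a + of_real (Im z) * b" by (simp add: a_def b_def)
    also have "\<dots> = (z + cnj z) / 2 * a + (z - cnj z) / (2 * \<i>) * b"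
      by (simp add: complex_add_cnj complex_diff_cnj field_simps)
    finally have "complex_of_real (f z) * z = ((z + cnj z) / 2 * a + (z - cnj z) / (2 * \<i>) * b) * z" by simp
    also have "\<dots> = (z * z + z * cnj z) / 2 * a + (z * z - z * cnj z) / (2 * \<i>) * b"
      by (simp add: field_simps)
    also have "\<dots> = poly [:a / 2 - b / (2 * \<i>), 0, a / 2 + b / (2 * \<i>):] z"
      unfolding zz by (simp add: field_simps)
    finally show ?thesis by simp
  qed
  thus ?case by blast
next
  case (const c)
  show ?case by (rule exI[of _ 0], rule exI[of _ "[:complex_of_real c:]"]) auto
next
  case (add f g)
  then obtain N q M r where *: "\<And>z. cmod z = 1 \<Longrightarrow> complex_of_real (f z) * z ^ N = poly q z"
    "\<And>z. cmod z = 1 \<Longrightarrow> complex_of_real (g z) * z ^ M = poly r z" by metis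
  have "complex_of_real (f z + g z) * z ^ (N + M) = poly (q * monom 1 M + r * monom 1 N) z" if "cmod z = 1" for z
  proof -
    have "complex_of_real (f z + g z) * z ^ (N + M)
        = (complex_of_real (f z) * z ^ N) * z ^ M + (complex_of_real (g z) * z ^ M) * z ^ N"
      by (simp add: power_add algebra_simps)
    thus ?thesis using *[OF that] by (simp add: poly_monom)
  qed
  thus ?case by blast
next
  case (mult f g)
  then obtain N q M r where *: "\<And>z. cmod z = 1 \<Longrightarrow> complex_of_real (f z) * z ^ N = poly q z"
    "\<And>z. cmod z = 1 \<Longrightarrow> complex_of_real (g z) * z ^ M = poly r z" by metis
  have "complex_of_real (f z * g z) * z ^ (N + M) = poly (q * r) z" if "cmod z = 1" for z
  proof -
    have "complex_of_real (f z * g z) * z ^ (N + M)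
        = (complex_of_real (f z) * z ^ N) * (complex_of_real (g z) * z ^ M)"
      by (simp add: power_add algebra_simps)
    thus ?thesis using *[OF that] by simp
  qed
  thus ?case by blast
qed

lemma real_polynomial_tchar:
  assumes "real_polynomial_function (p :: complex \<Rightarrow> real)"
  obtains N q where "\<And>t. complex_of_real (p (cis (2 * pi * t))) = (\<Sum>k\<le>degree q. coeff q k * tchar (int k - int N) t)"
proof -
  obtain N q where Nq: "\<And>z. cmod z = 1 \<Longrightarrow> complex_of_real (p z) * z ^ N = poly q z"
    using real_polynomial_trig[OF assms] by blast
  have "complex_of_real (p (cis (2 * pi * t))) = (\<Sum>k\<le>degree q. coeff q k * tchar (int k - int N) t)" for t
  proof -
    have u: "tchar (int N) t * tchar (- int N) t = 1" by (simp flip: tchar_add)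
    have "complex_of_real (p (cis (2 * pi * t))) = complex_of_real (p (cis (2 * pi * t))) * (tchar (int N) t * tchar (- int N) t)"
      using u by simp
    also have "\<dots> = (complex_of_real (p (cis (2 * pi * t))) * cis (2 * pi * t) ^ N) * tchar (- int N) t"
      unfolding tchar_of_nat by (simp only: mult.assoc)
    also have "complex_of_real (p (cis (2 * pi * t))) * cis (2 * pi * t) ^ N = poly q (cis (2 * pi * t))"
      by (rule Nq) simp
    also have "\<dots> * tchar (- int N) t = (\<Sum>k\<le>degree q. coeff q k * (tchar (int k) t * tchar (- int N) t))"
      by (simp add: poly_altdef tchar_of_nat sum_distrib_right mult.assoc)
    finally show ?thesis by (simp flip: tchar_add)
  qed
  thus ?thesis by (rule that)
qed

text \<open>Vanishing coefficients annihilate all trigonometric polynomials, and by dominated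
  convergence all bounded measurable functions. Testing against the conjugate of
  \<open>sgn (f t)\<close>, split into real and imaginary part, produces the integral of
  \<open>cmod (f t)\<close>.\<close>

lemma fourier_unique:
  assumes f: "L2T f" and z: "\<And>n. fourier_coeff f n = 0"
  shows "AE t in circ_meas. f t = 0"
proof -
  have fm [measurable]: "f \<in> borel_measurable circ_meas" using f by (simp add: L2T_def)
  have int0: "(LINT t|circ_meas. f t * tchar k t) = 0" for k
    using z[of "- k"] by (simp add: fourier_coeff_eq_ip ip_def cnj_tchar)
  have *: "(LINT t|circ_meas. f t * complex_of_real (m t)) = 0"
    if m: "m \<in> borel_measurable circ_meas" and m1: "\<And>t. \<bar>m t\<bar> \<le> 1" for m
  proof -
    obtain p where p: "\<And>n. real_polynomial_function (p n)" "\<And>n z. cmod z = 1 \<Longrightarrow> \<bar>p n z\<bar> \<le> 2"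
      "AE t in circ_meas. (\<lambda>n. p n (cis (2 * pi * t))) \<longlonglongrightarrow> m t"
      using circ_polynomial_approx[OF m m1] by blast
    have p0: "(LINT t|circ_meas. f t * complex_of_real (p n (cis (2 * pi * t)))) = 0" for n
    proof -
      obtain N q where Nq: "\<And>t. complex_of_real (p n (cis (2 * pi * t))) = (\<Sum>k\<le>degree q. coeff q k * tchar (int k - int N) t)"
        using real_polynomial_tchar[OF p(1)] by blast
      have "(LINT t|circ_meas. f t * complex_of_real (p n (cis (2 * pi * t))))
          = (LINT t|circ_meas. (\<Sum>k\<le>degree q. coeff q k * (f t * tchar (int k - int N) t)))"
        unfolding Nq sum_distrib_left by (simp only: mult.left_commute)
      also have "\<dots> = (\<Sum>k\<le>degree q. (LINT t|circ_meas. coeff q k * (f t * tchar (int k - int N) t)))"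
        by (intro Bochner_Integration.integral_sum integrable_mult_right integrable_L2T_mult f L2T_tchar)
      also have "\<dots> = 0" by (simp add: int0)
      finally show ?thesis .
    qed
    have pm: "(\<lambda>t. p n (cis (2 * pi * t))) \<in> borel_measurable circ_meas" for n
    proof (rule circ_continuous_measurable)
      have "continuous_on UNIV (p n)" using p(1) continuous_on_polymonial_function real_polynomial_function_eq by blast
      thus "continuous_on {0..1} (\<lambda>t. p n (cis (2 * pi * t)))"
        unfolding cis_conv_exp by (rule continuous_on_compose2) (auto intro!: continuous_intros)
    qed
    have "(\<lambda>n. LINT t|circ_meas. f t * complex_of_real (p n (cis (2 * pi * t)))) \<longlonglongrightarrow> (LINT t|circ_meas. f t * complex_of_real (m t))"
    proof (rule integral_dominated_convergence)
      show "integrable circ_meas (\<lambda>t. 2 * cmod (f t))" using integrable_L2T[OF f] by simp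
      show "AE t in circ_meas. (\<lambda>n. f t * complex_of_real (p n (cis (2 * pi * t)))) \<longlonglongrightarrow> f t * complex_of_real (m t)"
        using p(3) by eventually_elim (intro tendsto_intros)
      show "AE t in circ_meas. norm (f t * complex_of_real (p n (cis (2 * pi * t)))) \<le> 2 * cmod (f t)" for n
      proof (intro always_eventually allI)
        fix t
        have "cmod (f t) * \<bar>p n (cis (2 * pi * t))\<bar> \<le> cmod (f t) * 2" by (intro mult_left_mono p) auto
        thus "norm (f t * complex_of_real (p n (cis (2 * pi * t)))) \<le> 2 * cmod (f t)" by (simp add: norm_mult)
      qed
    qed (use m pm in measurable)
    thus ?thesis by (simp add: p0 LIMSEQ_const_iff)
  qed
  have "(LINT t|circ_meas. f t * cnj (sgn (f t)))
     = (LINT t|circ_meas. f t * complex_of_real (Re (sgn (f t))) - \<i> * (f t * complex_of_real (Im (sgn (f t)))))"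
    by (intro Bochner_Integration.integral_cong) (auto simp: complex_eq_iff algebra_simps)
  also have "\<dots> = 0"
  proof -
    have s1: "\<bar>Re (sgn (f t))\<bar> \<le> 1" "\<bar>Im (sgn (f t))\<bar> \<le> 1" for t
      using abs_Re_le_cmod[of "sgn (f t)"] abs_Im_le_cmod[of "sgn (f t)"] norm_sgn[of "f t"] by (auto split: if_splits)
    have sm: "(\<lambda>t. Re (sgn (f t))) \<in> borel_measurable circ_meas" "(\<lambda>t. Im (sgn (f t))) \<in> borel_measurable circ_meas"
      unfolding sgn_div_norm by measurable
    have I: "integrable circ_meas (\<lambda>t. f t * complex_of_real (m t))"
      if "m \<in> borel_measurable circ_meas" "\<And>t. \<bar>m t\<bar> \<le> 1" for m
      by (rule integrable_L2T_mult[OF f L2T_bounded[where B=1]]) (use that in simp_all)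
    have "integrable circ_meas (\<lambda>t. f t * complex_of_real (Re (sgn (f t))))"
      "integrable circ_meas (\<lambda>t. f t * complex_of_real (Im (sgn (f t))))"
      using I[OF sm(1) s1(1)] I[OF sm(2) s1(2)] .
    thus ?thesis using *[OF sm(1) s1(1)] *[OF sm(2) s1(2)]
      by (simp only: Bochner_Integration.integral_diff integrable_mult_right integral_mult_right_zero) simp
  qed
  also have "(LINT t|circ_meas. f t * cnj (sgn (f t))) = (LINT t|circ_meas. complex_of_real (cmod (f t)))"
  proof (rule Bochner_Integration.integral_cong)
    fix t
    have "f t * cnj (sgn (f t)) = (f t * cnj (f t)) / cmod (f t)" by (simp add: sgn_eq)
    also have "\<dots> = complex_of_real (cmod (f t))"
      by (simp add: complex_norm_square[symmetric] power2_eq_square)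
    finally show "f t * cnj (sgn (f t)) = complex_of_real (cmod (f t))" .
  qed simp
  finally have "(LINT t|circ_meas. cmod (f t)) = 0" by (simp add: integral_complex_of_real)
  hence "AE t in circ_meas. cmod (f t) = 0"
    using integrable_L2T[OF f] by (subst (asm) integral_nonneg_eq_0_iff_AE) auto
  thus ?thesis by simp
qed

text \<open>Arbitrary index sets instead of initial segments, so that differences of partial sums
  and single characters have the same shape.\<close>

definition tsum :: "(nat \<Rightarrow> complex) \<Rightarrow> nat set \<Rightarrow> real \<Rightarrow> complex" where
  "tsum c I t = (\<Sum>k\<in>I. c k * tchar (int k) t)"

lemma L2T_tsum [simp]: "L2T (tsum c I)"
  unfolding tsum_def by (intro L2T_sum L2T_scale L2T_tchar)

lemma ip_tsum_left: "L2T f \<Longrightarrow> ip (tsum c I) f = (\<Sum>k\<in>I. c k * ip (tchar (int k)) f)"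
  unfolding tsum_def by (subst ip_sum_left) (auto intro: L2T_scale simp: ip_scale_left)

lemma ip_tsum_right: "L2T f \<Longrightarrow> ip f (tsum c I) = (\<Sum>k\<in>I. cnj (c k) * fourier_coeff f (int k))"
  by (subst ip_cnj) (simp add: ip_tsum_left fourier_coeff_eq_ip ip_cnj[of f])

lemma fourier_coeff_tsum:
  "finite I \<Longrightarrow> fourier_coeff (tsum c I) n = (if n \<ge> 0 \<and> nat n \<in> I then c (nat n) else 0)"
proof -
  assume I: "finite I"
  have "fourier_coeff (tsum c I) n = (\<Sum>k\<in>I. if int k = n then c k else 0)"
    by (simp add: fourier_coeff_eq_ip ip_tsum_left ip_tchar if_distrib cong: if_cong)
  also have "\<dots> = (if n \<ge> 0 \<and> nat n \<in> I then c (nat n) else 0)"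
  proof (cases "n \<ge> 0")
    case True
    hence "int k = n \<longleftrightarrow> k = nat n" for k by auto
    with True I show ?thesis by simp
  next
    case False
    thus ?thesis by (intro trans[OF sum.neutral]) auto
  qed
  finally show ?thesis .
qed

lemma norm2_tsum: "finite I \<Longrightarrow> (norm2 (tsum c I))\<^sup>2 = (\<Sum>k\<in>I. (cmod (c k))\<^sup>2)"
proof -
  assume I: "finite I"
  have "complex_of_real ((norm2 (tsum c I))\<^sup>2) = (\<Sum>k\<in>I. cnj (c k) * c k)"
    unfolding ip_self[symmetric] by (simp add: ip_tsum_right fourier_coeff_tsum I)
  also have "\<dots> = complex_of_real (\<Sum>k\<in>I. (cmod (c k))\<^sup>2)"
    by (simp only: of_real_sum complex_norm_square mult.commute)
  finally show ?thesis using of_real_eq_iff by blast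
qed

lemma tsum_in_H2: "finite I \<Longrightarrow> tsum c I \<in> H2"
  by (simp add: H2_def fourier_coeff_tsum)

section \<open>Mean convergence of Fourier series\<close>

lemma Bessel_fourier:
  assumes "L2T f"
  shows "(\<Sum>k<N. (cmod (fourier_coeff f (int k)))\<^sup>2) \<le> (norm2 f)\<^sup>2"
proof -
  define s where "s = tsum (\<lambda>k. fourier_coeff f (int k)) {..<N}"
  have s: "L2T s" by (simp add: s_def)
  have "ip (\<lambda>t. f t - s t) s = ip f s - ip s s" using assms s by (intro ip_diff_left)
  also have "\<dots> = 0" unfolding s_def using assms by (simp add: ip_tsum_right fourier_coeff_tsum)
  finally have "(norm2 f)\<^sup>2 = (norm2 (\<lambda>t. f t - s t))\<^sup>2 + (norm2 s)\<^sup>2"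
    using norm2_add_power2[OF L2T_diff[OF assms s] s] by simp
  moreover have "(norm2 s)\<^sup>2 = (\<Sum>k<N. (cmod (fourier_coeff f (int k)))\<^sup>2)" by (simp add: s_def norm2_tsum)
  ultimately show ?thesis by simp
qed

lemma ip_tendsto:
  assumes "\<And>n. L2T (f n)" "L2T l" "(\<lambda>n. norm2 (\<lambda>t. f n t - l t)) \<longlonglongrightarrow> 0" "L2T h"
  shows "(\<lambda>n. ip (f n) h) \<longlonglongrightarrow> ip l h"
proof (rule LIM_zero_cancel, rule Lim_null_comparison)
  show "\<forall>\<^sub>F n in sequentially. norm (ip (f n) h - ip l h) \<le> norm2 (\<lambda>t. f n t - l t) * norm2 h"
    using assms by (intro always_eventually allI) (simp add: ip_le_norm2 L2T_diff flip: ip_diff_left)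
  show "(\<lambda>n. norm2 (\<lambda>t. f n t - l t) * norm2 h) \<longlonglongrightarrow> 0" using tendsto_mult_left_zero[OF assms(3)] .
qed

lemma Riesz_Fischer:
  assumes "summable (\<lambda>n. (cmod (c n))\<^sup>2)"
  obtains f where "L2T f" "\<And>n. fourier_coeff f n = (if n \<ge> 0 then c (nat n) else 0)"
    "(\<lambda>N. norm2 (\<lambda>t. tsum c {..<N} t - f t)) \<longlonglongrightarrow> 0"
proof -
  have "\<exists>M. \<forall>m\<ge>M. \<forall>n\<ge>M. norm2 (\<lambda>t. tsum c {..<m} t - tsum c {..<n} t) < e" if e: "e > 0" for e
  proof -
    obtain M where M: "\<And>m n. m \<ge> M \<Longrightarrow> norm (\<Sum>k\<in>{m..<n}. (cmod (c k))\<^sup>2) < e\<^sup>2"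
      using assms e by (subst (asm) summable_Cauchy) (metis zero_less_power)
    have half: "norm2 (\<lambda>t. tsum c {..<m} t - tsum c {..<n} t) < e" if "n \<ge> M" "m \<ge> n" for m n
    proof -
      have "tsum c {..<m} t - tsum c {..<n} t = tsum c {n..<m} t" for t
        using sum_diff_nat_ivl[of 0 n m "\<lambda>k. c k * tchar (int k) t"] that
        by (simp add: tsum_def lessThan_atLeast0)
      hence "(norm2 (\<lambda>t. tsum c {..<m} t - tsum c {..<n} t))\<^sup>2 = (\<Sum>k\<in>{n..<m}. (cmod (c k))\<^sup>2)"
        by (simp add: norm2_tsum)
      also have "\<dots> < e\<^sup>2" using M[OF that(1), of m] by simp
      finally show ?thesis using e by (simp add: power_less_imp_less_base)
    qed
    show ?thesis
    proof (intro exI[of _ M] allI impI)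
      fix m n assume "m \<ge> M" "n \<ge> M"
      thus "norm2 (\<lambda>t. tsum c {..<m} t - tsum c {..<n} t) < e"
        using half[of n m] half[of m n] norm2_minus_commute[of "tsum c {..<m}" "tsum c {..<n}"] by (cases "m \<ge> n") auto
    qed
  qed
  then obtain f where f: "L2T f" "(\<lambda>N. norm2 (\<lambda>t. tsum c {..<N} t - f t)) \<longlonglongrightarrow> 0"
    using L2T_complete[of "\<lambda>N. tsum c {..<N}", OF L2T_tsum] by blast
  have "fourier_coeff f n = (if n \<ge> 0 then c (nat n) else 0)" for n
  proof -
    have "(\<lambda>N. fourier_coeff (tsum c {..<N}) n) \<longlonglongrightarrow> fourier_coeff f n"
      unfolding fourier_coeff_eq_ip by (rule ip_tendsto) (use f in auto)
    moreover have "(\<lambda>N. fourier_coeff (tsum c {..<N}) n) \<longlonglongrightarrow> (if n \<ge> 0 then c (nat n) else 0)"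
      by (rule tendsto_eventually)
        (auto simp: fourier_coeff_tsum eventually_sequentially intro!: exI[of _ "Suc (nat n)"])
    ultimately show ?thesis by (rule LIMSEQ_unique)
  qed
  with f show ?thesis by (intro that)
qed

lemma summable_fourier:
  assumes "L2T f"
  shows "summable (\<lambda>k. (cmod (fourier_coeff f (int k)))\<^sup>2)"
  by (rule bounded_imp_summable[where B="(norm2 f)\<^sup>2"])
    (auto simp only: zero_le_power2 lessThan_Suc_atMost[symmetric] Bessel_fourier[OF assms])

text \<open>The negative coefficients of \<open>f\<close> vanish by definition of \<open>H2\<close>,
  so the sum supplied by Riesz-Fischer has all its coefficients in common with \<open>f\<close> and
  equals it almost everywhere by uniqueness.\<close>

lemma H2_partial_sums:
  assumes "f \<in> H2"
  shows "(\<lambda>N. norm2 (\<lambda>t. tsum (\<lambda>k. fourier_coeff f (int k)) {..<N} t - f t)) \<longlonglongrightarrow> 0"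
proof -
  have f: "L2T f" "\<And>n. n < 0 \<Longrightarrow> fourier_coeff f n = 0" using assms by (auto simp: H2_def)
  obtain g where g: "L2T g" "\<And>n. fourier_coeff g n = (if n \<ge> 0 then fourier_coeff f (int (nat n)) else 0)"
    "(\<lambda>N. norm2 (\<lambda>t. tsum (\<lambda>k. fourier_coeff f (int k)) {..<N} t - g t)) \<longlonglongrightarrow> 0"
    by (rule Riesz_Fischer[OF summable_fourier[OF f(1)]]) (rule that)
  have ae: "AE t in circ_meas. f t - g t = 0"
  proof (rule fourier_unique[OF L2T_diff[OF f(1) g(1)]])
    show "fourier_coeff (\<lambda>t. f t - g t) n = 0" for n
    proof -
      have "fourier_coeff (\<lambda>t. f t - g t) n = fourier_coeff f n - fourier_coeff g n"
        unfolding fourier_coeff_eq_ip using f(1) g(1) by (intro ip_diff_left) auto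
      thus ?thesis using g(2)[of n] f(2)[of n] by (cases "n \<ge> 0") auto
    qed
  qed
  have "norm2 (\<lambda>t. tsum (\<lambda>k. fourier_coeff f (int k)) {..<N} t - f t)
      = norm2 (\<lambda>t. tsum (\<lambda>k. fourier_coeff f (int k)) {..<N} t - g t)" for N
    by (rule norm2_cong_AE) (use ae f(1) g(1) in \<open>auto intro!: L2T_measurable L2T_diff elim: eventually_mono\<close>)
  with g(3) show ?thesis by simp
qed

text \<open>The projection cuts off the negative Fourier coefficients. Since \<open>projH2\<close>
  is a \<open>SOME\<close> term, nothing can be said about it before such a witness is
  exhibited.\<close>

lemma projH2_exists:
  assumes u: "L2T u"
  obtains q where "q \<in> H2" "\<And>k. k \<in> H2 \<Longrightarrow> ip u k = ip q k"
proof -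
  obtain q where q: "L2T q" "\<And>n. fourier_coeff q n = (if n \<ge> 0 then fourier_coeff u (int (nat n)) else 0)"
    by (rule Riesz_Fischer[OF summable_fourier[OF u]]) (rule that)
  have "ip u k = ip q k" if k: "k \<in> H2" for k
  proof -
    have kL: "L2T k" using k by (simp add: H2_def)
    define c where "c i = fourier_coeff k (int i)" for i
    have lim: "(\<lambda>N. ip (tsum c {..<N}) w) \<longlonglongrightarrow> ip k w" if "L2T w" for w
      by (rule ip_tendsto) (use that kL H2_partial_sums[OF k] in \<open>auto simp: c_def[abs_def]\<close>)
    have "fourier_coeff u (int i) = fourier_coeff q (int i)" for i using q(2)[of "int i"] by simp
    hence "ip (tsum c {..<N}) u = ip (tsum c {..<N}) q" for N
      using u q(1) by (simp add: ip_tsum_left ip_cnj[of "tchar _"] flip: fourier_coeff_eq_ip)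
    hence "ip k u = ip k q" using LIMSEQ_unique[OF lim[OF u]] lim[OF q(1)] by simp
    thus ?thesis by (simp add: ip_cnj[of u] ip_cnj[of q])
  qed
  moreover have "q \<in> H2" using q by (simp add: H2_def)
  ultimately show ?thesis by (intro that)
qed

lemma projH2_spec:
  assumes u: "L2T u"
  shows "projH2 u \<in> H2" "k \<in> H2 \<Longrightarrow> ip (projH2 u) k = ip u k"
proof -
  obtain q where "q \<in> H2" "\<And>k. k \<in> H2 \<Longrightarrow> ip u k = ip q k"
    by (rule projH2_exists[OF u]) (rule that)
  hence "q \<in> H2 \<and> (\<forall>k\<in>H2. ip u k = ip q k)" by blast
  hence "projH2 u \<in> H2 \<and> (\<forall>k\<in>H2. ip u k = ip (projH2 u) k)" unfolding projH2_def
    by (rule someI[of "\<lambda>q. q \<in> H2 \<and> (\<forall>k\<in>H2. ip u k = ip q k)" q])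
  thus "projH2 u \<in> H2" "k \<in> H2 \<Longrightarrow> ip (projH2 u) k = ip u k" by auto
qed

lemma H2_L2T: "f \<in> H2 \<Longrightarrow> L2T f"
  by (simp add: H2_def)

lemma H2_add: "f \<in> H2 \<Longrightarrow> g \<in> H2 \<Longrightarrow> (\<lambda>t. f t + g t) \<in> H2"
  by (auto simp: H2_def fourier_coeff_eq_ip ip_add_left intro: L2T_add)

lemma H2_scale: "f \<in> H2 \<Longrightarrow> (\<lambda>t. c * f t) \<in> H2"
  by (auto simp: H2_def fourier_coeff_eq_ip ip_scale_left intro: L2T_scale)

lemma H2_diff: "f \<in> H2 \<Longrightarrow> g \<in> H2 \<Longrightarrow> (\<lambda>t. f t - g t) \<in> H2"
  by (auto simp: H2_def fourier_coeff_eq_ip ip_diff_left intro: L2T_diff)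

lemma H2_limit:
  assumes "\<And>n. f n \<in> H2" "L2T l" "(\<lambda>n. norm2 (\<lambda>t. f n t - l t)) \<longlonglongrightarrow> 0"
  shows "l \<in> H2"
proof -
  have "fourier_coeff l n = 0" if "n < 0" for n
  proof -
    have "(\<lambda>i. fourier_coeff (f i) n) \<longlonglongrightarrow> fourier_coeff l n"
      unfolding fourier_coeff_eq_ip by (rule ip_tendsto) (use assms H2_L2T in auto)
    moreover have "fourier_coeff (f i) n = 0" for i using assms(1)[of i] that by (simp add: H2_def)
    ultimately show ?thesis by (simp add: LIMSEQ_const_iff)
  qed
  thus ?thesis using assms(2) by (simp add: H2_def)
qed

lemma H2_eq_AE:
  assumes "f \<in> H2" "g \<in> H2" "\<And>k. k \<in> H2 \<Longrightarrow> ip f k = ip g k"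
  shows "AE t in circ_meas. f t = g t"
proof -
  have L: "L2T (\<lambda>t. f t - g t)" using assms(1,2) by (intro L2T_diff H2_L2T)
  have "ip (\<lambda>t. f t - g t) (\<lambda>t. f t - g t) = 0"
    using assms H2_diff[OF assms(1,2)] by (subst ip_diff_left) (auto intro: H2_L2T)
  hence "norm2 (\<lambda>t. f t - g t) = 0" by (simp add: ip_self)
  thus ?thesis using L by (simp add: norm2_eq_0_iff)
qed

lemma norm2_projH2_le:
  assumes u: "L2T u"
  shows "norm2 (projH2 u) \<le> norm2 u"
proof -
  let ?p = "projH2 u"
  have "complex_of_real ((norm2 ?p)\<^sup>2) = ip u ?p"
    unfolding ip_self[symmetric] using projH2_spec[OF u] by simp
  hence "(norm2 ?p)\<^sup>2 \<le> norm2 u * norm2 ?p"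
    using ip_le_norm2[OF u H2_L2T[OF projH2_spec(1)[OF u]]] by (metis norm_of_real abs_power2)
  thus ?thesis using norm2_nonneg[of ?p] norm2_nonneg[of u]
    by (cases "norm2 ?p = 0") (auto simp: power2_eq_square mult_le_cancel_right simp del: norm2_nonneg)
qed

section \<open>Radial limits\<close>

lemma circ_integrable_continuous:
  fixes f :: "real \<Rightarrow> 'a::euclidean_space"
  assumes "continuous_on {0..1} f"
  shows "integrable circ_meas f"
proof -
  have "compact (f ` {0..1})" by (intro compact_continuous_image assms compact_Icc)
  hence "bounded (f ` {0..1})" by (rule compact_imp_bounded)
  then obtain B where B: "\<forall>t\<in>{0..1}. norm (f t) \<le> B" unfolding bounded_iff by auto
  show ?thesis
  proof (rule circ.integrable_const_bound[where B=B])
    show "AE t in circ_meas. norm (f t) \<le> B" using AE_space[of circ_meas] by eventually_elim (use B in simp)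
    show "f \<in> borel_measurable circ_meas" by (rule circ_continuous_measurable[OF assms])
  qed
qed

lemma continuous_on_circle: "continuous_on S (\<lambda>t. complex_of_real r * cis (2 * pi * t))"
  unfolding cis_conv_exp by (intro continuous_intros)

text \<open>On the circle \<open>dz = 2 * pi * \<i> * z dt\<close>; this accounts for the additional
  factor \<open>z\<close> on the left and the denominator on the right.\<close>

lemma contour_integral_circ:
  assumes h: "(h has_contour_integral I) (circlepath 0 r)" and c: "continuous_on (sphere 0 r) h" and r: "r > 0"
  shows "(LINT t|circ_meas. h (complex_of_real r * cis (2 * pi * t)) * (complex_of_real r * cis (2 * pi * t))) = I / (2 * pi * \<i>)"
proof -
  let ?z = "\<lambda>t. complex_of_real r * cis (2 * pi * t)"
  have cp: "circlepath 0 r t = ?z t" for t by (simp add: circlepath cis_conv_exp mult_ac)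
  have "((\<lambda>t. h (circlepath 0 r t) * vector_derivative (circlepath 0 r) (at t within {0..1})) has_integral I) {0..1}"
    using h by (simp add: has_contour_integral_def)
  hence "((\<lambda>t. h (?z t) * (2 * pi * \<i> * ?z t)) has_integral I) {0..1}"
  proof (rule has_integral_eq[rotated])
    fix t :: real assume t: "t \<in> {0..1}"
    have "vector_derivative (circlepath 0 r) (at t within {0..1}) = 2 * pi * \<i> * r * exp (2 * of_real pi * \<i> * t)"
      using t by (intro vector_derivative_circlepath01) auto
    also have "\<dots> = 2 * pi * \<i> * ?z t" by (simp add: cis_conv_exp mult_ac)
    finally show "h (circlepath 0 r t) * vector_derivative (circlepath 0 r) (at t within {0..1}) = h (?z t) * (2 * pi * \<i> * ?z t)"
      by (simp only: cp)
  qed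
  hence I: "integral {0..1} (\<lambda>t. h (?z t) * (2 * pi * \<i> * ?z t)) = I" by (rule integral_unique)
  have "continuous_on {0..1} (\<lambda>t. h (?z t) * (2 * pi * \<i> * ?z t))"
  proof (intro continuous_intros continuous_on_circle)
    show "continuous_on {0..1} (\<lambda>t. h (?z t))"
      by (rule continuous_on_compose2[OF c continuous_on_circle]) (use r in \<open>auto simp: norm_mult\<close>)
  qed
  hence "integrable circ_meas (\<lambda>t. h (?z t) * (2 * pi * \<i> * ?z t))" by (rule circ_integrable_continuous)
  hence "(LINT t|circ_meas. h (?z t) * (2 * pi * \<i> * ?z t)) = I"
    unfolding circ_meas_def using I by (subst lebesgue_integral_eq_integral) auto
  moreover have "(LINT t|circ_meas. h (?z t) * (2 * pi * \<i> * ?z t)) = 2 * pi * \<i> * (LINT t|circ_meas. h (?z t) * ?z t)"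
    by (subst integral_mult_right_zero[symmetric]) (simp add: mult_ac)
  ultimately show ?thesis by (simp add: field_simps)
qed

lemma circ_mean_value:
  assumes "continuous_on (cball 0 r) f" "f holomorphic_on ball 0 r" "r > 0"
  shows "(LINT t|circ_meas. f (complex_of_real r * cis (2 * pi * t))) = f 0"
proof -
  have "((\<lambda>u. f u / (u - 0)) has_contour_integral (2 * of_real pi * \<i> * f 0)) (circlepath 0 r)"
    using assms by (intro Cauchy_integral_circlepath) auto
  hence "(LINT t|circ_meas. (\<lambda>u. f u / (u - 0)) (complex_of_real r * cis (2 * pi * t)) * (complex_of_real r * cis (2 * pi * t)))
      = 2 * of_real pi * \<i> * f 0 / (2 * pi * \<i>)"
  proof (rule contour_integral_circ)
    show "continuous_on (sphere 0 r) (\<lambda>u. f u / (u - 0))"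
      using assms by (intro continuous_intros continuous_on_subset[OF assms(1)]) auto
  qed fact
  thus ?thesis using assms(3) by simp
qed

text \<open>On the unit circle \<open>cnj u = 1 / u\<close>, so the kernel equals
  \<open>u / ((1 - cnj w * u) * (u - w))\<close>. Cauchy's formula at \<open>w\<close> for the
  function \<open>1 / (1 - cnj w * u)\<close> gives the value.\<close>

lemma Poisson_kernel_mean:
  assumes "cmod w < 1"
  shows "(LINT t|circ_meas. 1 / (cmod (cis (2 * pi * t) - w))\<^sup>2) = 1 / (1 - (cmod w)\<^sup>2)"
proof -
  have nz: "1 - cnj w * u \<noteq> 0" if "cmod u \<le> 1" for u
  proof
    assume "1 - cnj w * u = 0"
    hence "cmod (cnj w * u) = 1" by (metis eq_iff_diff_eq_0 norm_one)
    moreover have "cmod w * cmod u \<le> cmod w * 1" using that by (intro mult_left_mono) auto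
    ultimately show False using assms by (simp add: norm_mult)
  qed
  have nw: "u - w \<noteq> 0" if "cmod u = 1" for u using that assms by auto
  have "((\<lambda>u. (1 / (1 - cnj w * u)) / (u - w)) has_contour_integral (2 * of_real pi * \<i> * (1 / (1 - cnj w * w)))) (circlepath 0 1)"
    using assms nz by (intro Cauchy_integral_circlepath continuous_intros holomorphic_intros) auto
  hence "(LINT t|circ_meas. (\<lambda>u. (1 / (1 - cnj w * u)) / (u - w)) (complex_of_real 1 * cis (2 * pi * t)) * (complex_of_real 1 * cis (2 * pi * t)))
      = 2 * of_real pi * \<i> * (1 / (1 - cnj w * w)) / (2 * pi * \<i>)"
    by (rule contour_integral_circ) (use nz nw in \<open>auto intro!: continuous_intros\<close>)
  hence "(LINT t|circ_meas. (1 / (1 - cnj w * cis (2 * pi * t))) / (cis (2 * pi * t) - w) * cis (2 * pi * t)) = 1 / (1 - cnj w * w)"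
    by simp
  moreover have "(1 / (1 - cnj w * u)) / (u - w) * u = complex_of_real (1 / (cmod (u - w))\<^sup>2)" if "cmod u = 1" for u
  proof -
    have uu: "u * cnj u = 1" using that complex_norm_square[of u] by simp
    have eq: "(u - w) * (1 - cnj w * u) = (u - w) * cnj (u - w) * u"
      using uu by (simp add: algebra_simps) 
    have "(1 / (1 - cnj w * u)) / (u - w) * u = u / ((u - w) * (1 - cnj w * u))"
      by (simp add: mult.commute)
    also have "\<dots> = u / ((u - w) * cnj (u - w) * u)" by (simp only: eq)
    also have "\<dots> = complex_of_real (1 / (cmod (u - w))\<^sup>2)"
      using that by (auto simp: complex_norm_square simp flip: of_real_power)
    finally show ?thesis .
  qed
  ultimately have "(LINT t|circ_meas. complex_of_real (1 / (cmod (cis (2 * pi * t) - w))\<^sup>2)) = 1 / (1 - cnj w * w)"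
    by simp
  hence "complex_of_real (LINT t|circ_meas. 1 / (cmod (cis (2 * pi * t) - w))\<^sup>2) = 1 / (1 - cnj w * w)"
    by (subst integral_complex_of_real[symmetric])
  also have "cnj w * w = complex_of_real ((cmod w)\<^sup>2)" by (simp only: complex_norm_square mult.commute)
  finally have "complex_of_real (LINT t|circ_meas. 1 / (cmod (cis (2 * pi * t) - w))\<^sup>2) = complex_of_real (1 / (1 - (cmod w)\<^sup>2))"
    by simp
  thus ?thesis using of_real_eq_iff by blast
qed

text \<open>If the boundary values of \<open>F\<close> have derivative \<open>c\<close> at \<open>z0\<close> along the circle, then \<open>F'\<close> tends to
  \<open>c\<close> along the radius. The second-order pole at \<open>w\<close> in Cauchy's formula is balanced by one
  at the reflected point \<open>z0 / r\<close>, which yields a kernel comparable to the Poisson kernel.\<close>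

lemma radial_limit_of_derivative:
  assumes F: "continuous_on (cball 0 1) F" "\<And>w. cmod w < 1 \<Longrightarrow> (F has_field_derivative g w) (at w)"
    and z0: "cmod z0 = 1"
    and c: "\<And>e. e > 0 \<Longrightarrow> \<exists>d>0. \<forall>z. cmod z = 1 \<and> cmod (z - z0) < d \<longrightarrow> cmod (F z - F z0 - c * (z - z0)) \<le> e * cmod (z - z0)"
  shows "((\<lambda>r::real. g (complex_of_real r * z0)) \<longlongrightarrow> c) (at_left 1)"
proof -
  \<comment> \<open>Subtracting the affine part leaves a function that is
    \<open>o(cmod (z - z0))\<close> on the circle and whose derivative \<open>g w - c\<close> has to
    tend to 0.\<close>
  define K where "K z = F z - F z0 - c * (z - z0)" for z
  have Kc: "continuous_on (cball 0 1) K" unfolding K_def by (intro continuous_intros F)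
  have Kd: "(K has_field_derivative (g w - c)) (at w)" if "cmod w < 1" for w
    unfolding K_def using F(2)[OF that] by (auto intro!: derivative_eq_intros)
  have Kh: "K holomorphic_on ball 0 1"
    unfolding holomorphic_on_open[OF open_ball]
  proof
    fix x :: complex assume "x \<in> ball 0 1"
    thus "\<exists>f'. (K has_field_derivative f') (at x)" by (intro exI) (rule Kd, simp)
  qed
  have "bounded (K ` cball 0 1)" by (intro compact_imp_bounded compact_continuous_image Kc compact_cball)
  then obtain M where "M > 0" "\<forall>z\<in>cball 0 1. cmod (K z) \<le> M" unfolding bounded_pos by auto
  hence M: "\<And>z. cmod z \<le> 1 \<Longrightarrow> cmod (K z) \<le> M" "M > 0" by auto
  have key: "cmod (g (complex_of_real r * z0) - c) \<le> 4 * e + 16 * M / d ^ 3 * (1 - r\<^sup>2)"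
    if e: "e > 0" and d: "d > 0" and near: "\<And>z. cmod z = 1 \<Longrightarrow> cmod (z - z0) < d \<Longrightarrow> cmod (K z) \<le> e * cmod (z - z0)"
      and r: "0 < r" "r < 1" for e d r
  proof -
    define w where "w = complex_of_real r * z0"
    define v where "v = z0 / complex_of_real r"
    have w1: "cmod w < 1" "cmod w = r" using r z0 by (auto simp: w_def norm_mult)
    have v1: "cmod v > 1" using r z0 by (simp add: v_def norm_divide)
    have uv: "u - v \<noteq> 0" if "cmod u \<le> 1" for u using that v1 by auto
    have uw: "u - w \<noteq> 0" if "cmod u = 1" for u using that w1 by auto
    have I1: "((\<lambda>u. K u / (u - w) ^ Suc 1) has_contour_integral ((2 * pi * \<i>) / (fact 1) * (deriv ^^ 1) K w)) (circlepath 0 1)"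
      using w1 by (intro Cauchy_has_contour_integral_higher_derivative_circlepath Kc Kh) auto
    \<comment> \<open>The factors \<open>u - w\<close> cancel off \<open>w\<close>; they merely
      bring \<open>K u / (u - v)^2\<close>, which has no pole in the closed disc, into the form of
      Cauchy's formula, with a numerator vanishing at \<open>w\<close>.\<close>
    have "((\<lambda>u. (K u * (u - w) / (u - v)\<^sup>2) / (u - w)) has_contour_integral (2 * of_real pi * \<i> * (K w * (w - w) / (w - v)\<^sup>2))) (circlepath 0 1)"
      using w1 uv by (intro Cauchy_integral_circlepath continuous_intros holomorphic_intros Kc Kh) auto
    hence I2: "((\<lambda>u. (K u * (u - w) / (u - v)\<^sup>2) / (u - w)) has_contour_integral 0) (circlepath 0 1)" by simp
    define D where "D u = K u / (u - w) ^ Suc 1 - (K u * (u - w) / (u - v)\<^sup>2) / (u - w)" for u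
    have "(D has_contour_integral (2 * pi * \<i> * (g w - c))) (circlepath 0 1)"
      unfolding D_def using has_contour_integral_diff[OF I1 I2] DERIV_imp_deriv[OF Kd[OF w1(1)]] by simp
    moreover have Dc: "continuous_on (sphere 0 1) D"
      unfolding D_def using uv uw by (intro continuous_intros continuous_on_subset[OF Kc]) auto
    ultimately have DI: "(LINT t|circ_meas. D (complex_of_real 1 * cis (2 * pi * t)) * (complex_of_real 1 * cis (2 * pi * t))) = g w - c"
      by (subst contour_integral_circ) auto
    \<comment> \<open>Reflection gives \<open>r * cmod (u - v) = cmod (u - w) = x\<close>, so the
      difference of the two double poles has size at most \<open>2 * (1 - r^2) / x^3\<close>.
      Moreover \<open>cmod (u - z0) <= 2 * x\<close>. Near \<open>z0\<close> this bounds
      \<open>K u\<close> by \<open>2 * e * x\<close> and leaves a Poisson kernel; elsewhere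
      \<open>d <= 2 * x\<close>, so \<open>M <= M / d^3 * (2 * x)^3\<close> absorbs the
      cube.\<close>
    have Db: "cmod (D u) \<le> 4 * e * (1 - r\<^sup>2) * (1 / (cmod (u - w))\<^sup>2) + 16 * M / d ^ 3 * (1 - r\<^sup>2)" if u: "cmod u = 1" for u
    proof -
      define x where "x = cmod (u - w)"
      have x0: "x > 0" using uw[OF u] by (simp add: x_def)
      have "cmod (complex_of_real r * (u - v)) = x"
      proof -
        have uu: "u * cnj u = 1" "z0 * cnj z0 = 1" using u z0 complex_norm_square[of u] complex_norm_square[of z0] by simp_all
        have "complex_of_real r * (u - v) = - (u * z0 * cnj (u - w))"
        proof -
          have "u * z0 * cnj (u - w) = (u * cnj u) * z0 - complex_of_real r * u * (z0 * cnj z0)"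
            by (simp add: w_def algebra_simps)
          thus ?thesis unfolding uu using r by (simp add: v_def algebra_simps)
        qed
        thus ?thesis using u z0 by (simp add: norm_mult x_def del: complex_cnj_diff)
      qed
      hence "r * cmod (u - v) = x" using r by (simp only: norm_mult norm_of_real abs_of_pos)
      hence xv: "cmod (u - v) = x / r" using r by (simp add: nonzero_eq_divide_eq mult.commute)
      have wv: "cmod (w - v) = (1 - r\<^sup>2) / r"
      proof -
        have "v - w = complex_of_real ((1 - r\<^sup>2) / r) * z0"
          using r by (simp add: v_def w_def field_simps power2_eq_square)
        hence "cmod (v - w) = \<bar>(1 - r\<^sup>2) / r\<bar>" using z0 by (metis norm_mult norm_of_real mult.right_neutral)
        also have "\<dots> = (1 - r\<^sup>2) / r" using r by (simp add: power_le_one)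
        finally show ?thesis by (simp add: norm_minus_commute)
      qed
      have "D u = K u * (1 / (u - w)\<^sup>2 - 1 / (u - v)\<^sup>2)"
      proof -
        have "(K u * (u - w) / (u - v)\<^sup>2) / (u - w) = K u / (u - v)\<^sup>2" using uw[OF u] by simp
        thus ?thesis by (simp add: D_def right_diff_distrib power2_eq_square)
      qed
      also have "1 / (u - w)\<^sup>2 - 1 / (u - v)\<^sup>2 = (w - v) * ((u - w) + (u - v)) / ((u - w)\<^sup>2 * (u - v)\<^sup>2)"
      proof -
        have "1 / (u - w)\<^sup>2 - 1 / (u - v)\<^sup>2 = ((u - v)\<^sup>2 - (u - w)\<^sup>2) / ((u - w)\<^sup>2 * (u - v)\<^sup>2)"
          using uw[OF u] uv[of u] u by (simp add: diff_frac_eq)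
        also have "(u - v)\<^sup>2 - (u - w)\<^sup>2 = (w - v) * ((u - w) + (u - v))" by (simp add: power2_eq_square algebra_simps)
        finally show ?thesis .
      qed
      finally have "cmod (D u) = cmod (K u) * ((1 - r\<^sup>2) / r * cmod ((u - w) + (u - v)) / (x\<^sup>2 * (x / r)\<^sup>2))"
        by (simp add: norm_mult norm_divide norm_power wv xv x_def[symmetric])
      also have "\<dots> \<le> cmod (K u) * ((1 - r\<^sup>2) / r * (x + x / r) / (x\<^sup>2 * (x / r)\<^sup>2))"
        using r norm_triangle_ineq[of "u - w" "u - v"] unfolding xv x_def[symmetric]
        by (intro mult_left_mono divide_right_mono) (auto simp: power_le_one)
      also have "(1 - r\<^sup>2) / r * (x + x / r) / (x\<^sup>2 * (x / r)\<^sup>2) = (1 - r\<^sup>2) * (1 + r) / x ^ 3"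
        using r x0 by (simp add: field_simps power2_eq_square power3_eq_cube)
      also have "cmod (K u) * ((1 - r\<^sup>2) * (1 + r) / x ^ 3) \<le> cmod (K u) * ((1 - r\<^sup>2) * 2 / x ^ 3)"
        using r x0 by (intro mult_left_mono divide_right_mono) (auto simp: power_le_one)
      also have "\<dots> \<le> (e * (2 * x) + M / d ^ 3 * (2 * x) ^ 3) * ((1 - r\<^sup>2) * 2 / x ^ 3)"
      proof (rule mult_right_mono)
        have "cmod (z0 - w) = 1 - r"
        proof -
          have "z0 - w = complex_of_real (1 - r) * z0" by (simp add: w_def algebra_simps)
          hence "cmod (z0 - w) = \<bar>1 - r\<bar>" using z0 by (metis norm_mult norm_of_real mult.right_neutral)
          thus ?thesis using r by simp
        qed
        moreover have "1 - r \<le> x" using norm_triangle_ineq2[of u w] u w1 by (simp add: x_def)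
        moreover have "cmod (u - z0) \<le> cmod (u - w) + cmod (w - z0)" using norm_triangle_ineq[of "u - w" "w - z0"] by simp
        ultimately have uz: "cmod (u - z0) \<le> 2 * x" by (simp add: x_def norm_minus_commute)
        show "cmod (K u) \<le> e * (2 * x) + M / d ^ 3 * (2 * x) ^ 3"
        proof (cases "cmod (u - z0) < d")
          case True
          hence "cmod (K u) \<le> e * cmod (u - z0)" using near u by simp
          also have "\<dots> \<le> e * (2 * x)" using e uz by (intro mult_left_mono) auto
          also have "\<dots> \<le> e * (2 * x) + M / d ^ 3 * (2 * x) ^ 3" using M d x0 by simp
          finally show ?thesis .
        next
          case False
          have "cmod (K u) \<le> M" using M u by simp
          also have "\<dots> = M / d ^ 3 * d ^ 3" using d by simp
          also have "\<dots> \<le> M / d ^ 3 * (2 * x) ^ 3" using False uz M d by (intro mult_left_mono power_mono) auto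
          also have "\<dots> \<le> e * (2 * x) + M / d ^ 3 * (2 * x) ^ 3" using e x0 by simp
          finally show ?thesis .
        qed
        show "0 \<le> (1 - r\<^sup>2) * 2 / x ^ 3" using r x0 by (simp add: power_le_one)
      qed
      also have "\<dots> = 4 * e * (1 - r\<^sup>2) * (1 / x\<^sup>2) + 16 * M / d ^ 3 * (1 - r\<^sup>2)"
        using x0 d by (simp add: field_simps power2_eq_square power3_eq_cube)
      finally show ?thesis by (simp add: x_def)
    qed
    have cD: "continuous_on {0..1} (\<lambda>t. D (cis (2 * pi * t)) * cis (2 * pi * t))"
      using continuous_on_circle[of "{0..1}" 1]
      by (intro continuous_intros continuous_on_compose2[OF Dc]) auto
    have cP: "continuous_on {0..1} (\<lambda>t. 1 / (cmod (cis (2 * pi * t) - w))\<^sup>2)"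
      using continuous_on_circle[of "{0..1}" 1] uw by (intro continuous_intros) auto
    have "cmod (g w - c) \<le> (LINT t|circ_meas. cmod (D (cis (2 * pi * t)) * cis (2 * pi * t)))"
      using DI integral_norm_bound[of circ_meas "\<lambda>t. D (cis (2 * pi * t)) * cis (2 * pi * t)"] by simp
    also have "\<dots> \<le> (LINT t|circ_meas. 4 * e * (1 - r\<^sup>2) * (1 / (cmod (cis (2 * pi * t) - w))\<^sup>2) + 16 * M / d ^ 3 * (1 - r\<^sup>2))"
    proof (rule integral_mono)
      show "integrable circ_meas (\<lambda>t. cmod (D (cis (2 * pi * t)) * cis (2 * pi * t)))"
        using circ_integrable_continuous[OF cD] by (rule integrable_norm)
      show "integrable circ_meas (\<lambda>t. 4 * e * (1 - r\<^sup>2) * (1 / (cmod (cis (2 * pi * t) - w))\<^sup>2) + 16 * M / d ^ 3 * (1 - r\<^sup>2))"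
        using circ_integrable_continuous[OF cP] by (intro Bochner_Integration.integrable_add integrable_mult_right) auto
      show "cmod (D (cis (2 * pi * t)) * cis (2 * pi * t)) \<le> 4 * e * (1 - r\<^sup>2) * (1 / (cmod (cis (2 * pi * t) - w))\<^sup>2) + 16 * M / d ^ 3 * (1 - r\<^sup>2)" for t
        using Db[of "cis (2 * pi * t)"] by (simp only: norm_mult norm_cis mult_1_right)
    qed
    also have "\<dots> = 4 * e * (1 - r\<^sup>2) * (LINT t|circ_meas. 1 / (cmod (cis (2 * pi * t) - w))\<^sup>2) + 16 * M / d ^ 3 * (1 - r\<^sup>2)"
      using circ_integrable_continuous[OF cP]
      by (subst Bochner_Integration.integral_add) (auto simp only: integrable_mult_right integral_mult_right_zero circ.integrable_const lebesgue_integral_const measure_circ_space space_circ scaleR_one)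
    \<comment> \<open>The mean \<open>1 / (1 - r^2)\<close> of the Poisson kernel cancels the factor
      in front, so the first term stays of size \<open>e\<close> while the second vanishes as
      \<open>r\<close> tends to 1.\<close>
    also have "\<dots> = 4 * e + 16 * M / d ^ 3 * (1 - r\<^sup>2)"
    proof -
      have "1 - r\<^sup>2 \<noteq> 0" using r by (simp add: power2_eq_1_iff)
      thus ?thesis unfolding Poisson_kernel_mean[OF w1(1)] w1(2) by simp
    qed
    finally show ?thesis by (simp add: w_def)
  qed
  show ?thesis
  proof (rule tendstoI)
    fix e :: real assume e: "e > 0"
    obtain d where d: "d > 0" "\<And>z. cmod z = 1 \<Longrightarrow> cmod (z - z0) < d \<Longrightarrow> cmod (K z) \<le> (e / 8) * cmod (z - z0)"
      using c[of "e / 8"] e unfolding K_def by auto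
    have "((\<lambda>r::real. 4 * (e / 8) + 16 * M / d ^ 3 * (1 - r\<^sup>2)) \<longlongrightarrow> 4 * (e / 8) + 16 * M / d ^ 3 * (1 - 1\<^sup>2)) (at_left 1)"
      by (intro tendsto_intros)
    hence "\<forall>\<^sub>F r in at_left 1. 4 * (e / 8) + 16 * M / d ^ 3 * (1 - r\<^sup>2) < e"
      by (rule order_tendstoD) (use e in auto)
    moreover have "\<forall>\<^sub>F r in at_left (1::real). 0 < r \<and> r < 1"
      using eventually_at_left_real[of 0 1] by (auto elim: eventually_mono)
    ultimately show "\<forall>\<^sub>F r in at_left 1. dist (g (complex_of_real r * z0)) c < e"
    proof eventually_elim
      case (elim r)
      thus ?case using key[of "e / 8" d r] e d by (simp add: dist_norm)
    qed
  qed
qed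

section \<open>Fatou's theorem for bounded holomorphic functions\<close>

lemma fourier_coeff_circle:
  assumes g: "g holomorphic_on ball 0 1" and r: "0 < r" "r < 1"
  shows "fourier_coeff (\<lambda>t. g (complex_of_real r * cis (2 * pi * t))) n
    = (if n \<ge> 0 then (deriv ^^ nat n) g 0 / fact (nat n) * of_real r ^ nat n else 0)"
proof -
  let ?z = "\<lambda>t. complex_of_real r * cis (2 * pi * t)"
  have gc: "continuous_on (cball 0 r) g" "g holomorphic_on ball 0 r"
    using g r by (auto intro!: holomorphic_on_imp_continuous_on intro: holomorphic_on_subset)
  show ?thesis
  proof (cases "n \<ge> 0")
    case True
    then obtain k where n: "n = int k" using nonneg_eq_int by blast
    have "((\<lambda>u. g u / (u - 0) ^ Suc k) has_contour_integral ((2 * pi * \<i>) / (fact k) * (deriv ^^ k) g 0)) (circlepath 0 r)"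
      using gc r by (intro Cauchy_has_contour_integral_higher_derivative_circlepath) auto
    moreover have "continuous_on (sphere 0 r) (\<lambda>u. g u / (u - 0) ^ Suc k)"
      using r by (intro continuous_intros continuous_on_subset[OF gc(1)]) auto
    ultimately have *: "(LINT t|circ_meas. g (?z t) / (?z t - 0) ^ Suc k * ?z t) = (2 * pi * \<i>) / (fact k) * (deriv ^^ k) g 0 / (2 * pi * \<i>)"
      using r(1) by (rule contour_integral_circ)
    have "g (?z t) / (?z t - 0) ^ Suc k * ?z t = (1 / of_real r ^ k) * (g (?z t) * cnj (tchar (int k) t))" for t
    proof -
      have "cis (2 * pi * t) ^ k * cnj (tchar (int k) t) = 1"
        unfolding tchar_of_nat[symmetric] cnj_tchar by (simp flip: tchar_add)
      hence "cnj (tchar (int k) t) = 1 / cis (2 * pi * t) ^ k" by (simp add: field_simps)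
      thus ?thesis using r by (simp add: power_mult_distrib)
    qed
    hence "(1 / of_real r ^ k) * (LINT t|circ_meas. g (?z t) * cnj (tchar (int k) t)) = (deriv ^^ k) g 0 / fact k"
      using * by simp
    thus ?thesis using r unfolding n fourier_coeff_eq_ip ip_def by (simp add: field_simps)
  next
    case False
    define m where "m = nat (- n)"
    have m: "- n = int m" "m > 0" using False by (auto simp: m_def)
    have "(LINT t|circ_meas. (\<lambda>u. g u * u ^ m) (?z t)) = (\<lambda>u. g u * u ^ m) 0"
      using gc r by (intro circ_mean_value continuous_intros holomorphic_intros) auto
    moreover have "g (?z t) * ?z t ^ m = of_real r ^ m * (g (?z t) * cnj (tchar n t))" for t
      unfolding cnj_tchar m(1) tchar_of_nat by (simp add: power_mult_distrib)
    ultimately have "of_real r ^ m * (LINT t|circ_meas. g (?z t) * cnj (tchar n t)) = (0::complex)" using m(2) by simp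
    thus ?thesis using r False unfolding fourier_coeff_eq_ip ip_def by simp
  qed
qed

text \<open>Bessel's inequality on a circle of radius \<open>r < 1\<close>, where \<open>g\<close>
  is continuous, followed by \<open>r\<close> tending to 1 in a finite sum; no boundary values are
  involved.\<close>

lemma Taylor_coeffs_square_sum_le:
  assumes g: "g holomorphic_on ball 0 1" and M: "\<And>z. cmod z < 1 \<Longrightarrow> cmod (g z) \<le> M"
  shows "(\<Sum>k<N. (cmod ((deriv ^^ k) g 0 / fact k))\<^sup>2) \<le> M\<^sup>2"
proof -
  let ?a = "\<lambda>k. (deriv ^^ k) g 0 / fact k"
  have *: "(\<Sum>k<N. (cmod (?a k) * r ^ k)\<^sup>2) \<le> M\<^sup>2" if r: "0 < r" "r < 1" for r
  proof -
    let ?f = "\<lambda>t. g (complex_of_real r * cis (2 * pi * t))"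
    have b: "cmod (?f t) \<le> M" for t using r by (intro M) (simp add: norm_mult)
    have "continuous_on {0..1} ?f"
      using r by (intro continuous_on_compose2[OF holomorphic_on_imp_continuous_on[OF g] continuous_on_circle]) (auto simp: norm_mult)
    hence m: "?f \<in> borel_measurable circ_meas" by (rule circ_continuous_measurable)
    have L: "L2T ?f" by (rule L2T_bounded[where B=M]) (use m b in auto)
    have "(\<Sum>k<N. (cmod (?a k) * r ^ k)\<^sup>2) = (\<Sum>k<N. (cmod (fourier_coeff ?f (int k)))\<^sup>2)"
      using r by (simp add: fourier_coeff_circle[OF g r] norm_mult norm_power norm_divide)
    also have "\<dots> \<le> (norm2 ?f)\<^sup>2" by (rule Bessel_fourier[OF L])
    also have "\<dots> \<le> M\<^sup>2"
    proof -
      have "norm2 (\<lambda>t. ?f t * 1) \<le> M * norm2 (\<lambda>t. 1)" by (rule norm2_mult_le) (use m b in auto)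
      thus ?thesis by (intro power_mono) (auto simp: norm2_def)
    qed
    finally show ?thesis .
  qed
  have "((\<lambda>r. \<Sum>k<N. (cmod (?a k) * r ^ k)\<^sup>2) \<longlongrightarrow> (\<Sum>k<N. (cmod (?a k) * 1 ^ k)\<^sup>2)) (at_left 1)"
    by (intro tendsto_intros)
  moreover have "\<forall>\<^sub>F r in at_left (1::real). (\<Sum>k<N. (cmod (?a k) * r ^ k)\<^sup>2) \<le> M\<^sup>2"
    using eventually_at_left_real[of 0 1] by (auto elim!: eventually_mono intro: *)
  ultimately have "(\<Sum>k<N. (cmod (?a k) * 1 ^ k)\<^sup>2) \<le> M\<^sup>2"
    by (rule tendsto_upperbound) simp
  thus ?thesis by simp
qed

lemma interval_sets_circ: "0 \<le> s \<Longrightarrow> t \<le> 1 \<Longrightarrow> {s..t} \<in> sets circ_meas"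
  unfolding circ_meas_def sets_restrict_space by (rule image_eqI[of _ _ "{s..t}"]) auto

lemma integral_tchar_interval:
  assumes n: "n \<noteq> 0" and st: "0 \<le> s" "s \<le> t" "t \<le> 1"
  shows "(LINT x|circ_meas. (2 * pi * \<i> * tchar n x) * indicator {s..t} x) = (tchar n t - tchar n s) / of_int n"
proof -
  define c where "c = 2 * complex_of_real pi * \<i> * of_int n"
  have c: "c \<noteq> 0" using n by (simp add: c_def)
  have te: "tchar n x = exp (c * of_real x)" for x
    by (simp add: tchar_def cis_conv_exp c_def mult_ac)
  have "((\<lambda>x. exp (c * of_real x)) has_integral (exp (c * of_real t) / c - exp (c * of_real s) / c)) {s..t}"
  proof (rule fundamental_theorem_of_calculus)
    fix x :: real
    have "((\<lambda>z. exp (c * z) / c) has_field_derivative exp (c * of_real x)) (at (of_real x))"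
      using c by (auto intro!: derivative_eq_intros)
    thus "((\<lambda>x. exp (c * of_real x) / c) has_vector_derivative exp (c * of_real x)) (at x within {s..t})"
      by (rule has_vector_derivative_real_field)
  qed (use st in auto)
  hence "((\<lambda>x. 2 * pi * \<i> * tchar n x) has_integral (2 * pi * \<i> * (exp (c * of_real t) / c - exp (c * of_real s) / c))) {s..t}"
    unfolding te by (rule has_integral_mult_right)
  also have "2 * pi * \<i> * (exp (c * of_real t) / c - exp (c * of_real s) / c) = (tchar n t - tchar n s) / of_int n"
    using n unfolding te by (simp add: c_def field_simps)
  finally have "((\<lambda>x. if x \<in> {s..t} then 2 * pi * \<i> * tchar n x else 0) has_integral ((tchar n t - tchar n s) / of_int n)) {0..1}"
    using st by (subst has_integral_restrict) auto
  hence I: "integral {0..1} (\<lambda>x. (2 * pi * \<i> * tchar n x) * indicator {s..t} x) = (tchar n t - tchar n s) / of_int n"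
    by (rule integral_unique[OF has_integral_eq[rotated]]) (auto simp: indicator_def)
  have im: "(indicator {s..t} :: real \<Rightarrow> complex) \<in> borel_measurable circ_meas"
    using st by (intro borel_measurable_indicator) (auto intro: interval_sets_circ)
  have "integrable circ_meas (\<lambda>x. (2 * pi * \<i> * tchar n x) * indicator {s..t} x)"
    by (rule integrable_L2T_mult[OF L2T_scale[OF L2T_tchar] L2T_bounded[OF im, where B=1]]) (simp add: indicator_def)
  thus ?thesis unfolding circ_meas_def using I by (subst lebesgue_integral_eq_integral) auto
qed

text \<open>The differentiation theorem controls averages over intervals to the right of a point.
  Left averages come from the reflected function, whose exceptional set is reflected back.\<close>

lemma Lebesgue_differentiation_interval:
  fixes \<gamma> f :: "real \<Rightarrow> complex"
  assumes \<gamma>: "integrable circ_meas \<gamma>"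
    and f: "\<And>s t. 0 \<le> s \<Longrightarrow> s \<le> t \<Longrightarrow> t \<le> 1 \<Longrightarrow> (LINT x|circ_meas. \<gamma> x * indicator {s..t} x) = f t - f s"
  shows "AE t in circ_meas. 0 < t \<and> t < 1 \<and> (\<forall>e>0. \<exists>d>0. \<forall>s\<in>{0..1}. \<bar>s - t\<bar> < d \<longrightarrow> cmod (f s - f t - \<gamma> t * of_real (s - t)) \<le> e * \<bar>s - t\<bar>)"
proof -
  \<comment> \<open>Extension by zero, because integrability is required on every box, including
    those that leave \<open>{0..1}\<close>.\<close>
  define \<gamma>' where "\<gamma>' x = (if x \<in> {0..1} then \<gamma> x else 0)" for x
  have "\<gamma> integrable_on {0..1}"
    using has_integral_integral_lebesgue_on[OF \<gamma>[unfolded circ_meas_def]] by (auto simp: integrable_on_def)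
  hence U: "\<gamma>' integrable_on UNIV" unfolding \<gamma>'_def by (simp only: integrable_restrict_UNIV)
  have i1: "\<gamma>' integrable_on cbox a b" for a b by (rule integrable_on_subcbox[OF U]) auto
  have i2: "(\<lambda>x. \<gamma>' (- x)) integrable_on cbox a b" for a b
    using i1[of "- b" "- a"] Henstock_Kurzweil_Integration.integrable_reflect_real[where f=\<gamma>' and a="- b" and b="- a"] by simp
  have fI: "integral {s..t} \<gamma>' = f t - f s" if "0 \<le> s" "s \<le> t" "t \<le> 1" for s t
  proof -
    have "integrable circ_meas (\<lambda>x. indicator {s..t} x *\<^sub>R \<gamma> x)"
      using \<gamma> by (rule integrable_mult_indicator[rotated]) (intro interval_sets_circ that)
    moreover have "indicator {s..t} x *\<^sub>R \<gamma> x = \<gamma> x * indicator {s..t} x" for x by (simp add: indicator_def)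
    ultimately have "integral {0..1} (\<lambda>x. \<gamma> x * indicator {s..t} x) = f t - f s"
      using f[OF that] unfolding circ_meas_def by (subst (asm) lebesgue_integral_eq_integral) auto
    moreover have "integral {0..1} (\<lambda>x. \<gamma> x * indicator {s..t} x) = integral {0..1} (\<lambda>x. if x \<in> {s..t} then \<gamma>' x else 0)"
      by (rule integral_cong) (auto simp: \<gamma>'_def)
    moreover have "\<dots> = integral ({s..t} \<inter> {0..1}) \<gamma>'" by (rule integral_restrict_Int)
    moreover have "{s..t} \<inter> {0..1} = {s..t}" using that by auto
    ultimately show ?thesis by metis
  qed
  obtain N1 where N1: "negligible N1" "\<And>x e. \<lbrakk>x \<notin> N1; 0 < e\<rbrakk> \<Longrightarrow> \<exists>d>0. \<forall>h. 0 < h \<and> h < d \<longrightarrow>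
      norm (integral (cbox x (x + h *\<^sub>R One)) \<gamma>' /\<^sub>R h ^ DIM(real) - \<gamma>' x) < e"
    by (rule integrable_ccontinuous_explicit[OF i1]) (rule that)
  obtain N2 where N2: "negligible N2" "\<And>x e. \<lbrakk>x \<notin> N2; 0 < e\<rbrakk> \<Longrightarrow> \<exists>d>0. \<forall>h. 0 < h \<and> h < d \<longrightarrow>
      norm (integral (cbox x (x + h *\<^sub>R One)) (\<lambda>x. \<gamma>' (- x)) /\<^sub>R h ^ DIM(real) - \<gamma>' (- x)) < e"
    by (rule integrable_ccontinuous_explicit[OF i2]) (rule that)
  have "negligible (uminus ` N2)" 
    by (rule negligible_differentiable_image_negligible[OF _ N2(1)]) (auto intro!: derivative_intros simp: differentiable_on_def)
  hence "negligible (N1 \<union> uminus ` N2 \<union> {0, 1})" using N1(1) by (intro negligible_Un) auto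
  hence "AE t in lebesgue. t \<notin> N1 \<union> uminus ` N2 \<union> {0, 1}"
    by (intro AE_not_in) (simp add: negligible_iff_null_sets)
  hence "AE t in circ_meas. t \<notin> N1 \<union> uminus ` N2 \<union> {0, 1}"
    unfolding circ_meas_def by (subst AE_restrict_space_iff) (auto elim: eventually_mono)
  moreover have "AE t in circ_meas. t \<in> {0..1}" using AE_space[of circ_meas] by simp
  ultimately show ?thesis
  proof eventually_elim
    case (elim t)
    have t: "0 < t" "t < 1" using elim by auto
    have "\<exists>d>0. \<forall>s\<in>{0..1}. \<bar>s - t\<bar> < d \<longrightarrow> cmod (f s - f t - \<gamma> t * of_real (s - t)) \<le> e * \<bar>s - t\<bar>" if e: "e > 0" for e
    proof -
      obtain d1 where d1: "d1 > 0" "\<And>h. 0 < h \<Longrightarrow> h < d1 \<Longrightarrow> norm (integral {t..t + h} \<gamma>' /\<^sub>R h - \<gamma>' t) < e"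
        using N1(2)[of t e] elim e by auto
      have "- t \<notin> N2" using elim by (metis UnI1 UnI2 imageI minus_minus)
      then obtain d2 where d2: "d2 > 0" "\<And>h. 0 < h \<Longrightarrow> h < d2 \<Longrightarrow> norm (integral {-t..-t + h} (\<lambda>x. \<gamma>' (- x)) /\<^sub>R h - \<gamma>' t) < e"
        using N2(2)[of "- t" e] e by auto
      have \<gamma>t: "\<gamma>' t = \<gamma> t" using t by (simp add: \<gamma>'_def)
      have conv: "cmod (x - y * of_real h) \<le> e * h" if "norm (x /\<^sub>R h - y) < e" "h > 0" for x y :: complex and h
      proof -
        have "x - y * of_real h = h *\<^sub>R (x /\<^sub>R h - y)" using that(2) by (simp add: scaleR_conv_of_real field_simps)
        hence "cmod (x - y * of_real h) = h * norm (x /\<^sub>R h - y)" using that(2) by (metis norm_scaleR abs_of_pos)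
        also have "\<dots> \<le> h * e" using that by (intro mult_left_mono) auto
        finally show ?thesis by (simp add: mult.commute)
      qed
      show ?thesis
      proof (intro exI[of _ "min d1 d2"] conjI ballI impI)
        fix s assume s: "s \<in> {0..1}" "\<bar>s - t\<bar> < min d1 d2"
        consider "s = t" | "s > t" | "s < t" by linarith
        thus "cmod (f s - f t - \<gamma> t * of_real (s - t)) \<le> e * \<bar>s - t\<bar>"
        proof cases
          case 2
          have "norm (integral {t..t + (s - t)} \<gamma>' /\<^sub>R (s - t) - \<gamma>' t) < e" by (rule d1) (use 2 s in auto)
          hence "cmod (integral {t..s} \<gamma>' - \<gamma> t * of_real (s - t)) \<le> e * (s - t)" 
            using conv[where x="integral {t..s} \<gamma>'" and h="s - t" and y="\<gamma> t"] 2 \<gamma>t by (simp del: of_real_diff)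
          moreover have "integral {t..s} \<gamma>' = f s - f t" using s t 2 by (intro fI) auto
          ultimately show ?thesis using 2 by simp
        next
          case 3
          have "norm (integral {-t..-t + (t - s)} (\<lambda>x. \<gamma>' (- x)) /\<^sub>R (t - s) - \<gamma>' t) < e" by (rule d2) (use 3 s in auto)
          moreover have "integral {-t..-t + (t - s)} (\<lambda>x. \<gamma>' (- x)) = integral {s..t} \<gamma>'" by simp
          moreover have "integral {s..t} \<gamma>' = f t - f s" using s t 3 by (intro fI) auto
          ultimately have "cmod (f t - f s - \<gamma> t * of_real (t - s)) \<le> e * (t - s)" 
            using conv[where x="f t - f s" and h="t - s" and y="\<gamma> t"] 3 \<gamma>t by (simp del: of_real_diff)
          moreover have "f s - f t - \<gamma> t * of_real (s - t) = - (f t - f s - \<gamma> t * of_real (t - s))" by (simp add: algebra_simps)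
          ultimately show ?thesis using 3 by (metis norm_minus_cancel abs_minus_commute abs_of_pos diff_gt_0_iff_gt)
        qed simp
      qed (use d1 d2 in auto)
    qed
    with t show ?case by blast
  qed
qed

text \<open>Chain rule for the inverse of the parametrisation. Its speed \<open>2 * pi\<close>
  exceeds 2, which gives \<open>\<bar>s - t\<bar> <= cmod (z - cis (2 * pi * t))\<close> close to
  \<open>t\<close>, so errors measured in the parameter are bounded by errors measured on the
  circle.\<close>

lemma circle_derivative_transfer:
  fixes f :: "real \<Rightarrow> complex" and F :: "complex \<Rightarrow> complex"
  assumes t: "0 < t" "t < 1"
    and f: "\<And>s. f s = F (cis (2 * pi * s))"
    and d: "\<And>e. e > 0 \<Longrightarrow> \<exists>d>0. \<forall>s\<in>{0..1}. \<bar>s - t\<bar> < d \<longrightarrow>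
       cmod (f s - f t - 2 * pi * \<i> * cis (2 * pi * t) * c * of_real (s - t)) \<le> e * \<bar>s - t\<bar>"
    and e: "e > 0"
  shows "\<exists>d>0. \<forall>z. cmod z = 1 \<and> cmod (z - cis (2 * pi * t)) < d \<longrightarrow>
     cmod (F z - F (cis (2 * pi * t)) - c * (z - cis (2 * pi * t))) \<le> e * cmod (z - cis (2 * pi * t))"
proof -
  let ?z = "\<lambda>s. cis (2 * pi * s)"
  have zd: "\<exists>d>0. \<forall>s. \<bar>s - t\<bar> < d \<longrightarrow> cmod (?z s - ?z t - 2 * pi * \<i> * ?z t * of_real (s - t)) \<le> e * \<bar>s - t\<bar>" if "e > 0" for e
  proof -
    have "((\<lambda>z. exp (2 * pi * \<i> * z)) has_field_derivative 2 * pi * \<i> * exp (2 * pi * \<i> * of_real t)) (at (of_real t))"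
      by (auto intro!: derivative_eq_intros)
    hence "((\<lambda>s. exp (2 * pi * \<i> * of_real s)) has_vector_derivative 2 * pi * \<i> * exp (2 * pi * \<i> * of_real t)) (at t)"
      by (rule has_vector_derivative_real_field)
    moreover have "exp (2 * pi * \<i> * of_real s) = ?z s" for s by (simp add: cis_conv_exp mult_ac)
    ultimately have "(?z has_vector_derivative 2 * pi * \<i> * ?z t) (at t)" by simp
    hence "(?z has_derivative (\<lambda>x. x *\<^sub>R (2 * pi * \<i> * ?z t))) (at t)" by (simp add: has_vector_derivative_def)
    hence "\<exists>d>0. \<forall>s. norm (s - t) < d \<longrightarrow> norm (?z s - ?z t - (s - t) *\<^sub>R (2 * pi * \<i> * ?z t)) \<le> e * norm (s - t)"
      using that unfolding has_derivative_at_alt by blast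
    thus ?thesis by (simp add: scaleR_conv_of_real mult_ac)
  qed
  define e1 e2 where "e1 = e / 2" and "e2 = e / (2 * (cmod c + 1))"
  have c1: "cmod c + 1 > 0" by (simp add: add_nonneg_pos)
  have pos: "e1 > 0" "e2 > 0" using e c1 by (simp_all add: e1_def e2_def)
  obtain d1 where d1: "d1 > 0" "\<And>s. s \<in> {0..1} \<Longrightarrow> \<bar>s - t\<bar> < d1 \<Longrightarrow> cmod (f s - f t - 2 * pi * \<i> * ?z t * c * of_real (s - t)) \<le> e1 * \<bar>s - t\<bar>"
    using d[OF pos(1)] by blast
  obtain d2 where d2: "d2 > 0" "\<And>s. \<bar>s - t\<bar> < d2 \<Longrightarrow> cmod (?z s - ?z t - 2 * pi * \<i> * ?z t * of_real (s - t)) \<le> e2 * \<bar>s - t\<bar>"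
    using zd[OF pos(2)] by blast
  obtain d3 where d3: "d3 > 0" "\<And>s. \<bar>s - t\<bar> < d3 \<Longrightarrow> cmod (?z s - ?z t - 2 * pi * \<i> * ?z t * of_real (s - t)) \<le> 1 * \<bar>s - t\<bar>"
    using zd[of 1] by auto
  define \<delta> where "\<delta> = min d1 (min d2 d3)"
  have \<delta>: "\<delta> > 0" using d1 d2 d3 by (simp add: \<delta>_def)
  \<comment> \<open>Parameters far from \<open>t\<close> form a compact set whose image misses
    \<open>cis (2 * pi * t)\<close>; \<open>t\<close> being interior excludes the one identification
    of 0 with 1. Hence points close on the circle have close parameters.\<close>
  define S where "S = ?z ` ({0..1} \<inter> {s. \<delta> \<le> \<bar>s - t\<bar>})"
  have "compact S" unfolding S_def
  proof (rule compact_continuous_image)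
    show "continuous_on ({0..1} \<inter> {s. \<delta> \<le> \<bar>s - t\<bar>}) ?z" using continuous_on_circle[of _ 1] by simp
    show "compact ({0..1} \<inter> {s. \<delta> \<le> \<bar>s - t\<bar>})"
      by (intro compact_Int_closed compact_Icc closed_Collect_le continuous_intros)
  qed
  moreover have "S \<inter> {?z t} = {}"
  proof -
    have "?z s \<noteq> ?z t" if "s \<in> {0..1}" "\<delta> \<le> \<bar>s - t\<bar>" for s
      using cis_circle_inj[of s t] that t \<delta> by (auto simp: doubleton_eq_iff)
    thus ?thesis unfolding S_def by fastforce
  qed
  ultimately obtain d where dd: "d > 0" "\<And>x. x \<in> S \<Longrightarrow> d \<le> dist x (?z t)"
    using separate_compact_closed[of S "{?z t}"] by auto
  show ?thesis
  proof (intro exI[of _ d] conjI allI impI dd(1))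
    fix z assume z: "cmod z = 1 \<and> cmod (z - ?z t) < d"
    have "z \<in> ?z ` {0..1}" using z by (simp add: cis_circle_surj)
    then obtain s where s: "s \<in> {0..1}" "z = ?z s" by blast
    have "\<bar>s - t\<bar> < \<delta>"
    proof (rule ccontr)
      assume "\<not> \<bar>s - t\<bar> < \<delta>"
      hence "z \<in> S" using s by (auto simp: S_def)
      thus False using dd(2)[of z] z by (simp add: dist_norm)
    qed
    hence s1: "\<bar>s - t\<bar> < d1" "\<bar>s - t\<bar> < d2" "\<bar>s - t\<bar> < d3" by (auto simp: \<delta>_def)
    have low: "\<bar>s - t\<bar> \<le> cmod (z - ?z t)"
    proof -
      have "cmod (2 * pi * \<i> * ?z t * of_real (s - t)) = 2 * pi * \<bar>s - t\<bar>" by (simp add: norm_mult del: of_real_diff)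
      moreover have "cmod (2 * pi * \<i> * ?z t * of_real (s - t)) \<le> cmod (z - ?z t) + \<bar>s - t\<bar>"
        using d3(2)[OF s1(3)] norm_triangle_ineq2[of "2 * pi * \<i> * ?z t * of_real (s - t)" "z - ?z t"] s(2)
        by (simp add: norm_minus_commute)
      moreover have "2 * \<bar>s - t\<bar> \<le> 2 * pi * \<bar>s - t\<bar>" using pi_gt3 by (intro mult_right_mono) auto
      ultimately have "2 * \<bar>s - t\<bar> \<le> cmod (z - ?z t) + \<bar>s - t\<bar>" by (metis order_trans)
      thus ?thesis by simp
    qed
    let ?A = "f s - f t - 2 * pi * \<i> * ?z t * c * of_real (s - t)"
    let ?B = "?z s - ?z t - 2 * pi * \<i> * ?z t * of_real (s - t)"
    have "F z - F (?z t) - c * (z - ?z t) = ?A - c * ?B"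
      unfolding s(2) f by (simp add: algebra_simps)
    hence "cmod (F z - F (?z t) - c * (z - ?z t)) \<le> cmod ?A + cmod c * cmod ?B"
      by (metis norm_mult norm_triangle_ineq4)
    also have "\<dots> \<le> e1 * \<bar>s - t\<bar> + cmod c * (e2 * \<bar>s - t\<bar>)"
      by (intro add_mono mult_left_mono d1 d2 s s1) auto
    also have "\<dots> = (e1 + cmod c * e2) * \<bar>s - t\<bar>" by (simp add: algebra_simps)
    also have "\<dots> \<le> e * \<bar>s - t\<bar>"
    proof (rule mult_right_mono)
      have "cmod c * e2 \<le> (cmod c + 1) * e2" using pos by (intro mult_right_mono) auto
      also have "\<dots> = e / 2"
      proof -
        have "x * (e / (2 * x)) = e / 2" if "x > 0" for x using that by (simp add: field_simps)
        thus ?thesis unfolding e2_def using c1 by blast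
      qed
      finally show "e1 + cmod c * e2 \<le> e" by (simp add: e1_def)
    qed simp
    also have "\<dots> \<le> e * cmod (z - ?z t)" using low e by (intro mult_left_mono) auto
    finally show "cmod (F z - F (?z t) - c * (z - ?z t)) \<le> e * cmod (z - ?z t)" .
  qed
qed

text \<open>The primitive has coefficients \<open>a (n - 1) / n\<close>, absolutely summable since
  \<open>2 * x * y <= x^2 + y^2\<close>, and so extends continuously to the closed disc. Almost
  everywhere its derivative along the circle is \<open>G\<close>, and the derivative
  \<open>g\<close> of the primitive inside the disc follows it radially.\<close>

theorem Fatou_bounded_holomorphic:
  assumes "Hinf g"
  obtains G where "L2T G" "AE t in circ_meas. ((\<lambda>r::real. g (complex_of_real r * cis (2 * pi * t))) \<longlongrightarrow> G t) (at_left 1)"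
proof -
  have g: "g holomorphic_on ball 0 1" using assms by (simp add: Hinf_def)
  obtain M where "\<forall>z\<in>ball 0 1. cmod (g z) \<le> M"
    using assms unfolding Hinf_def bounded_iff by auto
  hence M: "\<And>z. cmod z < 1 \<Longrightarrow> cmod (g z) \<le> M" by simp
  define a where "a k = (deriv ^^ k) g 0 / fact k" for k
  have a2: "summable (\<lambda>k. (cmod (a k))\<^sup>2)"
    by (rule bounded_imp_summable[where B="M\<^sup>2"])
      (auto simp only: zero_le_power2 lessThan_Suc_atMost[symmetric] a_def Taylor_coeffs_square_sum_le[OF g M])
  \<comment> \<open>The candidate for the boundary function, summed in quadratic mean from the
    Taylor coefficients before any radial limit is known to exist.\<close>
  obtain G where G: "L2T G" "(\<lambda>N. norm2 (\<lambda>t. tsum a {..<N} t - G t)) \<longlonglongrightarrow> 0"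
    by (rule Riesz_Fischer[OF a2]) (rule that)
  define \<alpha> where "\<alpha> n = (if n = 0 then 0 else a (n - 1) / of_nat n)" for n
  have \<alpha>s: "summable (\<lambda>n. cmod (\<alpha> n))"
  proof -
    have s1: "summable (\<lambda>k. (cmod (a k))\<^sup>2 + 1 / (real (Suc k))\<^sup>2)"
    proof (rule summable_add[OF a2])
      have "summable (\<lambda>k. 1 / (real k)\<^sup>2)" using inverse_power_summable[of 2, where 'a=real] by (simp add: inverse_eq_divide power_divide)
      thus "summable (\<lambda>k. 1 / (real (Suc k))\<^sup>2)" by (subst summable_Suc_iff)
    qed
    have "norm (cmod (\<alpha> (Suc k))) \<le> (cmod (a k))\<^sup>2 + 1 / (real (Suc k))\<^sup>2" for k
    proof -
      define y where "y = 1 / real (Suc k)"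
      have "0 \<le> cmod (a k) * y" by (simp add: y_def)
      moreover have "2 * (cmod (a k) * y) \<le> (cmod (a k))\<^sup>2 + y\<^sup>2" using sum_squares_bound[of "cmod (a k)" y] by (simp add: mult.assoc)
      moreover have "norm (cmod (\<alpha> (Suc k))) = cmod (a k) * y" by (simp add: \<alpha>_def y_def norm_divide del: of_nat_Suc)
      moreover have "y\<^sup>2 = 1 / (real (Suc k))\<^sup>2" by (simp add: y_def power_divide del: of_nat_Suc)
      ultimately show ?thesis by linarith
    qed
    hence "summable (\<lambda>k. cmod (\<alpha> (Suc k)))" by (intro summable_comparison_test'[OF s1, of 0])
    thus ?thesis by (subst (asm) summable_Suc_iff)
  qed
  define F where "F z = (\<Sum>n. \<alpha> n * z ^ n)" for z
  have unif: "uniform_limit (cball 0 1) (\<lambda>N z. \<Sum>n<N. \<alpha> n * z ^ n) F sequentially"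
    unfolding F_def
  proof (rule Weierstrass_m_test[OF _ \<alpha>s])
    fix n and z :: complex assume "z \<in> cball 0 1"
    hence "cmod (\<alpha> n) * cmod z ^ n \<le> cmod (\<alpha> n) * 1" by (intro mult_left_mono power_le_one) auto
    thus "cmod (\<alpha> n * z ^ n) \<le> cmod (\<alpha> n)" by (simp add: norm_mult norm_power)
  qed
  have Fc: "continuous_on (cball 0 1) F"
    by (rule uniform_limit_theorem[OF _ unif]) (auto intro!: always_eventually continuous_intros)
  have Fd: "(F has_field_derivative g w) (at w)" if w: "cmod w < 1" for w
  proof -
    have "\<exists>P P'. \<forall>z. cmod z < 1 \<longrightarrow> ((\<lambda>n. \<alpha> n * z ^ n) sums P z) \<and>
        ((\<lambda>n. of_nat n * \<alpha> n * z ^ (n - 1)) sums P' z) \<and> (P has_field_derivative P' z) (at z)"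
      by (rule power_series_and_derivative_0[of \<alpha> 1]) (use summable_norm_cancel[OF \<alpha>s] in simp)
    then obtain P P' where PP: "\<forall>z. cmod z < 1 \<longrightarrow> ((\<lambda>n. \<alpha> n * z ^ n) sums P z) \<and>
        ((\<lambda>n. of_nat n * \<alpha> n * z ^ (n - 1)) sums P' z) \<and> (P has_field_derivative P' z) (at z)" by blast
    hence P: "\<And>z. cmod z < 1 \<Longrightarrow> (\<lambda>n. \<alpha> n * z ^ n) sums P z"
        "\<And>z. cmod z < 1 \<Longrightarrow> (\<lambda>n. of_nat n * \<alpha> n * z ^ (n - 1)) sums P' z"
        "\<And>z. cmod z < 1 \<Longrightarrow> (P has_field_derivative P' z) (at z)" by auto
    have "(\<lambda>k. (deriv ^^ k) g 0 / fact k * (w - 0) ^ k) sums g w"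
      using w by (intro holomorphic_power_series[OF g]) simp
    moreover have "of_nat (Suc k) * \<alpha> (Suc k) * w ^ (Suc k - 1) = (deriv ^^ k) g 0 / fact k * (w - 0) ^ k" for k
      by (simp add: \<alpha>_def a_def del: of_nat_Suc)
    ultimately have "(\<lambda>k. of_nat (Suc k) * \<alpha> (Suc k) * w ^ (Suc k - 1)) sums g w" by (simp only:)
    from sums_Suc[OF this] have "(\<lambda>n. of_nat n * \<alpha> n * w ^ (n - 1)) sums g w" by (simp add: \<alpha>_def)
    with P(2)[OF w] have "P' w = g w" by (rule sums_unique2)
    with P(3)[OF w] have "(P has_field_derivative g w) (at w)" by simp
    thus ?thesis
      by (rule has_field_derivative_transform_within_open[where S="ball 0 1"])
        (use w P(1) in \<open>auto simp: F_def sums_iff\<close>)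
  qed
  define f where "f t = F (cis (2 * pi * t))" for t
  \<comment> \<open>\<open>2 * pi * \<i> * tchar 1 x\<close> is the derivative of
    \<open>cis (2 * pi * x)\<close>, so \<open>\<gamma>\<close> is the expected derivative of
    \<open>f\<close> in the parameter.\<close>
  define \<gamma> where "\<gamma> x = 2 * pi * \<i> * tchar 1 x * G x" for x
  have L\<gamma>: "L2T \<gamma>" unfolding \<gamma>_def
    by (rule L2T_mult_bounded[OF G(1), where B="2 * pi"]) (auto simp: norm_mult)
  have fi: "(LINT x|circ_meas. \<gamma> x * indicator {s..t} x) = f t - f s" if st: "0 \<le> s" "s \<le> t" "t \<le> 1" for s t
  proof -
    define h where "h x = cnj (2 * pi * \<i> * tchar 1 x * indicator {s..t} x)" for x
    have im: "(indicator {s..t} :: real \<Rightarrow> complex) \<in> borel_measurable circ_meas"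
      using st by (intro borel_measurable_indicator) (auto intro: interval_sets_circ)
    have Li: "L2T (indicator {s..t})" by (rule L2T_bounded[OF im, where B=1]) (simp add: indicator_def)
    have Lh: "L2T h" unfolding h_def
      by (rule L2T_cnj, rule L2T_mult_bounded[OF Li, where B="2 * pi"]) (auto simp: norm_mult)
    have "(\<lambda>N. ip (tsum a {..<N}) h) \<longlonglongrightarrow> ip G h" by (rule ip_tendsto) (use G Lh in auto)
    \<comment> \<open>Integrating the \<open>N\<close> characters over \<open>{s..t}\<close> raises
      each frequency by one and divides by it, which yields the partial sums of \<open>F\<close>
      with \<open>Suc N\<close> terms, as \<open>\<alpha> 0 = 0\<close>.\<close>
    moreover have "ip (tsum a {..<N}) h = (\<Sum>n<Suc N. \<alpha> n * cis (2 * pi * t) ^ n) - (\<Sum>n<Suc N. \<alpha> n * cis (2 * pi * s) ^ n)" for N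
    proof -
      have "ip (tchar (int k)) h = (tchar (int (Suc k)) t - tchar (int (Suc k)) s) / of_nat (Suc k)" for k
      proof -
        have "ip (tchar (int k)) h = (LINT x|circ_meas. (2 * pi * \<i> * tchar (int (Suc k)) x) * indicator {s..t} x)"
          unfolding ip_def h_def by (simp add: tchar_add mult_ac)
        also have "\<dots> = (tchar (int (Suc k)) t - tchar (int (Suc k)) s) / of_int (int (Suc k))"
          by (rule integral_tchar_interval[OF _ st]) simp
        finally show ?thesis by simp
      qed
      hence "ip (tsum a {..<N}) h = (\<Sum>k<N. \<alpha> (Suc k) * cis (2 * pi * t) ^ Suc k - \<alpha> (Suc k) * cis (2 * pi * s) ^ Suc k)"
        unfolding ip_tsum_left[OF Lh] tchar_of_nat
        by (intro sum.cong) (simp_all add: \<alpha>_def right_diff_distrib diff_divide_distrib)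
      thus ?thesis by (simp only: sum.lessThan_Suc_shift sum_subtractf) (simp add: \<alpha>_def)
    qed
    moreover have "(\<lambda>N. (\<Sum>n<Suc N. \<alpha> n * cis (2 * pi * t) ^ n) - (\<Sum>n<Suc N. \<alpha> n * cis (2 * pi * s) ^ n)) \<longlonglongrightarrow> f t - f s"
      unfolding f_def by (intro tendsto_diff LIMSEQ_Suc tendsto_uniform_limitI[OF unif]) auto
    ultimately have "ip G h = f t - f s" by (simp only: LIMSEQ_unique)
    moreover have "ip G h = (LINT x|circ_meas. \<gamma> x * indicator {s..t} x)"
      unfolding ip_def h_def \<gamma>_def by (simp add: mult_ac)
    ultimately show ?thesis by simp
  qed
  have "AE t in circ_meas. 0 < t \<and> t < 1 \<and> (\<forall>e>0. \<exists>d>0. \<forall>s\<in>{0..1}. \<bar>s - t\<bar> < d \<longrightarrow> cmod (f s - f t - \<gamma> t * of_real (s - t)) \<le> e * \<bar>s - t\<bar>)"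
    by (rule Lebesgue_differentiation_interval[OF integrable_L2T[OF L\<gamma>] fi])
  hence "AE t in circ_meas. ((\<lambda>r::real. g (complex_of_real r * cis (2 * pi * t))) \<longlongrightarrow> G t) (at_left 1)"
  proof eventually_elim
    case (elim t)
    have \<gamma>t: "\<gamma> t = 2 * pi * \<i> * cis (2 * pi * t) * G t" by (simp add: \<gamma>_def tchar_def)
    show ?case
    proof (rule radial_limit_of_derivative[OF Fc Fd])
      show "\<exists>d>0. \<forall>z. cmod z = 1 \<and> cmod (z - cis (2 * pi * t)) < d \<longrightarrow>
         cmod (F z - F (cis (2 * pi * t)) - G t * (z - cis (2 * pi * t))) \<le> e * cmod (z - cis (2 * pi * t))" if "e > 0" for e
        by (rule circle_derivative_transfer[where f=f]) (use elim that in \<open>auto simp: f_def \<gamma>t\<close>)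
    qed auto
  qed
  with G(1) show ?thesis by (rule that)
qed

section \<open>Boundary values and coanalytic Toeplitz operators\<close>

text \<open>A relation rather than a function: boundary values given by formulas, such as powers,
  polynomials or \<open>1 / b t\<close>, can be used directly and need not be written as
  \<open>bdry\<close> of something.\<close>

definition has_bdry :: "(complex \<Rightarrow> complex) \<Rightarrow> (real \<Rightarrow> complex) \<Rightarrow> bool" where
  "has_bdry f fb \<longleftrightarrow> Hinf f \<and> fb \<in> borel_measurable circ_meas \<and>
     (AE t in circ_meas. ((\<lambda>r::real. f (complex_of_real r * cis (2 * pi * t))) \<longlongrightarrow> fb t) (at_left 1))"

lemma has_bdryD:
  assumes "has_bdry f fb"
  shows "f holomorphic_on ball 0 1" "Hinf f" "fb \<in> borel_measurable circ_meas"
    "AE t in circ_meas. ((\<lambda>r::real. f (complex_of_real r * cis (2 * pi * t))) \<longlongrightarrow> fb t) (at_left 1)"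
  using assms by (auto simp: has_bdry_def Hinf_def)

lemma HinfE:
  assumes "Hinf f"
  obtains B where "\<And>z. cmod z < 1 \<Longrightarrow> cmod (f z) \<le> B"
proof -
  obtain B where "\<forall>z\<in>ball 0 1. cmod (f z) \<le> B" using assms unfolding Hinf_def bounded_iff by auto
  hence "cmod (f z) \<le> B" if "cmod z < 1" for z using that by simp
  thus ?thesis by (rule that)
qed

lemma has_bdry_bdry:
  assumes "Hinf g"
  shows "has_bdry g (bdry g)"
proof -
  obtain G where G: "L2T G" "AE t in circ_meas. ((\<lambda>r::real. g (complex_of_real r * cis (2 * pi * t))) \<longlongrightarrow> G t) (at_left 1)"
    by (rule Fatou_bounded_holomorphic[OF assms]) (rule that)
  have eq: "AE t in circ_meas. G t = bdry g t"
    using G(2)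
  proof eventually_elim
    case (elim t)
    thus ?case unfolding bdry_def by (intro tendsto_Lim[symmetric]) auto
  qed
  have "bdry g \<in> borel_measurable circ_meas" by (rule circ_AE_measurable[OF L2T_measurable[OF G(1)] eq])
  moreover have "AE t in circ_meas. ((\<lambda>r::real. g (complex_of_real r * cis (2 * pi * t))) \<longlongrightarrow> bdry g t) (at_left 1)"
    using G(2) eq by eventually_elim simp
  ultimately show ?thesis using assms by (simp add: has_bdry_def)
qed

text \<open>The compact set \<open>K\<close> keeps both the image and its radial limits inside the
  domain of \<open>\<phi>\<close>. The case beyond entire \<open>\<phi>\<close> is inversion on an
  annulus that contains the values of \<open>g\<close>.\<close>

lemma has_bdry_compose:
  assumes f: "has_bdry f fb" and B: "\<And>z. cmod z < 1 \<Longrightarrow> f z \<in> K" and K: "compact K"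
    and U: "open U" "K \<subseteq> U" "\<phi> holomorphic_on U"
  shows "has_bdry (\<lambda>z. \<phi> (f z)) (\<lambda>t. \<phi> (fb t))"
proof -
  have hol: "(\<lambda>z. \<phi> (f z)) holomorphic_on ball 0 1"
    using holomorphic_on_compose_gen[OF has_bdryD(1)[OF f] U(3)] B U(2) by (force simp: o_def)
  have \<phi>c: "continuous_on U \<phi>" using U(3) by (rule holomorphic_on_imp_continuous_on)
  have "bounded (\<phi> ` K)"
    by (intro compact_imp_bounded compact_continuous_image K continuous_on_subset[OF \<phi>c] U)
  hence bd: "bounded ((\<lambda>z. \<phi> (f z)) ` ball 0 1)" by (rule bounded_subset) (use B in auto)
  have inK: "AE t in circ_meas. fb t \<in> K"
    using has_bdryD(4)[OF f]
  proof eventually_elim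
    case (elim t)
    show ?case
    proof (rule Lim_in_closed_set[OF compact_imp_closed[OF K] _ _ elim])
      show "\<forall>\<^sub>F r in at_left 1. f (complex_of_real r * cis (2 * pi * t)) \<in> K"
        using eventually_at_left_real[of 0 "1::real"] by (rule eventually_mono) (auto intro!: B simp: norm_mult)
    qed simp
  qed
  have lim: "AE t in circ_meas. ((\<lambda>r::real. \<phi> (f (complex_of_real r * cis (2 * pi * t)))) \<longlongrightarrow> \<phi> (fb t)) (at_left 1)"
    using has_bdryD(4)[OF f] inK
  proof eventually_elim
    case (elim t)
    have "isCont \<phi> (fb t)" using elim(2) U \<phi>c continuous_on_eq_continuous_at by blast
    thus ?case using elim(1) by (rule isCont_tendsto_compose)
  qed
  \<comment> \<open>\<open>\<phi>\<close> need not be Borel outside \<open>U\<close>, so measurability comes from the truncated function.\<close>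
  have "(\<lambda>t. if fb t \<in> U then \<phi> (fb t) else 0) \<in> borel_measurable circ_meas"
  proof (rule measurable_compose[OF has_bdryD(3)[OF f]])
    show "(\<lambda>z. if z \<in> U then \<phi> z else 0) \<in> borel_measurable borel"
      using \<phi>c U(1) by (intro borel_measurable_continuous_on_if) auto
  qed
  moreover have "AE t in circ_meas. (if fb t \<in> U then \<phi> (fb t) else 0) = \<phi> (fb t)"
    using inK by eventually_elim (use U in auto)
  ultimately have "(\<lambda>t. \<phi> (fb t)) \<in> borel_measurable circ_meas" by (rule circ_AE_measurable)
  with hol bd lim show ?thesis by (simp add: has_bdry_def Hinf_def)
qed

lemma has_bdry_entire:
  assumes "has_bdry f fb" "\<phi> holomorphic_on UNIV"
  shows "has_bdry (\<lambda>z. \<phi> (f z)) (\<lambda>t. \<phi> (fb t))"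
proof -
  obtain B where "\<And>z. cmod z < 1 \<Longrightarrow> cmod (f z) \<le> B" by (rule HinfE[OF has_bdryD(2)[OF assms(1)]]) (rule that)
  thus ?thesis using assms(2) by (intro has_bdry_compose[OF assms(1), where K="cball 0 B" and U=UNIV]) auto
qed

lemma has_bdry_ident: "has_bdry (\<lambda>z. z) (\<lambda>t. cis (2 * pi * t))"
proof -
  have "bounded ((\<lambda>z::complex. z) ` ball 0 1)" by simp
  moreover have "((\<lambda>r::real. complex_of_real r * cis (2 * pi * t)) \<longlongrightarrow> complex_of_real 1 * cis (2 * pi * t)) (at_left 1)" for t
    by (intro tendsto_intros)
  moreover have "(\<lambda>t. cis (2 * pi * t)) \<in> borel_measurable circ_meas"
    using circ_continuous_measurable[OF continuous_on_circle[of _ 1]] by simp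
  ultimately show ?thesis by (simp add: has_bdry_def Hinf_def)
qed

lemma has_bdry_bounded:
  assumes "has_bdry f fb" "\<And>z. cmod z < 1 \<Longrightarrow> cmod (f z) \<le> B"
  shows "AE t in circ_meas. cmod (fb t) \<le> B"
  using has_bdryD(4)[OF assms(1)]
proof eventually_elim
  case (elim t)
  show ?case
  proof (rule tendsto_upperbound[OF tendsto_norm[OF elim]])
    show "\<forall>\<^sub>F r in at_left 1. cmod (f (complex_of_real r * cis (2 * pi * t))) \<le> B"
      using eventually_at_left_real[of 0 "1::real"] by (rule eventually_mono) (auto intro!: assms(2) simp: norm_mult)
  qed simp
qed

lemma L2T_has_bdry:
  assumes "has_bdry f fb"
  shows "L2T fb"
proof -
  obtain B where "\<And>z. cmod z < 1 \<Longrightarrow> cmod (f z) \<le> B" by (rule HinfE[OF has_bdryD(2)[OF assms]]) (rule that)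
  thus ?thesis using has_bdry_bounded[OF assms] has_bdryD(3)[OF assms] by (intro L2T_bounded) auto
qed

text \<open>Dominated convergence along radii increasing to 1. This ties the boundary function to
  the Taylor series, so negative coefficients vanish and the mean is the value at the
  origin.\<close>

lemma fourier_coeff_has_bdry:
  assumes f: "has_bdry f fb"
  shows "fourier_coeff fb n = (if n \<ge> 0 then (deriv ^^ nat n) f 0 / fact (nat n) else 0)"
proof -
  \<comment> \<open>The offset 2 keeps every radius strictly between 0 and 1.\<close>
  define r where "r i = 1 - 1 / real (i + 2)" for i :: nat
  have r: "0 < r i" "r i < 1" for i by (auto simp: r_def)
  have "(\<lambda>i. 1 - 1 / real (i + 2)) \<longlonglongrightarrow> 1 - 0"
    by (intro tendsto_intros LIMSEQ_ignore_initial_segment[OF lim_1_over_n])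
  hence rl: "r \<longlonglongrightarrow> 1" by (simp add: r_def[abs_def])
  have r1: "filterlim r (at_left 1) sequentially"
  proof -
    have "r i \<noteq> 1" for i using r(2)[of i] by simp
    thus ?thesis using rl r by (simp add: filterlim_at)
  qed
  obtain B where B: "\<And>z. cmod z < 1 \<Longrightarrow> cmod (f z) \<le> B" by (rule HinfE[OF has_bdryD(2)[OF f]]) (rule that)
  have "(\<lambda>i. LINT t|circ_meas. f (complex_of_real (r i) * cis (2 * pi * t)) * cnj (tchar n t)) \<longlonglongrightarrow> (LINT t|circ_meas. fb t * cnj (tchar n t))"
  proof (rule integral_dominated_convergence)
    show "(\<lambda>t. fb t * cnj (tchar n t)) \<in> borel_measurable circ_meas"
      using has_bdryD(3)[OF f] by (intro borel_measurable_times borel_measurable_cnj) auto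
    show "(\<lambda>t. f (complex_of_real (r i) * cis (2 * pi * t)) * cnj (tchar n t)) \<in> borel_measurable circ_meas" for i
    proof (rule circ_continuous_measurable)
      show "continuous_on {0..1} (\<lambda>t. f (complex_of_real (r i) * cis (2 * pi * t)) * cnj (tchar n t))"
        using r[of i]
        by (intro continuous_intros continuous_on_tchar
           continuous_on_compose2[OF holomorphic_on_imp_continuous_on[OF has_bdryD(1)[OF f]] continuous_on_circle])
          (auto simp: norm_mult)
    qed
    show "integrable circ_meas (\<lambda>t. B)" by simp
    show "AE t in circ_meas. (\<lambda>i. f (complex_of_real (r i) * cis (2 * pi * t)) * cnj (tchar n t)) \<longlonglongrightarrow> fb t * cnj (tchar n t)"
      using has_bdryD(4)[OF f]
    proof eventually_elim
      case (elim t)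
      show ?case by (intro tendsto_mult tendsto_const filterlim_compose[OF elim r1])
    qed
    show "AE t in circ_meas. norm (f (complex_of_real (r i) * cis (2 * pi * t)) * cnj (tchar n t)) \<le> B" for i
      using r[of i] by (intro always_eventually allI) (auto simp: norm_mult intro!: B)
  qed
  hence "(\<lambda>i. fourier_coeff (\<lambda>t. f (complex_of_real (r i) * cis (2 * pi * t))) n) \<longlonglongrightarrow> fourier_coeff fb n"
    by (simp add: fourier_coeff_eq_ip ip_def)
  hence "(\<lambda>i. if n \<ge> 0 then (deriv ^^ nat n) f 0 / fact (nat n) * of_real (r i) ^ nat n else 0) \<longlonglongrightarrow> fourier_coeff fb n"
    by (simp only: fourier_coeff_circle[OF has_bdryD(1)[OF f] r])
  moreover have "(\<lambda>i. if n \<ge> 0 then (deriv ^^ nat n) f 0 / fact (nat n) * of_real (r i) ^ nat n else 0)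
     \<longlonglongrightarrow> (if n \<ge> 0 then (deriv ^^ nat n) f 0 / fact (nat n) * of_real 1 ^ nat n else 0)"
    using rl by (cases "n \<ge> 0") (auto intro!: tendsto_eq_intros)
  ultimately have "fourier_coeff fb n = (if n \<ge> 0 then (deriv ^^ nat n) f 0 / fact (nat n) * of_real 1 ^ nat n else 0)"
    by (rule LIMSEQ_unique)
  thus ?thesis by simp
qed

lemma has_bdry_mean: "has_bdry f fb \<Longrightarrow> (LINT t|circ_meas. fb t) = f 0"
  using fourier_coeff_has_bdry[of f fb 0] by (simp add: fourier_coeff_eq_ip ip_def)

lemma fourier_coeff_mult_tchar: "fourier_coeff (\<lambda>t. f t * tchar m t) n = fourier_coeff f (n - m)"
proof -
  have "tchar m t * tchar (- n) t = tchar (- (n - m)) t" for t by (simp flip: tchar_add)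
  thus ?thesis by (simp add: fourier_coeff_eq_ip ip_def cnj_tchar mult.assoc)
qed

lemma fourier_coeff_cnj: "fourier_coeff (\<lambda>t. cnj (f t)) n = cnj (fourier_coeff f (- n))"
  unfolding fourier_coeff_eq_ip ip_def cnj_tchar
  by (subst Bochner_Integration.integral_cnj[symmetric]) (simp add: cnj_tchar)

text \<open>Multiplication by a character shifts coefficients to the right, which settles the
  partial sums of \<open>k\<close>; boundedness of \<open>fb\<close> passes the claim to the limit.
  So an analytic Toeplitz operator is plain multiplication.\<close>

lemma H2_mult_bdry:
  assumes f: "has_bdry f fb" and k: "k \<in> H2"
  shows "(\<lambda>t. fb t * k t) \<in> H2"
proof -
  obtain B where "\<And>z. cmod z < 1 \<Longrightarrow> cmod (f z) \<le> B" by (rule HinfE[OF has_bdryD(2)[OF f]]) (rule that)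
  hence B: "AE t in circ_meas. cmod (fb t) \<le> B" by (rule has_bdry_bounded[OF f])
  note fm = has_bdryD(3)[OF f]
  have L: "L2T (\<lambda>t. fb t * u t)" if "L2T u" for u by (rule L2T_mult_bounded[OF that fm B])
  define s where "s N = tsum (\<lambda>i. fourier_coeff k (int i)) {..<N}" for N
  show ?thesis
  proof (rule H2_limit[where f="\<lambda>N t. fb t * s N t"])
    show "L2T (\<lambda>t. fb t * k t)" by (rule L[OF H2_L2T[OF k]])
    show "(\<lambda>t. fb t * s N t) \<in> H2" for N
    proof -
      have "fourier_coeff (\<lambda>t. fb t * s N t) n = 0" if "n < 0" for n
      proof -
        have "fourier_coeff (\<lambda>t. fb t * s N t) n = fourier_coeff (\<lambda>t. \<Sum>i<N. fourier_coeff k (int i) * (fb t * tchar (int i) t)) n"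
          by (simp add: s_def tsum_def sum_distrib_left mult.left_commute)
        also have "\<dots> = (\<Sum>i<N. fourier_coeff k (int i) * fourier_coeff (\<lambda>t. fb t * tchar (int i) t) n)"
          unfolding fourier_coeff_eq_ip by (subst ip_sum_left) (auto intro!: L2T_scale L simp: ip_scale_left)
        also have "\<dots> = 0" using that by (simp add: fourier_coeff_mult_tchar fourier_coeff_has_bdry[OF f])
        finally show ?thesis .
      qed
      moreover have "L2T (s N)" by (simp add: s_def)
      ultimately show ?thesis using L by (simp add: H2_def)
    qed
    show "(\<lambda>N. norm2 (\<lambda>t. fb t * s N t - fb t * k t)) \<longlonglongrightarrow> 0"
    proof (rule Lim_null_comparison)
      have "norm2 (\<lambda>t. fb t * s N t - fb t * k t) \<le> B * norm2 (\<lambda>t. s N t - k t)" for N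
        using norm2_mult_le[OF L2T_diff[OF _ H2_L2T[OF k]] fm B, of "s N"] by (simp add: s_def right_diff_distrib)
      thus "\<forall>\<^sub>F N in sequentially. norm (norm2 (\<lambda>t. fb t * s N t - fb t * k t)) \<le> B * norm2 (\<lambda>t. s N t - k t)"
        by simp
      show "(\<lambda>N. B * norm2 (\<lambda>t. s N t - k t)) \<longlonglongrightarrow> 0"
        using tendsto_mult_right_zero[OF H2_partial_sums[OF k]] by (simp add: s_def)
    qed
  qed
qed

text \<open>Both inner operations can be removed: \<open>b t * h t\<close> already lies in
  \<open>H2\<close>, so the projection in \<open>toeplitz\<close> is invisible to \<open>f\<close>,
  and the projection of \<open>cnj (b t) * f t\<close> is a witness for the \<open>SOME\<close> in
  \<open>toeplitz_adj\<close>.\<close>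

lemma toeplitz_adj_spec:
  assumes g: "has_bdry g b" and f: "f \<in> H2"
  shows "toeplitz_adj b f \<in> H2" "h \<in> H2 \<Longrightarrow> ip (toeplitz_adj b f) h = ip f (\<lambda>t. b t * h t)"
proof -
  have t: "ip f (toeplitz b h) = ip f (\<lambda>t. b t * h t)" if h: "h \<in> H2" for h
  proof -
    have "ip (toeplitz b h) f = ip (\<lambda>t. b t * h t) f"
      unfolding toeplitz_def by (rule projH2_spec(2)[OF H2_L2T[OF H2_mult_bdry[OF g h]] f])
    thus ?thesis by (simp add: ip_cnj[of f])
  qed
  obtain B where "\<And>z. cmod z < 1 \<Longrightarrow> cmod (g z) \<le> B" by (rule HinfE[OF has_bdryD(2)[OF g]]) (rule that)
  hence B: "AE t in circ_meas. cmod (b t) \<le> B" by (rule has_bdry_bounded[OF g])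
  have L: "L2T (\<lambda>t. cnj (b t) * f t)"
    by (rule L2T_mult_bounded[OF H2_L2T[OF f], where B=B]) (use B has_bdryD(3)[OF g] in \<open>auto intro: borel_measurable_cnj\<close>)
  let ?p = "projH2 (\<lambda>t. cnj (b t) * f t)"
  have "ip ?p h = ip f (toeplitz b h)" if h: "h \<in> H2" for h
    unfolding projH2_spec(2)[OF L h] t[OF h] by (simp add: ip_def mult_ac)
  hence "?p \<in> H2 \<and> (\<forall>h\<in>H2. ip ?p h = ip f (toeplitz b h))" using projH2_spec(1)[OF L] by blast
  hence "toeplitz_adj b f \<in> H2 \<and> (\<forall>h\<in>H2. ip (toeplitz_adj b f) h = ip f (toeplitz b h))"
    unfolding toeplitz_adj_def by (rule someI[of "\<lambda>p. p \<in> H2 \<and> (\<forall>h\<in>H2. ip p h = ip f (toeplitz b h))" ?p])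
  thus "toeplitz_adj b f \<in> H2" "h \<in> H2 \<Longrightarrow> ip (toeplitz_adj b f) h = ip f (\<lambda>t. b t * h t)"
    using t by auto
qed

lemma norm2_toeplitz_adj_le:
  assumes g: "has_bdry g b" and f: "f \<in> H2" and B: "\<And>z. cmod z < 1 \<Longrightarrow> cmod (g z) \<le> B"
  shows "norm2 (toeplitz_adj b f) \<le> B * norm2 f"
proof -
  let ?p = "toeplitz_adj b f"
  note p = toeplitz_adj_spec(1)[OF g f]
  have "complex_of_real ((norm2 ?p)\<^sup>2) = ip f (\<lambda>t. b t * ?p t)"
    unfolding ip_self[symmetric] by (rule toeplitz_adj_spec(2)[OF g f p])
  hence "(norm2 ?p)\<^sup>2 \<le> norm2 f * norm2 (\<lambda>t. b t * ?p t)"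
    using ip_le_norm2[OF H2_L2T[OF f] H2_L2T[OF H2_mult_bdry[OF g p]]] by (metis norm_of_real abs_power2)
  also have "\<dots> \<le> norm2 f * (B * norm2 ?p)"
    using norm2_mult_le[OF H2_L2T[OF p] has_bdryD(3)[OF g] has_bdry_bounded[OF g B]] by (intro mult_left_mono) auto
  finally have *: "norm2 ?p * norm2 ?p \<le> (B * norm2 f) * norm2 ?p" by (simp add: power2_eq_square mult_ac)
  have "0 \<le> B" using B[of 0] norm_ge_zero[of "g 0"] by (simp del: norm_ge_zero)
  thus ?thesis using * norm2_nonneg[of ?p] norm2_nonneg[of f]
    by (cases "norm2 ?p = 0") (auto simp: mult_le_cancel_right simp del: norm2_nonneg)
qed

section \<open>Decay of adjoint powers on characters\<close>

lemma H2_finite_support: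
  assumes q: "q \<in> H2" and N: "\<And>n. n \<ge> N \<Longrightarrow> fourier_coeff q (int n) = 0"
  shows "AE t in circ_meas. q t = tsum (\<lambda>i. fourier_coeff q (int i)) {..<N} t"
proof -
  let ?c = "\<lambda>i. fourier_coeff q (int i)"
  have *: "tsum ?c {..<M} t = tsum ?c {..<N} t" if "M \<ge> N" for M t
    unfolding tsum_def using that N by (intro sum.mono_neutral_right) auto
  have "\<forall>\<^sub>F M in sequentially. norm2 (\<lambda>t. tsum ?c {..<M} t - q t) = norm2 (\<lambda>t. tsum ?c {..<N} t - q t)"
    unfolding eventually_sequentially
  proof (intro exI[of _ N] allI impI)
    fix M assume "N \<le> M"
    show "norm2 (\<lambda>t. tsum ?c {..<M} t - q t) = norm2 (\<lambda>t. tsum ?c {..<N} t - q t)" by (simp only: *[OF \<open>N \<le> M\<close>])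
  qed
  hence "(\<lambda>M. norm2 (\<lambda>t. tsum ?c {..<M} t - q t)) \<longlonglongrightarrow> norm2 (\<lambda>t. tsum ?c {..<N} t - q t)"
    by (rule tendsto_eventually)
  hence "norm2 (\<lambda>t. tsum ?c {..<N} t - q t) = 0" using H2_partial_sums[OF q] by (rule LIMSEQ_unique)
  hence "AE t in circ_meas. tsum ?c {..<N} t - q t = 0"
    by (subst (asm) norm2_eq_0_iff) (auto intro: L2T_diff H2_L2T[OF q])
  thus ?thesis by eventually_elim simp
qed

lemma norm2_H2_finite_support:
  assumes q: "q \<in> H2" and N: "\<And>n. n \<ge> N \<Longrightarrow> fourier_coeff q (int n) = 0"
  shows "(norm2 q)\<^sup>2 = (\<Sum>i<N. (cmod (fourier_coeff q (int i)))\<^sup>2)"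
proof -
  have "norm2 q = norm2 (tsum (\<lambda>i. fourier_coeff q (int i)) {..<N})"
    by (rule norm2_cong_AE) (use H2_finite_support[OF q N] L2T_measurable[OF H2_L2T[OF q]] in \<open>auto intro: L2T_measurable\<close>)
  thus ?thesis by (simp add: norm2_tsum)
qed

text \<open>\<open>p m\<close> has frequencies in \<open>{0..k}\<close> only, and its coefficient at
  \<open>j\<close> is the conjugate of the Taylor coefficient of \<open>h ^ m\<close> of order
  \<open>k - j\<close>. On the closed disc of radius 1/2 the modulus of \<open>h\<close> has a
  maximum \<open>\<rho> < 1\<close>, so Cauchy's inequality makes these finitely many coefficients
  decay like \<open>\<rho> ^ m\<close>.\<close>

lemma toeplitz_adj_power_tchar:
  assumes h: "has_bdry h hb"
    and p: "\<And>m. p m \<in> H2" "\<And>m k'. k' \<in> H2 \<Longrightarrow> ip (p m) k' = ip (tchar (int k)) (\<lambda>t. hb t ^ m * k' t)"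
    and h1: "\<And>z. cmod z < 1 \<Longrightarrow> cmod (h z) < 1"
  shows "(\<lambda>m. norm2 (p m)) \<longlonglongrightarrow> 0"
proof -
  have hm: "has_bdry (\<lambda>z. h z ^ m) (\<lambda>t. hb t ^ m)" for m
    by (rule has_bdry_entire[OF h]) (intro holomorphic_intros)
  have co: "fourier_coeff (p m) (int j) = cnj (fourier_coeff (\<lambda>t. hb t ^ m) (int k - int j))" for m j
  proof -
    have "tchar (int j) \<in> H2" using tsum_in_H2[of "{j}" "\<lambda>_. 1"] by (simp add: tsum_def[abs_def])
    hence "fourier_coeff (p m) (int j) = cnj (ip (\<lambda>t. hb t ^ m * tchar (int j) t) (tchar (int k)))"
      unfolding fourier_coeff_eq_ip by (subst p(2)) (assumption, rule ip_cnj)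
    thus ?thesis by (simp add: fourier_coeff_mult_tchar flip: fourier_coeff_eq_ip)
  qed
  have Z: "fourier_coeff (p m) (int j) = 0" if "j \<ge> Suc k" for m j
    using that by (simp add: co fourier_coeff_has_bdry[OF hm])
  have eq: "(norm2 (p m))\<^sup>2 = (\<Sum>j<Suc k. (cmod (fourier_coeff (p m) (int j)))\<^sup>2)" for m
    by (rule norm2_H2_finite_support[OF p(1) Z])
  have lim: "(\<lambda>m. fourier_coeff (p m) (int j)) \<longlonglongrightarrow> 0" if j: "j < Suc k" for j
  proof -
    define i where "i = k - j"
    have ki: "int k - int j = int i" using j by (simp add: i_def)
    have hh: "h holomorphic_on cball 0 (1/2)" using has_bdryD(1)[OF h] by (rule holomorphic_on_subset) auto
    have "continuous_on (cball 0 (1/2)) (\<lambda>z. cmod (h z))"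
      using hh by (intro continuous_intros holomorphic_on_imp_continuous_on)
    hence "\<exists>w\<in>cball 0 (1/2). \<forall>z\<in>cball 0 (1/2). cmod (h z) \<le> cmod (h w)"
      by (intro continuous_attains_sup) auto
    then obtain w where w: "w \<in> cball 0 (1/2)" "\<forall>z\<in>cball 0 (1/2). cmod (h z) \<le> cmod (h w)" by blast
    define \<rho> where "\<rho> = cmod (h w)"
    have \<rho>: "0 \<le> \<rho>" "\<rho> < 1" using h1[of w] w(1) by (auto simp: \<rho>_def)
    have "cmod (fourier_coeff (p m) (int j)) \<le> \<rho> ^ m * 2 ^ i" for m
    proof -
      have "cmod ((deriv ^^ i) (\<lambda>z. h z ^ m) 0) \<le> fact i * \<rho> ^ m / (1/2) ^ i"
      proof (rule Cauchy_inequality)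
        show "(\<lambda>z. h z ^ m) holomorphic_on ball 0 (1/2)"
          using hh by (intro holomorphic_intros) (auto intro: holomorphic_on_subset)
        show "continuous_on (cball 0 (1/2)) (\<lambda>z. h z ^ m)"
          using hh by (intro continuous_intros holomorphic_on_imp_continuous_on)
        show "cmod (h x ^ m) \<le> \<rho> ^ m" if "cmod (0 - x) = 1 / 2" for x
          unfolding norm_power \<rho>_def using that by (intro power_mono w(2)[rule_format]) auto
      qed simp
      thus ?thesis by (simp add: co ki fourier_coeff_has_bdry[OF hm] norm_divide power_one_over divide_simps mult_ac)
    qed
    hence "\<forall>\<^sub>F m in sequentially. cmod (fourier_coeff (p m) (int j)) \<le> \<rho> ^ m * 2 ^ i" by simp
    moreover have "(\<lambda>m. \<rho> ^ m * 2 ^ i) \<longlonglongrightarrow> 0" using \<rho> by (intro tendsto_mult_left_zero LIMSEQ_power_zero) auto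
    ultimately show ?thesis by (rule Lim_null_comparison)
  qed
  have "(\<lambda>m. (norm2 (p m))\<^sup>2) \<longlonglongrightarrow> (\<Sum>j<Suc k. (cmod 0)\<^sup>2)"
    unfolding eq by (intro tendsto_intros lim) auto
  hence "(\<lambda>m. sqrt ((norm2 (p m))\<^sup>2)) \<longlonglongrightarrow> sqrt 0" by (intro tendsto_real_sqrt) simp
  thus ?thesis by simp
qed

section \<open>Bessel bounds and density\<close>

text \<open>The least harmonic majorant of the square of a polynomial in the disc is the real part of an
  entire function, which is built up along Horner's scheme.\<close>

lemma polynomial_square_majorant:
  fixes c :: "nat \<Rightarrow> complex"
  shows "\<exists>\<phi>. \<phi> holomorphic_on UNIV \<and>
    (\<forall>w. cmod w \<le> 1 \<longrightarrow> (cmod (\<Sum>m<N. c m * w ^ m))\<^sup>2 \<le> Re (\<phi> w)) \<and>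
    (\<forall>w. cmod w < 1 \<longrightarrow> Re (\<phi> w) + (cmod (\<Sum>m<N. c m * w ^ m))\<^sup>2 \<le> (2 + 4 / (1 - (cmod w)\<^sup>2)) * (\<Sum>m<N. (cmod (c m))\<^sup>2))"
proof (induction N arbitrary: c)
  case 0
  show ?case by (rule exI[of _ "\<lambda>_. 0"]) auto
next
  case (Suc N)
  let ?q = "\<lambda>w. \<Sum>m<N. c (Suc m) * w ^ m"
  let ?S = "\<Sum>m<N. (cmod (c (Suc m)))\<^sup>2"
  obtain \<phi> where \<phi>: "\<phi> holomorphic_on UNIV" "\<And>w. cmod w \<le> 1 \<Longrightarrow> (cmod (?q w))\<^sup>2 \<le> Re (\<phi> w)"
    "\<And>w. cmod w < 1 \<Longrightarrow> Re (\<phi> w) + (cmod (?q w))\<^sup>2 \<le> (2 + 4 / (1 - (cmod w)\<^sup>2)) * ?S"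
    using Suc[of "\<lambda>m. c (Suc m)"] by auto
  have q: "(\<Sum>m<Suc N. c m * w ^ m) = c 0 + w * ?q w" for w
    by (simp add: sum.lessThan_Suc_shift sum_distrib_left mult_ac del: sum.lessThan_Suc)
  have S: "(\<Sum>m<Suc N. (cmod (c m))\<^sup>2) = (cmod (c 0))\<^sup>2 + ?S"
    by (simp add: sum.lessThan_Suc_shift del: sum.lessThan_Suc)
  \<comment> \<open>Expanding \<open>cmod (c 0 + w * q)^2\<close> leaves
    \<open>cmod w^2 * cmod q^2\<close> as the only term that is not harmonic; it is replaced by the
    majorant for \<open>q\<close>, with equality on the circle.\<close>
  define \<phi>' where "\<phi>' w = of_real ((cmod (c 0))\<^sup>2) + 2 * cnj (c 0) * (w * ?q w) + \<phi> w" for w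
  have sq: "(cmod (c 0 + w * ?q w))\<^sup>2 = (cmod (c 0))\<^sup>2 + 2 * Re (cnj (c 0) * (w * ?q w)) + (cmod w)\<^sup>2 * (cmod (?q w))\<^sup>2" for w
  proof -
    have "(cmod (a + b))\<^sup>2 = (cmod a)\<^sup>2 + 2 * Re (cnj a * b) + (cmod b)\<^sup>2" for a b
      unfolding cmod_power2 by (simp add: power2_eq_square algebra_simps)
    thus ?thesis by (simp add: norm_mult power_mult_distrib)
  qed
  have Re': "Re (\<phi>' w) = (cmod (c 0))\<^sup>2 + 2 * Re (cnj (c 0) * (w * ?q w)) + Re (\<phi> w)" for w
    by (simp add: \<phi>'_def mult.assoc)
  show ?case unfolding q S
  proof (intro exI[of _ \<phi>'] conjI allI impI)
    show "\<phi>' holomorphic_on UNIV" unfolding \<phi>'_def using \<phi>(1) by (intro holomorphic_intros)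
    fix w :: complex
    show "(cmod (c 0 + w * ?q w))\<^sup>2 \<le> Re (\<phi>' w)" if w: "cmod w \<le> 1"
    proof -
      have "(cmod w)\<^sup>2 * (cmod (?q w))\<^sup>2 \<le> 1 * (cmod (?q w))\<^sup>2" using w by (intro mult_right_mono power_le_one) auto
      thus ?thesis using \<phi>(2)[OF w] sq[of w] Re'[of w] by linarith
    qed
    show "Re (\<phi>' w) + (cmod (c 0 + w * ?q w))\<^sup>2 \<le> (2 + 4 / (1 - (cmod w)\<^sup>2)) * ((cmod (c 0))\<^sup>2 + ?S)" if w: "cmod w < 1"
    proof -
      define x y r s where "x = cmod (c 0)" and "y = cmod (?q w)" and "r = cmod w" and "s = 1 - (cmod w)\<^sup>2"
      have nn: "0 \<le> x" "0 \<le> y" "0 \<le> r" "r \<le> 1" using w by (auto simp: x_def y_def r_def)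
      have s: "s > 0" unfolding s_def using w power_less_one_iff[of "cmod w" 2] by simp
      have "Re (cnj (c 0) * (w * ?q w)) \<le> cmod (cnj (c 0) * (w * ?q w))" by (rule complex_Re_le_cmod)
      also have "\<dots> = r * (x * y)" by (simp add: norm_mult x_def y_def r_def mult_ac)
      also have "\<dots> \<le> 1 * (x * y)" using nn by (intro mult_right_mono) auto
      finally have a: "Re (cnj (c 0) * (w * ?q w)) \<le> x * y" by simp
      \<comment> \<open>The cross terms \<open>4 * x * y\<close> are absorbed by the gain
        \<open>s * y^2\<close> from the factor \<open>cmod w^2 = 1 - s\<close> in front of
        \<open>y^2\<close>. The price \<open>4 / s * x^2\<close> is the origin of the constant, and
        the gain exists only because the inductive bound carries the extra square of the
        polynomial.\<close>
      have "0 \<le> (s * y - 2 * x)\<^sup>2 / s" using s by simp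
      also have "\<dots> = s * y\<^sup>2 + 4 * x\<^sup>2 / s - 4 * (x * y)" using s by (simp add: power2_eq_square field_simps)
      finally have b: "4 * (x * y) \<le> s * y\<^sup>2 + 4 / s * x\<^sup>2" by simp
      have "Re (\<phi>' w) + (cmod (c 0 + w * ?q w))\<^sup>2 = 2 * x\<^sup>2 + 4 * Re (cnj (c 0) * (w * ?q w)) + Re (\<phi> w) + y\<^sup>2 - s * y\<^sup>2"
        unfolding Re' sq x_def y_def s_def by (simp add: algebra_simps)
      also have "\<dots> \<le> 2 * x\<^sup>2 + 4 / s * x\<^sup>2 + (2 + 4 / s) * ?S" using a b \<phi>(3)[OF w] unfolding y_def s_def by linarith
      also have "\<dots> = (2 + 4 / s) * (x\<^sup>2 + ?S)" by (simp add: distrib_left distrib_right)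
      finally show ?thesis by (simp only: x_def s_def)
    qed
  qed
qed

text \<open>Littlewood's subordination for polynomials: the majorant composed with \<open>h\<close>
  is the real part of a bounded analytic function, so its mean over the circle is its value at the
  origin.\<close>

lemma polynomial_composition_bound:
  assumes h: "has_bdry h hb" and h1: "\<And>z. cmod z < 1 \<Longrightarrow> cmod (h z) \<le> 1" and h0: "cmod (h 0) < 1"
  shows "(LINT t|circ_meas. (cmod (\<Sum>m<N. c m * hb t ^ m))\<^sup>2) \<le> (2 + 4 / (1 - (cmod (h 0))\<^sup>2)) * (\<Sum>m<N. (cmod (c m))\<^sup>2)"
proof -
  obtain \<phi> where \<phi>: "\<phi> holomorphic_on UNIV" "\<And>w. cmod w \<le> 1 \<Longrightarrow> (cmod (\<Sum>m<N. c m * w ^ m))\<^sup>2 \<le> Re (\<phi> w)"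
    "\<And>w. cmod w < 1 \<Longrightarrow> Re (\<phi> w) + (cmod (\<Sum>m<N. c m * w ^ m))\<^sup>2 \<le> (2 + 4 / (1 - (cmod w)\<^sup>2)) * (\<Sum>m<N. (cmod (c m))\<^sup>2)"
    using polynomial_square_majorant[where N=N and c=c] by blast
  have b: "has_bdry (\<lambda>z. \<phi> (h z)) (\<lambda>t. \<phi> (hb t))" by (rule has_bdry_entire[OF h \<phi>(1)])
  have "has_bdry (\<lambda>z. \<Sum>m<N. c m * h z ^ m) (\<lambda>t. \<Sum>m<N. c m * hb t ^ m)"
    by (rule has_bdry_entire[OF h, where \<phi>="\<lambda>w. \<Sum>m<N. c m * w ^ m"]) (intro holomorphic_intros)
  hence "L2T (\<lambda>t. \<Sum>m<N. c m * hb t ^ m)" by (rule L2T_has_bdry)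
  moreover have I: "integrable circ_meas (\<lambda>t. \<phi> (hb t))" by (rule integrable_L2T[OF L2T_has_bdry[OF b]])
  moreover have "AE t in circ_meas. (cmod (\<Sum>m<N. c m * hb t ^ m))\<^sup>2 \<le> Re (\<phi> (hb t))"
  proof -
    have "AE t in circ_meas. cmod (hb t) \<le> 1" by (rule has_bdry_bounded[OF h h1])
    thus ?thesis by eventually_elim (rule \<phi>(2))
  qed
  ultimately have "(LINT t|circ_meas. (cmod (\<Sum>m<N. c m * hb t ^ m))\<^sup>2) \<le> (LINT t|circ_meas. Re (\<phi> (hb t)))"
    by (intro integral_mono_AE) (auto simp: L2T_def)
  also have "\<dots> = Re (\<phi> (h 0))" using integral_Re[OF I] has_bdry_mean[OF b] by simp
  also have "\<dots> \<le> (2 + 4 / (1 - (cmod (h 0))\<^sup>2)) * (\<Sum>m<N. (cmod (c m))\<^sup>2)"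
    using \<phi>(3)[OF h0] zero_le_power2[of "cmod (\<Sum>m<N. c m * h 0 ^ m)"] by linarith
  finally show ?thesis .
qed

text \<open>Conjugating the terms of negative frequency makes them analytic without changing real
  parts on the circle, so a real trigonometric polynomial is the real part of an ordinary
  polynomial.\<close>

lemma indicator_trig_approx:
  assumes A: "A \<in> sets circ_meas"
  obtains Q :: "nat \<Rightarrow> complex poly" where "\<And>n t. \<bar>Re (poly (Q n) (cis (2 * pi * t)))\<bar> \<le> 2"
    "AE t in circ_meas. (\<lambda>n. Re (poly (Q n) (cis (2 * pi * t)))) \<longlonglongrightarrow> indicator A t"
proof -
  obtain p :: "nat \<Rightarrow> complex \<Rightarrow> real" where p: "\<And>n. real_polynomial_function (p n)" "\<And>n z. cmod z = 1 \<Longrightarrow> \<bar>p n z\<bar> \<le> 2"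
      "AE t in circ_meas. (\<lambda>n. p n (cis (2 * pi * t))) \<longlonglongrightarrow> indicator A t"
    by (rule circ_polynomial_approx[of "indicator A"]) (use A in \<open>auto simp: indicator_def\<close>)
  have "\<exists>Q. \<forall>t. Re (poly Q (cis (2 * pi * t))) = p n (cis (2 * pi * t))" for n
  proof -
    obtain N q where Nq: "\<And>t. complex_of_real (p n (cis (2 * pi * t))) = (\<Sum>k\<le>degree q. coeff q k * tchar (int k - int N) t)"
      by (rule real_polynomial_tchar[OF p(1)]) (rule that)
    define Q where "Q = (\<Sum>k\<le>degree q. if k \<ge> N then monom (coeff q k) (k - N) else monom (cnj (coeff q k)) (N - k))"
    have "Re (poly Q (cis (2 * pi * t))) = p n (cis (2 * pi * t))" for t
    proof -
      have "Re (poly (if k \<ge> N then monom (coeff q k) (k - N) else monom (cnj (coeff q k)) (N - k)) (cis (2 * pi * t)))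
          = Re (coeff q k * tchar (int k - int N) t)" for k
      proof (cases "k \<ge> N")
        case True
        hence "int k - int N = int (k - N)" by simp
        hence "tchar (int k - int N) t = cis (2 * pi * t) ^ (k - N)" by (simp only: tchar_of_nat)
        thus ?thesis using True by (simp add: poly_monom)
      next
        case False
        hence "- (int k - int N) = int (N - k)" by simp
        hence "cnj (coeff q k * tchar (int k - int N) t) = cnj (coeff q k) * cis (2 * pi * t) ^ (N - k)"
          by (simp only: complex_cnj_mult cnj_tchar tchar_of_nat)
        hence "Re (coeff q k * tchar (int k - int N) t) = Re (cnj (coeff q k) * cis (2 * pi * t) ^ (N - k))"
          by (metis cnj.sel(1))
        thus ?thesis using False by (simp only: poly_monom if_False)
      qed
      hence "Re (poly Q (cis (2 * pi * t))) = (\<Sum>k\<le>degree q. Re (coeff q k * tchar (int k - int N) t))"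
        unfolding Q_def poly_sum Re_sum by (intro sum.cong) auto
      also have "\<dots> = Re (complex_of_real (p n (cis (2 * pi * t))))" unfolding Nq by simp
      finally show ?thesis by simp
    qed
    thus ?thesis by blast
  qed
  then obtain Q where Q: "\<And>n t. Re (poly (Q n) (cis (2 * pi * t))) = p n (cis (2 * pi * t))" by metis
  show ?thesis by (rule that[of Q]) (use p Q in auto)
qed

text \<open>Outer functions that are tiny off \<open>A\<close>: the exponential of a polynomial whose real part is
  close to a large multiple of \<open>1\<^sub>A - \<bar>A\<bar>\<close>.\<close>

lemma entire_small_off_set:
  assumes A: "A \<in> sets circ_meas" and pos: "measure circ_meas A > 0" and e: "e > 0"
  obtains E where "E holomorphic_on UNIV" "E 0 = 1"
    "norm2 (\<lambda>t. indicator ({0..1} - A) t * E (cis (2 * pi * t))) < e"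
proof -
  define a where "a = measure circ_meas A"
  obtain Q :: "nat \<Rightarrow> complex poly" where Q: "\<And>n t. \<bar>Re (poly (Q n) (cis (2 * pi * t)))\<bar> \<le> 2"
    "AE t in circ_meas. (\<lambda>n. Re (poly (Q n) (cis (2 * pi * t)))) \<longlonglongrightarrow> indicator A t"
    by (rule indicator_trig_approx[OF A]) (rule that)
  have Qb: "has_bdry (\<lambda>z. poly (Q n) z) (\<lambda>t. poly (Q n) (cis (2 * pi * t)))" for n
    by (rule has_bdry_entire[OF has_bdry_ident]) (intro holomorphic_intros)
  have Qm: "(\<lambda>t. Re (poly (Q n) (cis (2 * pi * t)))) \<in> borel_measurable circ_meas" for n
    using has_bdryD(3)[OF Qb] by measurable
  have "(\<lambda>n. LINT t|circ_meas. Re (poly (Q n) (cis (2 * pi * t)))) \<longlonglongrightarrow> (LINT t|circ_meas. indicator A t)"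
    by (rule integral_dominated_convergence[where w="\<lambda>_. 2"]) (use A Q Qm in auto)
  moreover have "(LINT t|circ_meas. Re (poly (Q n) (cis (2 * pi * t)))) = Re (poly (Q n) 0)" for n
    using integral_Re[OF integrable_L2T[OF L2T_has_bdry[OF Qb[of n]]]] has_bdry_mean[OF Qb[of n]] by simp
  moreover have "(LINT t|circ_meas. indicator A t) = a" using A sets.sets_into_space[OF A] by (simp add: a_def Int_absorb2)
  ultimately have m: "(\<lambda>n. Re (poly (Q n) 0)) \<longlonglongrightarrow> a" by simp
  \<comment> \<open>\<open>exp (- (2 * real K * a))\<close> is the limiting squared modulus off
    \<open>A\<close>: there the indicator is 0, while its mean \<open>a\<close> is subtracted.
    Positivity of \<open>a\<close> lets a large \<open>K\<close> succeed, and \<open>K\<close> is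
    fixed before the approximation index.\<close>
  obtain K :: nat where K: "exp (- (2 * real K * a)) < e\<^sup>2"
  proof -
    have "exp (- (2 * a)) < 1" using pos by (simp add: a_def)
    moreover have "e\<^sup>2 > 0" using e by simp
    ultimately obtain K where "exp (- (2 * a)) ^ K < e\<^sup>2" using real_arch_pow_inv by blast
    moreover have "exp (- (2 * a)) ^ K = exp (- (2 * real K * a))" by (simp add: exp_of_nat_mult[symmetric] mult_ac)
    ultimately show ?thesis using that by metis
  qed
  define E where "E n z = exp (of_nat K * (poly (Q n) z - poly (Q n) 0))" for n z
  define w where "w n t = indicator ({0..1} - A) t * exp (2 * real K * (Re (poly (Q n) (cis (2 * pi * t))) - Re (poly (Q n) 0)))" for n t
  have Re0: "\<bar>Re (poly (Q n) 0)\<bar> \<le> 2" for n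
  proof -
    have "\<bar>LINT t|circ_meas. Re (poly (Q n) (cis (2 * pi * t)))\<bar> \<le> (LINT t|circ_meas. \<bar>Re (poly (Q n) (cis (2 * pi * t)))\<bar>)"
      by (rule integral_abs_bound)
    also have "\<dots> \<le> (LINT t|circ_meas. 2)"
      by (rule integral_mono) (use Q(1)[of n] integrable_Re[OF integrable_L2T[OF L2T_has_bdry[OF Qb[of n]]]] in auto)
    finally show ?thesis using integral_Re[OF integrable_L2T[OF L2T_has_bdry[OF Qb[of n]]]] has_bdry_mean[OF Qb[of n]] by simp
  qed
  have Ac: "{0..1} - A \<in> sets circ_meas" using sets.compl_sets[OF A] by simp
  have "(\<lambda>n. LINT t|circ_meas. w n t) \<longlonglongrightarrow> (LINT t|circ_meas. indicator ({0..1} - A) t * exp (2 * real K * (0 - a)))"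
  proof (rule integral_dominated_convergence[where w="\<lambda>_. exp (2 * real K * 4)"])
    show "AE t in circ_meas. (\<lambda>n. w n t) \<longlonglongrightarrow> indicator ({0..1} - A) t * exp (2 * real K * (0 - a))"
      using Q(2)
    proof eventually_elim
      case (elim t)
      show ?case
      proof (cases "t \<in> A")
        case False
        hence "(\<lambda>n. Re (poly (Q n) (cis (2 * pi * t)))) \<longlonglongrightarrow> 0" using elim by simp
        thus ?thesis unfolding w_def by (intro tendsto_intros m)
      qed (simp add: w_def)
    qed
    show "AE t in circ_meas. norm (w n t) \<le> exp (2 * real K * 4)" for n
    proof (intro always_eventually allI)
      fix t
      have "Re (poly (Q n) (cis (2 * pi * t))) - Re (poly (Q n) 0) \<le> 4" using Q(1)[of n t] Re0[of n] by linarith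
      hence "2 * real K * (Re (poly (Q n) (cis (2 * pi * t))) - Re (poly (Q n) 0)) \<le> 2 * real K * 4"
        by (intro mult_left_mono) auto
      thus "norm (w n t) \<le> exp (2 * real K * 4)" by (auto simp: w_def indicator_def)
    qed
    show "w n \<in> borel_measurable circ_meas" for n unfolding w_def using Qm[of n] Ac by measurable
  qed (use Ac in auto)
  moreover have "(LINT t|circ_meas. indicator ({0..1} - A) t * exp (2 * real K * (0 - a))) < e\<^sup>2"
  proof -
    have "(LINT t|circ_meas. indicator ({0..1} - A) t * exp (2 * real K * (0 - a))) = measure circ_meas ({0..1} - A) * exp (- (2 * real K * a))"
      using Ac sets.sets_into_space[OF Ac] by (simp add: Int_absorb2)
    also have "\<dots> \<le> 1 * exp (- (2 * real K * a))"
      using circ.bounded_measure[of "{0..1} - A"] by (intro mult_right_mono) auto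
    also have "\<dots> < e\<^sup>2" using K by simp
    finally show ?thesis .
  qed
  ultimately have "\<forall>\<^sub>F n in sequentially. (LINT t|circ_meas. w n t) < e\<^sup>2" by (rule order_tendstoD)
  then obtain n where n: "(LINT t|circ_meas. w n t) < e\<^sup>2" by (auto simp: eventually_sequentially)
  show ?thesis
  proof (rule that[of "E n"])
    show "E n holomorphic_on UNIV" unfolding E_def by (intro holomorphic_intros)
    show "E n 0 = 1" by (simp add: E_def)
    have "(cmod (indicator ({0..1} - A) t * E n (cis (2 * pi * t))))\<^sup>2 = w n t" for t
    proof -
      have "(cmod (E n (cis (2 * pi * t))))\<^sup>2 = exp (2 * real K * (Re (poly (Q n) (cis (2 * pi * t))) - Re (poly (Q n) 0)))"
        by (simp add: E_def norm_exp_eq_Re exp_double[symmetric] mult.assoc)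
      thus ?thesis by (simp add: w_def indicator_def)
    qed
    hence "(norm2 (\<lambda>t. indicator ({0..1} - A) t * E n (cis (2 * pi * t))))\<^sup>2 = (LINT t|circ_meas. w n t)"
      by (simp add: norm2_power2)
    thus "norm2 (\<lambda>t. indicator ({0..1} - A) t * E n (cis (2 * pi * t))) < e"
      using n e by (intro power_less_imp_less_base[of _ 2 e]) auto
  qed
qed

section \<open>Density of projections of bounded functions carried by \<open>A\<close>\<close>

lemma projH2_linear:
  assumes u: "L2T u" and v: "L2T v"
  shows "AE t in circ_meas. projH2 (\<lambda>t. a * u t + v t) t = a * projH2 u t + projH2 v t"
proof (rule H2_eq_AE)
  have L: "L2T (\<lambda>t. a * u t + v t)" by (intro L2T_add L2T_scale u v)
  show "projH2 (\<lambda>t. a * u t + v t) \<in> H2" by (rule projH2_spec(1)[OF L])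
  show "(\<lambda>t. a * projH2 u t + projH2 v t) \<in> H2" by (intro H2_add H2_scale projH2_spec(1) u v)
  fix k assume k: "k \<in> H2"
  have "ip (projH2 (\<lambda>t. a * u t + v t)) k = ip (\<lambda>t. a * u t + v t) k" by (rule projH2_spec(2)[OF L k])
  also have "\<dots> = a * ip u k + ip v k"
    using H2_L2T[OF k] u v by (subst ip_add_left) (auto intro: L2T_scale simp: ip_scale_left)
  also have "\<dots> = ip (\<lambda>t. a * projH2 u t + projH2 v t) k"
    using H2_L2T[OF k] H2_L2T[OF projH2_spec(1)[OF u]] H2_L2T[OF projH2_spec(1)[OF v]] projH2_spec(2)[OF u k] projH2_spec(2)[OF v k]
    by (subst ip_add_left) (auto intro: L2T_scale simp: ip_scale_left)
  finally show "ip (projH2 (\<lambda>t. a * u t + v t)) k = ip (\<lambda>t. a * projH2 u t + projH2 v t) k" .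
qed

lemma norm2_projH2_linear_le:
  assumes u: "L2T u" and v: "L2T v" and x: "L2T x" and y: "L2T y"
  shows "norm2 (\<lambda>t. projH2 (\<lambda>t. a * u t + v t) t - (a * x t + y t))
    \<le> cmod a * norm2 (\<lambda>t. projH2 u t - x t) + norm2 (\<lambda>t. projH2 v t - y t)"
proof -
  have P: "L2T (projH2 w)" if "L2T w" for w by (rule H2_L2T[OF projH2_spec(1)[OF that]])
  have "norm2 (\<lambda>t. projH2 (\<lambda>t. a * u t + v t) t - (a * x t + y t))
     = norm2 (\<lambda>t. a * (projH2 u t - x t) + (projH2 v t - y t))"
  proof (rule norm2_cong_AE)
    show "AE t in circ_meas. projH2 (\<lambda>t. a * u t + v t) t - (a * x t + y t) = a * (projH2 u t - x t) + (projH2 v t - y t)"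
      using projH2_linear[OF u v, of a] by eventually_elim (simp add: algebra_simps)
  qed (intro L2T_measurable L2T_add L2T_diff L2T_scale P u v x y)+
  also have "\<dots> \<le> norm2 (\<lambda>t. a * (projH2 u t - x t)) + norm2 (\<lambda>t. projH2 v t - y t)"
    by (intro norm2_triangle L2T_diff L2T_scale P u v x y)
  finally show ?thesis by (simp only: norm2_scale)
qed

text \<open>The approximants come from bounded \<open>\<psi>\<close>, since the bound enters the
  Bessel constant.\<close>

definition approx_from :: "real set \<Rightarrow> (real \<Rightarrow> complex) \<Rightarrow> bool" where
  "approx_from A u \<longleftrightarrow> (\<forall>e>0. \<exists>\<psi> B. \<psi> \<in> borel_measurable circ_meas \<and> (\<forall>t. cmod (\<psi> t) \<le> B) \<and>
      norm2 (\<lambda>t. projH2 (\<lambda>t. indicator A t * \<psi> t) t - u t) < e)"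

lemma L2T_indicator_mult:
  assumes "A \<in> sets circ_meas" "\<psi> \<in> borel_measurable circ_meas" "\<And>t. cmod (\<psi> t) \<le> B"
  shows "L2T (\<lambda>t. indicator A t * \<psi> t)"
proof (rule L2T_mult_bounded[where B=1])
  show "L2T \<psi>" by (rule L2T_bounded[where B=B]) (use assms in auto)
  show "(indicator A :: real \<Rightarrow> complex) \<in> borel_measurable circ_meas" using assms(1) by (rule borel_measurable_indicator)
qed (simp add: indicator_def)

lemma approx_from_linear:
  assumes A: "A \<in> sets circ_meas" and x: "approx_from A x" "L2T x" and y: "approx_from A y" "L2T y"
  shows "approx_from A (\<lambda>t. a * x t + y t)"
  unfolding approx_from_def
proof (intro allI impI)
  fix e :: real assume e: "e > 0"
  have a: "cmod a + 1 > 0" by (simp add: add_nonneg_pos)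
  obtain \<psi> B where \<psi>: "\<psi> \<in> borel_measurable circ_meas" "\<And>t. cmod (\<psi> t) \<le> B"
    "norm2 (\<lambda>t. projH2 (\<lambda>t. indicator A t * \<psi> t) t - x t) < e / (2 * (cmod a + 1))"
  proof -
    have "e / (2 * (cmod a + 1)) > 0" using e a by simp
    thus ?thesis using x(1) that unfolding approx_from_def by blast
  qed
  obtain \<theta> D where \<theta>: "\<theta> \<in> borel_measurable circ_meas" "\<And>t. cmod (\<theta> t) \<le> D"
    "norm2 (\<lambda>t. projH2 (\<lambda>t. indicator A t * \<theta> t) t - y t) < e / 2"
  proof -
    have "e / 2 > 0" using e by simp
    thus ?thesis using y(1) that unfolding approx_from_def by blast
  qed
  have eq: "indicator A t * (a * \<psi> t + \<theta> t) = a * (indicator A t * \<psi> t) + indicator A t * \<theta> t" for t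
    by (simp add: algebra_simps)
  have "norm2 (\<lambda>t. projH2 (\<lambda>t. indicator A t * (a * \<psi> t + \<theta> t)) t - (a * x t + y t))
      \<le> cmod a * norm2 (\<lambda>t. projH2 (\<lambda>t. indicator A t * \<psi> t) t - x t) + norm2 (\<lambda>t. projH2 (\<lambda>t. indicator A t * \<theta> t) t - y t)"
    unfolding eq by (rule norm2_projH2_linear_le[OF L2T_indicator_mult[OF A \<psi>(1,2)] L2T_indicator_mult[OF A \<theta>(1,2)] x(2) y(2)])
  also have "\<dots> < e"
  proof -
    have "cmod a * norm2 (\<lambda>t. projH2 (\<lambda>t. indicator A t * \<psi> t) t - x t) \<le> (cmod a + 1) * norm2 (\<lambda>t. projH2 (\<lambda>t. indicator A t * \<psi> t) t - x t)"
      by (intro mult_right_mono) auto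
    also have "\<dots> < e / 2" using \<psi>(3) a by (simp add: field_simps)
    finally show ?thesis using \<theta>(3) by linarith
  qed
  finally have "norm2 (\<lambda>t. projH2 (\<lambda>t. indicator A t * (a * \<psi> t + \<theta> t)) t - (a * x t + y t)) < e" .
  moreover have "cmod (a * \<psi> t + \<theta> t) \<le> cmod a * B + D" for t
    using norm_triangle_ineq[of "a * \<psi> t" "\<theta> t"] mult_left_mono[OF \<psi>(2)[of t], of "cmod a"] \<theta>(2)[of t] by (simp add: norm_mult)
  moreover have "(\<lambda>t. a * \<psi> t + \<theta> t) \<in> borel_measurable circ_meas" using \<psi>(1) \<theta>(1) by measurable
  ultimately show "\<exists>\<psi> B. \<psi> \<in> borel_measurable circ_meas \<and> (\<forall>t. cmod (\<psi> t) \<le> B) \<and>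
      norm2 (\<lambda>t. projH2 (\<lambda>t. indicator A t * \<psi> t) t - (a * x t + y t)) < e" by blast
qed

lemma approx_from_zero: "approx_from A (\<lambda>t. 0)"
  unfolding approx_from_def
proof (intro allI impI)
  fix e :: real assume "e > 0"
  moreover have "norm2 (\<lambda>t. projH2 (\<lambda>t. indicator A t * 0) t - 0) \<le> 0"
    using norm2_projH2_le[OF L2T_const[of 0]] by (simp add: norm2_def)
  ultimately show "\<exists>\<psi> B. \<psi> \<in> borel_measurable circ_meas \<and> (\<forall>t. cmod (\<psi> t) \<le> B) \<and>
      norm2 (\<lambda>t. projH2 (\<lambda>t. indicator A t * \<psi> t) t - 0) < e"
    by (intro exI[of _ "\<lambda>_. 0"] exI[of _ 0]) auto
qed

lemma approx_from_tsum:
  assumes A: "A \<in> sets circ_meas" and "finite I" "\<And>i. i \<in> I \<Longrightarrow> approx_from A (tchar (int i))"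
  shows "approx_from A (tsum c I)"
  using assms(2,3)
proof (induction I)
  case empty
  show ?case using approx_from_zero by (simp add: tsum_def[abs_def])
next
  case (insert i I)
  have "approx_from A (\<lambda>t. c i * tchar (int i) t + tsum c I t)" by (intro approx_from_linear A) (use insert in auto)
  thus ?case using insert.hyps by (simp add: tsum_def[abs_def])
qed

text \<open>For \<open>E\<close> with \<open>E 0 = 1\<close> the projection of \<open>cnj E\<close>
  times the character is a polynomial of degree \<open>m\<close> with leading coefficient 1.
  Restricting to \<open>A\<close> before projecting changes it by at most the norm of
  \<open>E\<close> off \<open>A\<close>, and the lower-order terms are removed by the induction
  hypothesis.\<close>

lemma approx_from_tchar:
  assumes A: "A \<in> sets circ_meas" and pos: "measure circ_meas A > 0"
  shows "approx_from A (tchar (int m))"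
proof (induction m rule: less_induct)
  case (less m)
  show ?case
    unfolding approx_from_def
  proof (intro allI impI)
    fix e :: real assume e: "e > 0"
    hence e2: "e / 2 > 0" by simp
    obtain E where E: "E holomorphic_on UNIV" "E 0 = 1"
      "norm2 (\<lambda>t. indicator ({0..1} - A) t * E (cis (2 * pi * t))) < e / 2"
      by (rule entire_small_off_set[OF A pos e2]) (rule that)
    define eb where "eb t = E (cis (2 * pi * t))" for t
    have eb: "has_bdry E eb" unfolding eb_def using has_bdry_entire[OF has_bdry_ident E(1)] .
    have ebm: "eb \<in> borel_measurable circ_meas" by (rule has_bdryD(3)[OF eb])
    have "continuous_on (cball 0 1) E" using E(1) holomorphic_on_imp_continuous_on continuous_on_subset by blast
    hence "bounded (E ` cball 0 1)" by (intro compact_imp_bounded compact_continuous_image compact_cball)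
    then obtain M where "\<forall>z\<in>cball 0 1. cmod (E z) \<le> M" unfolding bounded_iff by auto
    hence M: "cmod (eb t) \<le> M" for t by (simp add: eb_def)
    define \<psi> where "\<psi> t = cnj (eb t) * tchar (int m) t" for t
    have \<psi>m: "\<psi> \<in> borel_measurable circ_meas" unfolding \<psi>_def using ebm by measurable
    have \<psi>b: "cmod (\<psi> t) \<le> M" for t using M[of t] by (simp add: \<psi>_def norm_mult)
    have L\<psi>: "L2T \<psi>" by (rule L2T_bounded[where B=M]) (use \<psi>m \<psi>b in auto)
    define q where "q = projH2 \<psi>"
    have q: "q \<in> H2" unfolding q_def by (rule projH2_spec(1)[OF L\<psi>])
    have qc: "fourier_coeff q (int n) = cnj (fourier_coeff eb (int m - int n))" for n
    proof -
      have "tchar (int n) \<in> H2" using tsum_in_H2[of "{n}" "\<lambda>_. 1"] by (simp add: tsum_def[abs_def])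
      hence "fourier_coeff q (int n) = fourier_coeff \<psi> (int n)"
        unfolding q_def fourier_coeff_eq_ip by (rule projH2_spec(2)[OF L\<psi>])
      thus ?thesis unfolding \<psi>_def fourier_coeff_mult_tchar fourier_coeff_cnj by simp
    qed
    have q0: "fourier_coeff q (int n) = 0" if "n \<ge> Suc m" for n
      using that by (simp add: qc fourier_coeff_has_bdry[OF eb])
    have q1: "fourier_coeff q (int m) = 1" using E(2) by (simp add: qc fourier_coeff_has_bdry[OF eb])
    define d where "d i = fourier_coeff q (int i)" for i
    have qeq: "AE t in circ_meas. q t = tsum d {..<Suc m} t"
      using H2_finite_support[OF q q0] by (simp add: d_def[abs_def])
    have "approx_from A (tsum (\<lambda>i. - d i) {..<m})" by (rule approx_from_tsum[OF A]) (use less in auto)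
    then obtain \<theta> D where \<theta>: "\<theta> \<in> borel_measurable circ_meas" "\<And>t. cmod (\<theta> t) \<le> D"
      "norm2 (\<lambda>t. projH2 (\<lambda>t. indicator A t * \<theta> t) t - tsum (\<lambda>i. - d i) {..<m} t) < e / 2"
      using e2 unfolding approx_from_def by blast
    have LA\<psi>: "L2T (\<lambda>t. indicator A t * \<psi> t)" by (rule L2T_indicator_mult[OF A \<psi>m \<psi>b])
    have LA\<theta>: "L2T (\<lambda>t. indicator A t * \<theta> t)" by (rule L2T_indicator_mult[OF A \<theta>(1,2)])
    have n1: "norm2 (\<lambda>t. projH2 (\<lambda>t. indicator A t * \<psi> t) t - q t) < e / 2"
    proof -
      \<comment> \<open>\<open>u\<close> vanishes on \<open>A\<close> and equals
        \<open>-\<psi>\<close> off it, so the contractive projection reduces the error to the size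
        of \<open>E\<close> off \<open>A\<close>.\<close>
      define u where "u t = (-1) * \<psi> t + indicator A t * \<psi> t" for t
      have Lu: "L2T u" unfolding u_def by (intro L2T_add L2T_scale L\<psi> LA\<psi>)
      have "norm2 (\<lambda>t. projH2 (\<lambda>t. indicator A t * \<psi> t) t - q t) = norm2 (projH2 u)"
      proof (rule norm2_cong_AE)
        show "AE t in circ_meas. projH2 (\<lambda>t. indicator A t * \<psi> t) t - q t = projH2 u t"
          using projH2_linear[OF L\<psi> LA\<psi>, of "-1"] unfolding u_def[abs_def] q_def by eventually_elim simp
      qed (intro L2T_measurable L2T_diff H2_L2T[OF q] H2_L2T[OF projH2_spec(1)] LA\<psi> Lu)+
      also have "\<dots> \<le> norm2 u" by (rule norm2_projH2_le[OF Lu])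
      also have "\<dots> = norm2 (\<lambda>t. indicator ({0..1} - A) t * E (cis (2 * pi * t)))"
        unfolding norm2_def
      proof (rule arg_cong[where f=sqrt], rule Bochner_Integration.integral_cong)
        fix t assume "t \<in> space circ_meas"
        thus "(cmod (u t))\<^sup>2 = (cmod (indicator ({0..1} - A) t * E (cis (2 * pi * t))))\<^sup>2"
          by (auto simp: u_def \<psi>_def eb_def indicator_def norm_mult)
      qed simp
      finally show ?thesis using E(3) by linarith
    qed
    have eq: "indicator A t * (1 * \<psi> t + \<theta> t) = 1 * (indicator A t * \<psi> t) + indicator A t * \<theta> t" for t
      by (simp add: algebra_simps)
    have "norm2 (\<lambda>t. projH2 (\<lambda>t. indicator A t * (1 * \<psi> t + \<theta> t)) t - tchar (int m) t)
        = norm2 (\<lambda>t. projH2 (\<lambda>t. indicator A t * (1 * \<psi> t + \<theta> t)) t - (1 * q t + tsum (\<lambda>i. - d i) {..<m} t))"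
    proof (rule norm2_cong_AE)
      show "AE t in circ_meas. projH2 (\<lambda>t. indicator A t * (1 * \<psi> t + \<theta> t)) t - tchar (int m) t
          = projH2 (\<lambda>t. indicator A t * (1 * \<psi> t + \<theta> t)) t - (1 * q t + tsum (\<lambda>i. - d i) {..<m} t)"
        using qeq by eventually_elim (simp add: tsum_def sum_negf d_def q1)
    qed (unfold eq, (intro L2T_measurable L2T_diff L2T_add L2T_scale L2T_tchar L2T_tsum H2_L2T[OF q] H2_L2T[OF projH2_spec(1)] LA\<psi> LA\<theta>)+)
    also have "\<dots> \<le> cmod 1 * norm2 (\<lambda>t. projH2 (\<lambda>t. indicator A t * \<psi> t) t - q t)
        + norm2 (\<lambda>t. projH2 (\<lambda>t. indicator A t * \<theta> t) t - tsum (\<lambda>i. - d i) {..<m} t)"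
      unfolding eq by (rule norm2_projH2_linear_le[OF LA\<psi> LA\<theta> H2_L2T[OF q] L2T_tsum])
    also have "\<dots> < e" using n1 \<theta>(3) by simp
    finally have "norm2 (\<lambda>t. projH2 (\<lambda>t. indicator A t * (1 * \<psi> t + \<theta> t)) t - tchar (int m) t) < e" .
    moreover have "cmod (1 * \<psi> t + \<theta> t) \<le> M + D" for t
      using norm_triangle_ineq[of "\<psi> t" "\<theta> t"] \<psi>b[of t] \<theta>(2)[of t] by simp
    moreover have "(\<lambda>t. 1 * \<psi> t + \<theta> t) \<in> borel_measurable circ_meas" using \<psi>m \<theta>(1) by measurable
    ultimately show "\<exists>\<psi> B. \<psi> \<in> borel_measurable circ_meas \<and> (\<forall>t. cmod (\<psi> t) \<le> B) \<and>
      norm2 (\<lambda>t. projH2 (\<lambda>t. indicator A t * \<psi> t) t - tchar (int m) t) < e" by blast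
  qed
qed

lemma complex_rat_dense: "e > 0 \<Longrightarrow> \<exists>p q. cmod (Complex (of_rat p) (of_rat q) - z) < e"
proof -
  assume e: "e > 0"
  have *: "\<exists>p. \<bar>of_rat p - x\<bar> < e / 2" for x :: real
  proof -
    obtain p where "x - e / 2 < of_rat p" "of_rat p < x + e / 2" using of_rat_dense[of "x - e / 2" "x + e / 2"] e by auto
    thus ?thesis by (intro exI[of _ p]) linarith
  qed
  obtain p q where "\<bar>of_rat p - Re z\<bar> < e / 2" "\<bar>of_rat q - Im z\<bar> < e / 2" using * by blast
  thus ?thesis using cmod_le[of "Complex (of_rat p) (of_rat q) - z"] by (intro exI[of _ p] exI[of _ q]) simp
qed

text \<open>Coefficient lists over the complex rationals, paired with an accuracy
  \<open>1 / real (Suc n)\<close>, form a countable type; its numbering turns density into the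
  sequence that the criterion asks for.\<close>

lemma countable_dense_from:
  assumes A: "A \<in> sets circ_meas" and pos: "measure circ_meas A > 0"
  obtains \<psi> :: "nat \<Rightarrow> real \<Rightarrow> complex" and B :: "nat \<Rightarrow> real"
  where "\<And>i. \<psi> i \<in> borel_measurable circ_meas" "\<And>i t. cmod (\<psi> i t) \<le> B i"
    "\<And>f e. f \<in> H2 \<Longrightarrow> e > 0 \<Longrightarrow> \<exists>i. norm2 (\<lambda>t. projH2 (\<lambda>t. indicator A t * \<psi> i t) t - f t) < e"
proof -
  define \<gamma> :: "(rat \<times> rat) list \<Rightarrow> nat \<Rightarrow> complex" where
    "\<gamma> l k = Complex (of_rat (fst (l ! k))) (of_rat (snd (l ! k)))" for l k
  define s where "s l = tsum (\<gamma> l) {..<length l}" for l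
  have "\<exists>\<psi> B. \<psi> \<in> borel_measurable circ_meas \<and> (\<forall>t. cmod (\<psi> t) \<le> B) \<and>
      norm2 (\<lambda>t. projH2 (\<lambda>t. indicator A t * \<psi> t) t - s l t) < 1 / real (Suc n)" for l n
  proof -
    have "approx_from A (s l)" unfolding s_def by (intro approx_from_tsum[OF A] approx_from_tchar[OF A pos]) auto
    thus ?thesis unfolding approx_from_def by simp
  qed
  then obtain \<psi> B where \<psi>: "\<And>l n. \<psi> l n \<in> borel_measurable circ_meas" "\<And>l n t. cmod (\<psi> l n t) \<le> B l n"
    "\<And>l n. norm2 (\<lambda>t. projH2 (\<lambda>t. indicator A t * \<psi> l n t) t - s l t) < 1 / real (Suc n)"
    by metis
  define d :: "nat \<Rightarrow> (rat \<times> rat) list \<times> nat" where "d = from_nat"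
  show ?thesis
  proof (rule that[of "\<lambda>i. \<psi> (fst (d i)) (snd (d i))" "\<lambda>i. B (fst (d i)) (snd (d i))"])
    fix f and e :: real assume f: "f \<in> H2" and e: "e > 0"
    define c where "c k = fourier_coeff f (int k)" for k
    have "\<forall>\<^sub>F N in sequentially. norm2 (\<lambda>t. tsum c {..<N} t - f t) < e / 3"
      using H2_partial_sums[OF f] e unfolding c_def[abs_def] by (intro order_tendstoD(2)) auto
    then obtain N where N: "norm2 (\<lambda>t. tsum c {..<N} t - f t) < e / 3" by (auto simp: eventually_sequentially)
    \<comment> \<open>With \<open>N\<close> coefficients off by less than \<open>\<delta>\<close>,
      the squared error is at most \<open>N * \<delta>^2\<close>, and \<open>N < (N + 1)^2\<close>
      compares it with \<open>(e / 3)^2\<close>, also for \<open>N = 0\<close>.\<close>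
    define \<delta> where "\<delta> = e / (3 * (real N + 1))"
    have \<delta>: "\<delta> > 0" using e by (simp add: \<delta>_def)
    have "\<exists>r. cmod (Complex (of_rat (fst r)) (of_rat (snd r)) - c k) < \<delta>" for k
      using complex_rat_dense[OF \<delta>, of "c k"] by (metis fst_conv snd_conv)
    then obtain r where r: "\<And>k. cmod (Complex (of_rat (fst (r k))) (of_rat (snd (r k))) - c k) < \<delta>" by metis
    define l where "l = map r [0..<N]"
    have l: "length l = N" "k < N \<Longrightarrow> \<gamma> l k = Complex (of_rat (fst (r k))) (of_rat (snd (r k)))" for k
      by (auto simp: l_def \<gamma>_def)
    have "norm2 (\<lambda>t. s l t - tsum c {..<N} t) < e / 3"
    proof -
      have "s l t - tsum c {..<N} t = tsum (\<lambda>k. \<gamma> l k - c k) {..<N} t" for t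
        by (simp add: s_def l(1) tsum_def sum_subtractf left_diff_distrib)
      hence "(norm2 (\<lambda>t. s l t - tsum c {..<N} t))\<^sup>2 = (\<Sum>k<N. (cmod (\<gamma> l k - c k))\<^sup>2)" by (simp add: norm2_tsum)
      also have "\<dots> \<le> (\<Sum>k<N. \<delta>\<^sup>2)" using r l(2) by (intro sum_mono power_mono) (auto intro: less_imp_le)
      also have "\<dots> = real N * \<delta>\<^sup>2" by simp
      also have "\<dots> < (real N + 1)\<^sup>2 * \<delta>\<^sup>2"
      proof (rule mult_strict_right_mono)
        have "0 < 1 + (real N + real N * real N)" by (intro add_pos_nonneg) auto
        thus "real N < (real N + 1)\<^sup>2" by (simp add: power2_eq_square algebra_simps)
      qed (use \<delta> in simp)
      also have "\<dots> = (e / 3)\<^sup>2"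
      proof -
        have "x * (e / (3 * x)) = e / 3" if "x > 0" for x using that by (simp add: field_simps)
        hence "(real N + 1) * \<delta> = e / 3" unfolding \<delta>_def using add_nonneg_pos[OF of_nat_0_le_iff zero_less_one] by blast
        thus ?thesis by (simp only: power_mult_distrib[symmetric])
      qed
      finally show ?thesis using e by (intro power_less_imp_less_base[of _ 2 "e / 3"]) auto
    qed
    obtain n where n: "1 / real (Suc n) < e / 3" using reals_Archimedean[of "e / 3"] e by (auto simp: inverse_eq_divide)
    have "norm2 (\<lambda>t. projH2 (\<lambda>t. indicator A t * \<psi> l n t) t - f t)
        \<le> norm2 (\<lambda>t. projH2 (\<lambda>t. indicator A t * \<psi> l n t) t - s l t) + norm2 (\<lambda>t. s l t - f t)"
      by (intro norm2_triangle_diff H2_L2T[OF projH2_spec(1)] L2T_indicator_mult[OF A \<psi>(1,2)] H2_L2T[OF f]) (simp add: s_def)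
    also have "norm2 (\<lambda>t. s l t - f t) \<le> norm2 (\<lambda>t. s l t - tsum c {..<N} t) + norm2 (\<lambda>t. tsum c {..<N} t - f t)"
      by (intro norm2_triangle_diff L2T_tsum H2_L2T[OF f]) (simp add: s_def)
    finally have "norm2 (\<lambda>t. projH2 (\<lambda>t. indicator A t * \<psi> l n t) t - f t) < e"
      using \<psi>(3)[of l n] n N \<open>norm2 (\<lambda>t. s l t - tsum c {..<N} t) < e / 3\<close> by linarith
    thus "\<exists>i. norm2 (\<lambda>t. projH2 (\<lambda>t. indicator A t * \<psi> (fst (d i)) (snd (d i)) t) t - f t) < e"
      by (intro exI[of _ "to_nat (l, n)"]) (simp add: d_def)
  qed (use \<psi> in auto)
qed

section \<open>The Hardy space as a Banach space\<close>

lemma H2_zero: "(\<lambda>t. 0) \<in> H2"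
  using tsum_in_H2[of "{}"] by (simp add: tsum_def[abs_def])

lemma H2_uminus: "f \<in> H2 \<Longrightarrow> (\<lambda>t. - f t) \<in> H2"
  using H2_scale[of f "-1"] by simp

\<comment> \<open>On functions \<open>norm2\<close> is only a seminorm, while summing the series in
  the criterion needs a Banach space as a type. The quotient is partial because only members of
  \<open>H2\<close> represent classes.\<close>
quotient_type hardy = "real \<Rightarrow> complex" / partial:
  "\<lambda>f g. f \<in> H2 \<and> g \<in> H2 \<and> (AE t in circ_meas. f t = g t)"
proof (rule part_equivpI)
  show "\<exists>f. f \<in> H2 \<and> f \<in> H2 \<and> (AE t in circ_meas. f t = f t)" using H2_zero by auto
  show "symp (\<lambda>f g. f \<in> H2 \<and> g \<in> H2 \<and> (AE t in circ_meas. f t = g t))"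
    by (rule sympI) (auto elim: eventually_mono)
  show "transp (\<lambda>f g. f \<in> H2 \<and> g \<in> H2 \<and> (AE t in circ_meas. f t = g t))"
  proof (rule transpI)
    fix f g h
    assume "f \<in> H2 \<and> g \<in> H2 \<and> (AE t in circ_meas. f t = g t)" "g \<in> H2 \<and> h \<in> H2 \<and> (AE t in circ_meas. g t = h t)"
    moreover from this have "AE t in circ_meas. f t = h t" by (auto elim: eventually_elim2)
    ultimately show "f \<in> H2 \<and> h \<in> H2 \<and> (AE t in circ_meas. f t = h t)" by blast
  qed
qed

instantiation hardy :: real_normed_vector
begin

lift_definition zero_hardy :: hardy is "\<lambda>t. 0" using H2_zero by simp

lift_definition plus_hardy :: "hardy \<Rightarrow> hardy \<Rightarrow> hardy" is "\<lambda>f g t. f t + g t"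
  by (auto intro: H2_add elim: eventually_elim2)

lift_definition minus_hardy :: "hardy \<Rightarrow> hardy \<Rightarrow> hardy" is "\<lambda>f g t. f t - g t"
  by (auto intro: H2_diff elim: eventually_elim2)

lift_definition uminus_hardy :: "hardy \<Rightarrow> hardy" is "\<lambda>f t. - f t"
  by (auto intro: H2_uminus elim: eventually_mono)

lift_definition scaleR_hardy :: "real \<Rightarrow> hardy \<Rightarrow> hardy" is "\<lambda>r f t. complex_of_real r * f t"
  by (auto intro: H2_scale elim: eventually_mono)

lift_definition norm_hardy :: "hardy \<Rightarrow> real" is norm2
  by (auto intro: norm2_cong_AE L2T_measurable H2_L2T)

definition sgn_hardy :: "hardy \<Rightarrow> hardy" where "sgn_hardy x = inverse (norm x) *\<^sub>R x"

definition dist_hardy :: "hardy \<Rightarrow> hardy \<Rightarrow> real" where "dist_hardy x y = norm (x - y)"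

definition uniformity_hardy :: "(hardy \<times> hardy) filter" where
  "uniformity_hardy = (INF e\<in>{0 <..}. principal {(x, y). dist x y < e})"

definition open_hardy :: "hardy set \<Rightarrow> bool" where
  "open_hardy U \<longleftrightarrow> (\<forall>x\<in>U. eventually (\<lambda>(x', y). x' = x \<longrightarrow> y \<in> U) uniformity)"

instance
proof
  fix a b c x y :: hardy and r s :: real
  show "a + b + c = a + (b + c)" by transfer (auto intro!: H2_add simp: add.assoc)
  show "a + b = b + a" by transfer (auto intro!: H2_add simp: add.commute)
  show "0 + a = a" by transfer (auto intro!: H2_add)
  show "- a + a = 0" by transfer (auto intro!: H2_add H2_uminus H2_zero)
  show "a - b = a + - b" by transfer (auto intro!: H2_add H2_diff H2_uminus)
  show "r *\<^sub>R (x + y) = r *\<^sub>R x + r *\<^sub>R y" by transfer (auto intro!: H2_add H2_scale simp: distrib_left)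
  show "(r + s) *\<^sub>R x = r *\<^sub>R x + s *\<^sub>R x"
    by transfer (auto intro!: H2_add H2_scale simp: distrib_right)
  show "r *\<^sub>R s *\<^sub>R x = (r * s) *\<^sub>R x"
    by transfer (auto intro!: H2_scale simp: mult.assoc)
  show "1 *\<^sub>R x = x" by transfer auto
  show "dist x y = norm (x - y)" by (rule dist_hardy_def)
  show "sgn x = inverse (norm x) *\<^sub>R x" by (rule sgn_hardy_def)
  show "(norm x = 0) = (x = 0)" by transfer (auto simp: norm2_eq_0_iff H2_L2T H2_zero)
  show "norm (x + y) \<le> norm x + norm y" by transfer (auto intro: norm2_triangle H2_L2T)
  show "norm (r *\<^sub>R x) = \<bar>r\<bar> * norm x" by transfer (simp add: norm2_scale)
qed (rule uniformity_hardy_def open_hardy_def)+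

end

text \<open>Projections and adjoints are known only through their inner products with
  \<open>H2\<close>; this turns such information into equality of classes.\<close>

lemma abs_hardy_eqI:
  assumes "f \<in> H2" "g \<in> H2" "\<And>k. k \<in> H2 \<Longrightarrow> ip f k = ip g k"
  shows "abs_hardy f = abs_hardy g"
  using H2_eq_AE[OF assms] assms Quotient_rel_abs[OF Quotient_hardy, of f g] by blast

lemma hardy_cases:
  obtains f where "f \<in> H2" "x = abs_hardy f"
  by (rule that[of "rep_hardy x"])
    (use Quotient_rep_reflp[OF Quotient_hardy, of x] Quotient_abs_rep[OF Quotient_hardy, of x] in auto)

lemma rep_abs_hardy:
  assumes "f \<in> H2"
  shows "rep_hardy (abs_hardy f) \<in> H2" "AE t in circ_meas. rep_hardy (abs_hardy f) t = f t"
  using Quotient_rep_abs[OF Quotient_hardy, of f] assms by auto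

lemma plus_abs_hardy: "f \<in> H2 \<Longrightarrow> g \<in> H2 \<Longrightarrow> abs_hardy f + abs_hardy g = abs_hardy (\<lambda>t. f t + g t)"
  by (rule plus_hardy.abs_eq) (auto simp: eq_onp_def)

lemma minus_abs_hardy: "f \<in> H2 \<Longrightarrow> g \<in> H2 \<Longrightarrow> abs_hardy f - abs_hardy g = abs_hardy (\<lambda>t. f t - g t)"
  by (rule minus_hardy.abs_eq) (auto simp: eq_onp_def)

lemma scaleR_abs_hardy: "f \<in> H2 \<Longrightarrow> r *\<^sub>R abs_hardy f = abs_hardy (\<lambda>t. complex_of_real r * f t)"
  by (rule scaleR_hardy.abs_eq) (auto simp: eq_onp_def)

lemma norm_abs_hardy: "f \<in> H2 \<Longrightarrow> norm (abs_hardy f) = norm2 f"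
  by (rule norm_hardy.abs_eq) (auto simp: eq_onp_def)

instance hardy :: banach
proof
  fix X :: "nat \<Rightarrow> hardy" assume X: "Cauchy X"
  have "\<forall>n. \<exists>f. f \<in> H2 \<and> X n = abs_hardy f" by (metis hardy_cases)
  then obtain f where f: "\<And>n. f n \<in> H2" "\<And>n. X n = abs_hardy (f n)" by metis
  have d: "norm (X m - X n) = norm2 (\<lambda>t. f m t - f n t)" for m n
    by (simp add: f minus_abs_hardy norm_abs_hardy H2_diff)
  have cau: "\<exists>N. \<forall>m\<ge>N. \<forall>n\<ge>N. norm2 (\<lambda>t. f m t - f n t) < e" if "e > 0" for e
    using CauchyD[OF X that] by (simp add: d)
  obtain l where l: "L2T l" "(\<lambda>n. norm2 (\<lambda>t. f n t - l t)) \<longlonglongrightarrow> 0"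
    using L2T_complete[of f, OF H2_L2T[OF f(1)] cau] by blast
  have lH: "l \<in> H2" by (rule H2_limit[OF f(1) l])
  have "(\<lambda>n. norm (X n - abs_hardy l)) \<longlonglongrightarrow> 0"
    using l(2) by (simp add: f minus_abs_hardy norm_abs_hardy H2_diff lH)
  hence "X \<longlonglongrightarrow> abs_hardy l" by (simp add: tendsto_norm_zero_iff LIM_zero_cancel)
  thus "convergent X" by (rule convergentI)
qed

definition hardy_adj :: "(real \<Rightarrow> complex) \<Rightarrow> hardy \<Rightarrow> hardy" where
  "hardy_adj b x = abs_hardy (toeplitz_adj b (rep_hardy x))"

lemma hardy_adj_abs:
  assumes g: "has_bdry g b" and f: "f \<in> H2"
  shows "hardy_adj b (abs_hardy f) = abs_hardy (toeplitz_adj b f)"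
  unfolding hardy_adj_def
proof (rule abs_hardy_eqI)
  note r = rep_abs_hardy[OF f]
  show "toeplitz_adj b (rep_hardy (abs_hardy f)) \<in> H2" "toeplitz_adj b f \<in> H2"
    by (rule toeplitz_adj_spec(1)[OF g r(1)], rule toeplitz_adj_spec(1)[OF g f])
  fix k assume k: "k \<in> H2"
  show "ip (toeplitz_adj b (rep_hardy (abs_hardy f))) k = ip (toeplitz_adj b f) k"
    unfolding toeplitz_adj_spec(2)[OF g r(1) k] toeplitz_adj_spec(2)[OF g f k]
    by (rule ip_cong_AE) (use r f H2_mult_bdry[OF g k] in \<open>auto intro: L2T_measurable H2_L2T\<close>)
qed

lemma toeplitz_adj_funpow:
  assumes g: "has_bdry g b" and f: "f \<in> H2"
  shows "(toeplitz_adj b ^^ n) f \<in> H2"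
    "k \<in> H2 \<Longrightarrow> ip ((toeplitz_adj b ^^ n) f) k = ip f (\<lambda>t. b t ^ n * k t)"
    "(hardy_adj b ^^ n) (abs_hardy f) = abs_hardy ((toeplitz_adj b ^^ n) f)"
proof (induction n arbitrary: k)
  case (Suc n)
  { case 1 show ?case using toeplitz_adj_spec(1)[OF g Suc(1)] by simp }
  { case 2
    have "ip ((toeplitz_adj b ^^ Suc n) f) k = ip ((toeplitz_adj b ^^ n) f) (\<lambda>t. b t * k t)"
      using toeplitz_adj_spec(2)[OF g Suc(1) 2] by simp
    also have "\<dots> = ip f (\<lambda>t. b t ^ n * (b t * k t))" by (rule Suc(2)[OF H2_mult_bdry[OF g 2]])
    finally show ?case by (simp add: mult_ac) }
  { case 3 show ?case using Suc(3) hardy_adj_abs[OF g Suc(1)] by simp }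
qed (use f in auto)

lemma bounded_linear_hardy_adj:
  assumes g: "has_bdry g b"
  shows "bounded_linear (hardy_adj b)"
proof -
  obtain B where B: "\<And>z. cmod z < 1 \<Longrightarrow> cmod (g z) \<le> B" by (rule HinfE[OF has_bdryD(2)[OF g]]) (rule that)
  note S = toeplitz_adj_spec[OF g]
  have L: "L2T (\<lambda>t. b t * k t)" if "k \<in> H2" for k by (rule H2_L2T[OF H2_mult_bdry[OF g that]])
  show ?thesis
  proof (rule bounded_linear_intro[where K=B])
    fix x y :: hardy and r :: real
    obtain f where f: "f \<in> H2" "x = abs_hardy f" by (rule hardy_cases)
    obtain h where h: "h \<in> H2" "y = abs_hardy h" by (rule hardy_cases)
    have "abs_hardy (toeplitz_adj b (\<lambda>t. f t + h t)) = abs_hardy (\<lambda>t. toeplitz_adj b f t + toeplitz_adj b h t)"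
      by (rule abs_hardy_eqI) (use f h in \<open>auto simp: S H2_add ip_add_left H2_L2T L\<close>)
    thus "hardy_adj b (x + y) = hardy_adj b x + hardy_adj b y"
      using f h by (simp add: plus_abs_hardy hardy_adj_abs[OF g] H2_add S)
    have "abs_hardy (toeplitz_adj b (\<lambda>t. complex_of_real r * f t)) = abs_hardy (\<lambda>t. complex_of_real r * toeplitz_adj b f t)"
      by (rule abs_hardy_eqI) (use f in \<open>auto simp: S H2_scale ip_scale_left\<close>)
    thus "hardy_adj b (r *\<^sub>R x) = r *\<^sub>R hardy_adj b x"
      using f by (simp add: scaleR_abs_hardy hardy_adj_abs[OF g] H2_scale S)
    show "norm (hardy_adj b x) \<le> norm x * B"
      using f norm2_toeplitz_adj_le[OF g f(1) B] by (simp add: norm_abs_hardy hardy_adj_abs[OF g] S mult.commute)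
  qed
qed

text \<open>All powers are contractions, so convergence on finite sums of characters extends to
  their closure, which is everything.\<close>

lemma hardy_adj_funpow_tendsto_0:
  assumes h: "has_bdry h hb" and h1: "\<And>z. cmod z < 1 \<Longrightarrow> cmod (h z) < 1"
  shows "(\<lambda>m. (hardy_adj hb ^^ m) y) \<longlonglongrightarrow> 0"
proof -
  let ?R = "hardy_adj hb"
  interpret R: bounded_linear ?R by (rule bounded_linear_hardy_adj[OF h])
  have h1': "cmod (h z) \<le> 1" if "cmod z < 1" for z using h1[OF that] by simp
  have Rn: "norm ((?R ^^ m) y) \<le> norm y" for m y
  proof (induction m)
    case (Suc m)
    obtain f where f: "f \<in> H2" "(?R ^^ m) y = abs_hardy f" by (rule hardy_cases)
    have "norm (?R ((?R ^^ m) y)) \<le> norm ((?R ^^ m) y)"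
      using norm2_toeplitz_adj_le[OF h f(1) h1'] f toeplitz_adj_spec(1)[OF h f(1)] by (simp add: hardy_adj_abs[OF h] norm_abs_hardy)
    with Suc show ?case by simp
  qed simp
  have Radd: "(?R ^^ m) (x + y) = (?R ^^ m) x + (?R ^^ m) y" for m x y
    by (induction m) (simp_all add: R.add)
  have chr: "(\<lambda>m. (?R ^^ m) (abs_hardy (\<lambda>t. c * tchar (int k) t))) \<longlonglongrightarrow> 0" for c k
  proof -
    have tk: "tchar (int k) \<in> H2" using tsum_in_H2[of "{k}" "\<lambda>_. 1"] by (simp add: tsum_def[abs_def])
    note P = toeplitz_adj_funpow[OF h tk]
    have "(?R ^^ m) (abs_hardy (\<lambda>t. c * tchar (int k) t)) = abs_hardy (\<lambda>t. c * (toeplitz_adj hb ^^ m) (tchar (int k)) t)" for m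
      unfolding toeplitz_adj_funpow(3)[OF h H2_scale[OF tk]]
      by (rule abs_hardy_eqI) (simp_all add: toeplitz_adj_funpow(1,2)[OF h] H2_scale tk ip_scale_left)
    hence "norm ((?R ^^ m) (abs_hardy (\<lambda>t. c * tchar (int k) t))) = cmod c * norm2 ((toeplitz_adj hb ^^ m) (tchar (int k)))" for m
      by (simp add: norm_abs_hardy H2_scale P norm2_scale)
    moreover have "(\<lambda>m. cmod c * norm2 ((toeplitz_adj hb ^^ m) (tchar (int k)))) \<longlonglongrightarrow> 0"
      by (intro tendsto_mult_right_zero toeplitz_adj_power_tchar[OF h, where k=k] P h1)
    ultimately have "(\<lambda>m. norm ((?R ^^ m) (abs_hardy (\<lambda>t. c * tchar (int k) t)))) \<longlonglongrightarrow> 0" by simp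
    thus ?thesis by (rule tendsto_norm_zero_cancel)
  qed
  have ts: "(\<lambda>m. (?R ^^ m) (abs_hardy (tsum c I))) \<longlonglongrightarrow> 0" if "finite I" for c I
    using that
  proof (induction I)
    case empty
    have "tsum c {} = (\<lambda>t. 0 * tchar (int 0) t)" by (simp add: tsum_def[abs_def])
    thus ?case using chr[of 0 0] by simp
  next
    case (insert i I)
    have ti: "(\<lambda>t. c i * tchar (int i) t) \<in> H2" using tsum_in_H2[of "{i}" c] by (simp add: tsum_def[abs_def])
    have "abs_hardy (tsum c (insert i I)) = abs_hardy (\<lambda>t. c i * tchar (int i) t) + abs_hardy (tsum c I)"
      using insert.hyps by (simp add: plus_abs_hardy ti tsum_in_H2) (simp add: tsum_def[abs_def])
    thus ?case using tendsto_add[OF chr[of "c i" i] insert.IH] by (simp add: Radd)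
  qed
  obtain f where f: "f \<in> H2" "y = abs_hardy f" by (rule hardy_cases)
  show ?thesis
  proof (rule tendstoI)
    fix e :: real assume e: "e > 0"
    have "\<forall>\<^sub>F N in sequentially. norm2 (\<lambda>t. tsum (\<lambda>i. fourier_coeff f (int i)) {..<N} t - f t) < e / 2"
      using H2_partial_sums[OF f(1)] e by (intro order_tendstoD(2)) auto
    then obtain N where N: "norm2 (\<lambda>t. tsum (\<lambda>i. fourier_coeff f (int i)) {..<N} t - f t) < e / 2"
      by (auto simp: eventually_sequentially)
    define s where "s = abs_hardy (tsum (\<lambda>i. fourier_coeff f (int i)) {..<N})"
    have "norm (s - y) < e / 2"
      using N unfolding s_def f(2) by (simp add: f(1) minus_abs_hardy tsum_in_H2 norm_abs_hardy H2_diff)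
    hence ys: "norm (y - s) < e / 2" by (simp only: norm_minus_commute)
    have "(\<lambda>m. (?R ^^ m) s) \<longlonglongrightarrow> 0" unfolding s_def by (rule ts) simp
    hence "\<forall>\<^sub>F m in sequentially. norm ((?R ^^ m) s) < e / 2" using e by (intro order_tendstoD(2)[OF tendsto_norm_zero]) auto
    thus "\<forall>\<^sub>F m in sequentially. dist ((?R ^^ m) y) 0 < e"
    proof eventually_elim
      case (elim m)
      have "(?R ^^ m) y = (?R ^^ m) (y - s) + (?R ^^ m) s" using Radd[of m "y - s" s] by simp
      hence "norm ((?R ^^ m) y) \<le> norm ((?R ^^ m) (y - s)) + norm ((?R ^^ m) s)" by (metis norm_triangle_ineq)
      also have "\<dots> < e" using Rn[of m "y - s"] ys elim by linarith
      finally show ?case by simp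
    qed
  qed
qed

section \<open>Projected functions and functionals on the quotient\<close>

definition hardy_proj :: "(real \<Rightarrow> complex) \<Rightarrow> hardy" where
  "hardy_proj u = abs_hardy (projH2 u)"

lemma hardy_proj_linear:
  assumes "L2T u" "L2T v"
  shows "hardy_proj (\<lambda>t. complex_of_real r * u t + v t) = r *\<^sub>R hardy_proj u + hardy_proj v"
proof -
  have H: "projH2 u \<in> H2" "projH2 v \<in> H2" using assms by (auto intro: projH2_spec)
  have "projH2 (\<lambda>t. complex_of_real r * u t + v t) \<in> H2" using assms by (intro projH2_spec L2T_add L2T_scale)
  moreover have "(\<lambda>t. complex_of_real r * projH2 u t + projH2 v t) \<in> H2" using H by (intro H2_add H2_scale)
  ultimately have "hardy_proj (\<lambda>t. complex_of_real r * u t + v t) = abs_hardy (\<lambda>t. complex_of_real r * projH2 u t + projH2 v t)"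
    unfolding hardy_proj_def
    using projH2_linear[OF assms, of "complex_of_real r"] Quotient_rel_abs[OF Quotient_hardy] by blast
  also have "\<dots> = r *\<^sub>R hardy_proj u + hardy_proj v"
    using H by (simp add: hardy_proj_def plus_abs_hardy scaleR_abs_hardy H2_scale)
  finally show ?thesis .
qed

lemma hardy_proj_sum:
  fixes N :: nat
  assumes "\<And>m. L2T (u m)"
  shows "(\<Sum>m<N. c m *\<^sub>R hardy_proj (u m)) = hardy_proj (\<lambda>t. \<Sum>m<N. complex_of_real (c m) * u m t)"
proof (induction N)
  case 0
  have "norm (hardy_proj (\<lambda>t. 0)) \<le> 0"
    using norm2_projH2_le[OF L2T_const[of 0]] by (simp add: hardy_proj_def norm_abs_hardy projH2_spec(1) norm2_def)
  thus ?case by simp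
next
  case (Suc N)
  have L: "L2T (\<lambda>t. \<Sum>m<N. complex_of_real (c m) * u m t)" by (intro L2T_sum L2T_scale assms)
  have "(\<lambda>t. \<Sum>m<Suc N. complex_of_real (c m) * u m t) = (\<lambda>t. complex_of_real (c N) * u N t + (\<Sum>m<N. complex_of_real (c m) * u m t))"
    by (simp add: add.commute)
  hence "hardy_proj (\<lambda>t. \<Sum>m<Suc N. complex_of_real (c m) * u m t) = c N *\<^sub>R hardy_proj (u N) + (\<Sum>m<N. c m *\<^sub>R hardy_proj (u m))"
    using hardy_proj_linear[OF assms L, of "c N" N] Suc by simp
  thus ?case by (simp add: add.commute)
qed

text \<open>Multiplication by \<open>b t ^ m\<close> preserves \<open>H2\<close>, so projecting
  \<open>w\<close> first makes no difference when the result is tested against \<open>H2\<close>.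
  Hence the powers act on \<open>w\<close> by pure multiplication under a single projection.\<close>

lemma hardy_adj_funpow_proj:
  assumes g: "has_bdry g b" and w: "L2T w"
  shows "(hardy_adj b ^^ m) (hardy_proj w) = hardy_proj (\<lambda>t. cnj (b t) ^ m * w t)"
    and "L2T (\<lambda>t. cnj (b t) ^ m * w t)"
proof -
  have gm: "has_bdry (\<lambda>z. g z ^ m) (\<lambda>t. b t ^ m)" by (rule has_bdry_entire[OF g]) (intro holomorphic_intros)
  obtain B where "\<And>z. cmod z < 1 \<Longrightarrow> cmod (g z ^ m) \<le> B" by (rule HinfE[OF has_bdryD(2)[OF gm]]) (rule that)
  hence B: "AE t in circ_meas. cmod (b t ^ m) \<le> B" by (rule has_bdry_bounded[OF gm])
  show L: "L2T (\<lambda>t. cnj (b t) ^ m * w t)"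
    by (rule L2T_mult_bounded[OF w, where B=B])
      (use B borel_measurable_cnj[OF has_bdryD(3)[OF gm]] in \<open>simp_all add: norm_power\<close>)
  note P = projH2_spec[OF w]
  show "(hardy_adj b ^^ m) (hardy_proj w) = hardy_proj (\<lambda>t. cnj (b t) ^ m * w t)"
    unfolding hardy_proj_def toeplitz_adj_funpow(3)[OF g P(1)]
  proof (rule abs_hardy_eqI)
    show "(toeplitz_adj b ^^ m) (projH2 w) \<in> H2" "projH2 (\<lambda>t. cnj (b t) ^ m * w t) \<in> H2"
      by (rule toeplitz_adj_funpow(1)[OF g P(1)], rule projH2_spec(1)[OF L])
    fix k assume k: "k \<in> H2"
    have "ip ((toeplitz_adj b ^^ m) (projH2 w)) k = ip (projH2 w) (\<lambda>t. b t ^ m * k t)"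
      by (rule toeplitz_adj_funpow(2)[OF g P(1) k])
    also have "\<dots> = ip w (\<lambda>t. b t ^ m * k t)" by (rule P(2)[OF H2_mult_bdry[OF gm k]])
    also have "\<dots> = ip (\<lambda>t. cnj (b t) ^ m * w t) k" by (simp add: ip_def mult_ac)
    also have "\<dots> = ip (projH2 (\<lambda>t. cnj (b t) ^ m * w t)) k" by (rule projH2_spec(2)[OF L k, symmetric])
    finally show "ip ((toeplitz_adj b ^^ m) (projH2 w)) k = ip (projH2 (\<lambda>t. cnj (b t) ^ m * w t)) k" .
  qed
qed

text \<open>The bound in \<open>dual_H2\<close> annihilates differences of norm zero, so a
  functional is constant on classes and the choice of representative is harmless.\<close>

lemma hardy_functional:
  assumes \<phi>: "\<phi> \<in> dual_H2"
  shows "bounded_linear (\<lambda>x. \<phi> (rep_hardy x))" "f \<in> H2 \<Longrightarrow> \<phi> (rep_hardy (abs_hardy f)) = \<phi> f"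
proof -
  have lin: "\<phi> (\<lambda>t. a * f t + b * h t) = a * \<phi> f + b * \<phi> h" if "f \<in> H2" "h \<in> H2" for f h a b
    using \<phi> that unfolding dual_H2_def by blast
  obtain C where C: "\<And>f. f \<in> H2 \<Longrightarrow> cmod (\<phi> f) \<le> C * norm2 f" using \<phi> unfolding dual_H2_def by blast
  have cong: "\<phi> (rep_hardy (abs_hardy f)) = \<phi> f" if f: "f \<in> H2" for f
  proof -
    note r = rep_abs_hardy[OF f]
    have d: "(\<lambda>t. 1 * rep_hardy (abs_hardy f) t + (-1) * f t) \<in> H2" by (intro H2_add H2_scale r(1) f)
    have "AE t in circ_meas. 1 * rep_hardy (abs_hardy f) t + (-1) * f t = 0" using r(2) by eventually_elim simp
    hence "norm2 (\<lambda>t. 1 * rep_hardy (abs_hardy f) t + (-1) * f t) = 0" using H2_L2T[OF d] by (simp add: norm2_eq_0_iff)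
    hence "\<phi> (\<lambda>t. 1 * rep_hardy (abs_hardy f) t + (-1) * f t) = 0" using C[OF d] by simp
    thus ?thesis using lin[OF r(1) f, of 1 "-1"] by simp
  qed
  thus "f \<in> H2 \<Longrightarrow> \<phi> (rep_hardy (abs_hardy f)) = \<phi> f" .
  show "bounded_linear (\<lambda>x. \<phi> (rep_hardy x))"
  proof (rule bounded_linear_intro[where K=C])
    fix x y :: hardy and r :: real
    obtain f where f: "f \<in> H2" "x = abs_hardy f" by (rule hardy_cases)
    obtain h where h: "h \<in> H2" "y = abs_hardy h" by (rule hardy_cases)
    show "\<phi> (rep_hardy (x + y)) = \<phi> (rep_hardy x) + \<phi> (rep_hardy y)"
      using f h lin[OF f(1) h(1), of 1 1] by (simp add: plus_abs_hardy cong H2_add)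
    show "\<phi> (rep_hardy (r *\<^sub>R x)) = r *\<^sub>R \<phi> (rep_hardy x)"
      using f lin[OF f(1) f(1), of r 0] by (simp add: scaleR_abs_hardy cong H2_scale scaleR_conv_of_real)
    show "norm (\<phi> (rep_hardy x)) \<le> norm x * C"
      using f C[OF f(1)] by (simp add: cong norm_abs_hardy mult.commute)
  qed
qed

lemma weakly_hypercyclic_H2_transfer:
  assumes g: "has_bdry g b"
    and x: "\<And>F y \<epsilon>. finite F \<Longrightarrow> (\<And>\<psi>. \<psi> \<in> F \<Longrightarrow> bounded_linear (\<psi> :: hardy \<Rightarrow> real)) \<Longrightarrow> \<epsilon> > 0
      \<Longrightarrow> \<exists>n. \<forall>\<psi>\<in>F. \<bar>\<psi> ((hardy_adj b ^^ n) x) - \<psi> y\<bar> < \<epsilon>"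
  shows "weakly_hypercyclic_H2 (toeplitz_adj b)"
proof -
  obtain f where f: "f \<in> H2" "x = abs_hardy f" by (rule hardy_cases)
  have "\<exists>p\<in>{(toeplitz_adj b ^^ n) f | n. True}. \<forall>\<phi>\<in>F. cmod (\<phi> p - \<phi> h) < e"
    if h: "h \<in> H2" and e: "e > 0" and F: "finite F" "F \<subseteq> dual_H2" for h e F
  proof -
    \<comment> \<open>A complex functional is within \<open>e\<close> as soon as its real and
      imaginary parts are within \<open>e / 2\<close>.\<close>
    define F' where "F' = (\<lambda>\<phi> x. Re (\<phi> (rep_hardy x))) ` F \<union> (\<lambda>\<phi> x. Im (\<phi> (rep_hardy x))) ` F"
    have "finite F'" using F by (simp add: F'_def)
    moreover have "bounded_linear \<psi>" if "\<psi> \<in> F'" for \<psi>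
    proof -
      obtain \<phi> where "\<phi> \<in> F" "\<psi> = (\<lambda>x. Re (\<phi> (rep_hardy x))) \<or> \<psi> = (\<lambda>x. Im (\<phi> (rep_hardy x)))"
        using \<open>\<psi> \<in> F'\<close> unfolding F'_def by blast
      thus ?thesis using hardy_functional(1)[of \<phi>] F
        bounded_linear_compose[OF bounded_linear_Re] bounded_linear_compose[OF bounded_linear_Im] by blast
    qed
    moreover have "e / 2 > 0" using e by simp
    ultimately obtain n where n: "\<forall>\<psi>\<in>F'. \<bar>\<psi> ((hardy_adj b ^^ n) x) - \<psi> (abs_hardy h)\<bar> < e / 2"
      using x[of F' "e / 2" "abs_hardy h"] by blast
    define p where "p = (toeplitz_adj b ^^ n) f"
    have p: "p \<in> H2" "(hardy_adj b ^^ n) x = abs_hardy p"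
      using toeplitz_adj_funpow(1,3)[OF g f(1)] by (auto simp: p_def f(2))
    have "cmod (\<phi> p - \<phi> h) < e" if \<phi>: "\<phi> \<in> F" for \<phi>
    proof -
      have c: "\<phi> (rep_hardy (abs_hardy p)) = \<phi> p" "\<phi> (rep_hardy (abs_hardy h)) = \<phi> h"
        using hardy_functional(2)[of \<phi>] \<phi> F p(1) h by auto
      have "(\<lambda>x. Re (\<phi> (rep_hardy x))) \<in> F'" "(\<lambda>x. Im (\<phi> (rep_hardy x))) \<in> F'" using \<phi> by (auto simp: F'_def)
      from n[rule_format, OF this(1)] n[rule_format, OF this(2)]
      have "\<bar>Re (\<phi> p - \<phi> h)\<bar> < e / 2" "\<bar>Im (\<phi> p - \<phi> h)\<bar> < e / 2" by (simp_all add: p(2) c)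
      thus ?thesis using cmod_le[of "\<phi> p - \<phi> h"] by linarith
    qed
    thus ?thesis unfolding p_def by blast
  qed
  thus ?thesis unfolding weakly_hypercyclic_H2_def weakly_dense_H2_def using f(1) by blast
qed

text \<open>The contractive projection is dropped at once. What remains is \<open>\<psi>\<close>
  times a polynomial in \<open>hb\<close> on \<open>A\<close> and 0 elsewhere; enlarging the
  integral of that polynomial from \<open>A\<close> to the whole circle is what makes subordination
  applicable.\<close>

lemma hardy_Bessel:
  assumes g: "has_bdry g b" and h: "has_bdry h hb" and h1: "\<And>z. cmod z < 1 \<Longrightarrow> cmod (h z) \<le> 1" and h0: "cmod (h 0) < 1"
    and A: "A \<in> sets circ_meas" and hA: "AE t in circ_meas. t \<in> A \<longrightarrow> cnj (b t) = hb t"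
    and \<psi>: "\<psi> \<in> borel_measurable circ_meas" "\<And>t. cmod (\<psi> t) \<le> B"
  shows "(norm (\<Sum>m<N. c m *\<^sub>R (hardy_adj b ^^ m) (hardy_proj (\<lambda>t. indicator A t * \<psi> t))))\<^sup>2
    \<le> B\<^sup>2 * (2 + 4 / (1 - (cmod (h 0))\<^sup>2)) * (\<Sum>m<N. (c m)\<^sup>2)"
proof -
  let ?w = "\<lambda>t. indicator A t * \<psi> t"
  have w: "L2T ?w" by (rule L2T_indicator_mult[OF A \<psi>])
  define u where "u t = (\<Sum>m<N. complex_of_real (c m) * (cnj (b t) ^ m * ?w t))" for t
  define q where "q t = (\<Sum>m<N. complex_of_real (c m) * hb t ^ m)" for t
  have Lu: "L2T u" unfolding u_def by (intro L2T_sum L2T_scale hardy_adj_funpow_proj(2)[OF g w])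
  have "has_bdry (\<lambda>z. \<Sum>m<N. complex_of_real (c m) * h z ^ m) q" unfolding q_def
    by (rule has_bdry_entire[OF h, where \<phi>="\<lambda>w. \<Sum>m<N. complex_of_real (c m) * w ^ m"]) (intro holomorphic_intros)
  hence Lq: "L2T q" by (rule L2T_has_bdry)
  have "(\<Sum>m<N. c m *\<^sub>R (hardy_adj b ^^ m) (hardy_proj ?w)) = hardy_proj u"
    unfolding u_def hardy_adj_funpow_proj(1)[OF g w] by (rule hardy_proj_sum[OF hardy_adj_funpow_proj(2)[OF g w]])
  hence "(norm (\<Sum>m<N. c m *\<^sub>R (hardy_adj b ^^ m) (hardy_proj ?w)))\<^sup>2 = (norm2 (projH2 u))\<^sup>2"
    by (simp add: hardy_proj_def norm_abs_hardy projH2_spec(1) Lu)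
  also have "\<dots> \<le> (norm2 u)\<^sup>2" using norm2_projH2_le[OF Lu] by (intro power_mono) auto
  also have "\<dots> \<le> (LINT t|circ_meas. B\<^sup>2 * (cmod (q t))\<^sup>2)"
    unfolding norm2_power2
  proof (rule integral_mono_AE)
    show "AE t in circ_meas. (cmod (u t))\<^sup>2 \<le> B\<^sup>2 * (cmod (q t))\<^sup>2"
      using hA
    proof eventually_elim
      case (elim t)
      have "cmod (u t) \<le> B * cmod (q t)"
      proof (cases "t \<in> A")
        case True
        hence "u t = \<psi> t * q t" using elim by (simp add: u_def q_def sum_distrib_left mult_ac)
        thus ?thesis using \<psi>(2)[of t] by (simp add: norm_mult mult_right_mono)
      next
        case False
        hence "u t = 0" by (simp add: u_def)
        moreover have "0 \<le> B" using \<psi>(2)[of t] norm_ge_zero order_trans by blast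
        ultimately show ?thesis by simp
      qed
      hence "(cmod (u t))\<^sup>2 \<le> (B * cmod (q t))\<^sup>2" by (intro power_mono) auto
      thus ?case by (simp add: power_mult_distrib)
    qed
  qed (use Lu Lq in \<open>auto simp: L2T_def\<close>)
  also have "\<dots> = B\<^sup>2 * (LINT t|circ_meas. (cmod (q t))\<^sup>2)" by simp
  also have "\<dots> \<le> B\<^sup>2 * ((2 + 4 / (1 - (cmod (h 0))\<^sup>2)) * (\<Sum>m<N. (cmod (complex_of_real (c m)))\<^sup>2))"
    unfolding q_def by (intro mult_left_mono polynomial_composition_bound[OF h h1 h0]) auto
  finally show ?thesis by (simp add: mult.assoc)
qed

section \<open>Maximum principle and conclusion\<close>

lemma nonconstant_norm_gt_1:
  assumes hol: "g holomorphic_on ball 0 1" and nc: "\<not> (\<exists>c. \<forall>z\<in>ball 0 1. g z = c)"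
    and ge1: "\<And>z. cmod z < 1 \<Longrightarrow> cmod (g z) \<ge> 1" and z: "cmod z < 1"
  shows "cmod (g z) > 1"
proof (rule ccontr)
  assume "\<not> cmod (g z) > 1"
  hence z1: "cmod (g z) = 1" using ge1[OF z] by simp
  have nz: "g w \<noteq> 0" if "cmod w < 1" for w using ge1[OF that] by auto
  have "(\<lambda>w. 1 / g w) constant_on ball 0 1"
  proof (rule maximum_modulus_principle[where \<xi>=z and U="ball 0 1"])
    show "(\<lambda>w. 1 / g w) holomorphic_on ball 0 1" using hol nz by (intro holomorphic_intros) auto
    show "norm (1 / g w) \<le> norm (1 / g z)" if "w \<in> ball 0 1" for w
      using ge1[of w] that z1 by (simp add: norm_divide divide_le_eq)
  qed (use z in auto)
  then obtain c where c: "\<And>w. w \<in> ball 0 1 \<Longrightarrow> 1 / g w = c" unfolding constant_on_def by blast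
  have "g w = 1 / c" if "w \<in> ball 0 1" for w unfolding c[OF that, symmetric] by simp
  thus False using nc by blast
qed

theorem theorem1p9:
  fixes g :: "complex \<Rightarrow> complex"
  assumes "Hinf g"
    and "\<not> (\<exists>c. \<forall>z\<in>ball 0 1. g z = c)"
    and "\<forall>z\<in>ball 0 1. g z \<notin> ball 0 1"
    and "measure circ_meas {t\<in>{0..1}. cmod (bdry g t) = 1} > 0"
  shows "weakly_hypercyclic_H2 (toeplitz_adj (bdry g))"
proof -
  define b where "b = bdry g"
  have g: "has_bdry g b" unfolding b_def by (rule has_bdry_bdry[OF assms(1)])
  have ge1: "cmod (g z) \<ge> 1" if "cmod z < 1" for z using assms(3) that by force
  have gt1: "cmod (g z) > 1" if "cmod z < 1" for z
    by (rule nonconstant_norm_gt_1[OF has_bdryD(1)[OF g] assms(2) ge1 that])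
  obtain M where M: "\<And>z. cmod z < 1 \<Longrightarrow> cmod (g z) \<le> M" by (rule HinfE[OF assms(1)]) (rule that)
  define h where "h z = 1 / g z" for z
  define hb where "hb t = 1 / b t" for t
  \<comment> \<open>The closed annulus contains all values of \<open>g\<close> and avoids 0, so
    inversion is holomorphic around it.\<close>
  define K where "K = {w::complex. 1 \<le> cmod w} \<inter> cball 0 M"
  have K: "compact K" unfolding K_def
    by (intro closed_Int_compact closed_Collect_le continuous_intros compact_cball)
  have h: "has_bdry h hb"
    unfolding h_def hb_def
  proof (rule has_bdry_compose[OF g _ K, where U="- {0}"])
    show "g z \<in> K" if "cmod z < 1" for z using M[OF that] ge1[OF that] by (simp add: K_def)
  qed (auto simp: K_def intro!: holomorphic_intros)
  have h1: "cmod (h z) < 1" if "cmod z < 1" for z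
    using gt1[OF that] by (simp add: h_def norm_divide divide_less_eq)
  have h1': "cmod (h z) \<le> 1" if "cmod z < 1" for z using h1[OF that] by simp
  \<comment> \<open>Division by zero would give \<open>hb t = 0\<close>; the lower bound 1 for
    \<open>g\<close> survives in the radial limit and excludes zeros of \<open>b\<close> almost
    everywhere.\<close>
  have hb1: "AE t in circ_meas. hb t * b t = 1"
  proof -
    have "AE t in circ_meas. b t \<noteq> 0"
      using has_bdryD(4)[OF g]
    proof eventually_elim
      case (elim t)
      have "1 \<le> cmod (b t)"
      proof (rule tendsto_lowerbound[OF tendsto_norm[OF elim]])
        show "\<forall>\<^sub>F r in at_left 1. 1 \<le> cmod (g (complex_of_real r * cis (2 * pi * t)))"
          using eventually_at_left_real[of 0 "1::real"] by (rule eventually_mono) (auto intro!: ge1 simp: norm_mult)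
      qed simp
      thus ?case by auto
    qed
    thus ?thesis by eventually_elim (simp add: hb_def)
  qed
  define A where "A = {t\<in>{0..1}. cmod (b t) = 1}"
  have A: "A \<in> sets circ_meas"
  proof -
    have "{t \<in> space circ_meas. cmod (b t) = 1} \<in> sets circ_meas" using has_bdryD(3)[OF g] by measurable
    thus ?thesis by (simp add: A_def)
  qed
  have Apos: "measure circ_meas A > 0" using assms(4) by (simp add: A_def b_def)
  have hA: "AE t in circ_meas. t \<in> A \<longrightarrow> cnj (b t) = hb t"
  proof (intro always_eventually allI impI)
    fix t assume "t \<in> A"
    hence "b t * cnj (b t) = 1" using complex_norm_square[of "b t"] by (simp add: A_def)
    thus "cnj (b t) = hb t" unfolding hb_def by (metis eq_divide_imp mult.commute mult_zero_left zero_neq_one)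
  qed
  obtain \<psi> :: "nat \<Rightarrow> real \<Rightarrow> complex" and B :: "nat \<Rightarrow> real" where \<psi>: "\<And>i. \<psi> i \<in> borel_measurable circ_meas" "\<And>i t. cmod (\<psi> i t) \<le> B i"
    "\<And>f e. f \<in> H2 \<Longrightarrow> e > 0 \<Longrightarrow> \<exists>i. norm2 (\<lambda>t. projH2 (\<lambda>t. indicator A t * \<psi> i t) t - f t) < e"
    by (rule countable_dense_from[OF A Apos]) (rule that)
  define u where "u i = hardy_proj (\<lambda>t. indicator A t * \<psi> i t)" for i
  have dense: "\<exists>i. norm (u i - y) < e" if e: "e > 0" for y e
  proof -
    obtain f where f: "f \<in> H2" "y = abs_hardy f" by (rule hardy_cases)
    obtain i where "norm2 (\<lambda>t. projH2 (\<lambda>t. indicator A t * \<psi> i t) t - f t) < e" using \<psi>(3)[OF f(1) e] by blast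
    thus ?thesis using f projH2_spec(1)[OF L2T_indicator_mult[OF A \<psi>(1,2)], of i]
      by (intro exI[of _ i]) (simp add: u_def hardy_proj_def minus_abs_hardy norm_abs_hardy H2_diff)
  qed
  have TR: "hardy_adj b (hardy_adj hb x) = x" for x
  proof -
    obtain f where f: "f \<in> H2" "x = abs_hardy f" by (rule hardy_cases)
    note Rf = toeplitz_adj_spec[OF h f(1)]
    have "abs_hardy (toeplitz_adj b (toeplitz_adj hb f)) = abs_hardy f"
    proof (rule abs_hardy_eqI[OF toeplitz_adj_spec(1)[OF g Rf(1)] f(1)])
      fix k assume k: "k \<in> H2"
      note bk = H2_mult_bdry[OF g k]
      have "ip (toeplitz_adj b (toeplitz_adj hb f)) k = ip f (\<lambda>t. hb t * (b t * k t))"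
        unfolding toeplitz_adj_spec(2)[OF g Rf(1) k] by (rule Rf(2)[OF bk])
      also have "\<dots> = cnj (ip (\<lambda>t. hb t * (b t * k t)) f)" by (rule ip_cnj)
      also have "ip (\<lambda>t. hb t * (b t * k t)) f = ip k f"
      proof (rule ip_cong_AE)
        show "AE t in circ_meas. hb t * (b t * k t) = k t" using hb1 by eventually_elim (simp flip: mult.assoc)
      qed (intro L2T_measurable H2_L2T H2_mult_bdry[OF h bk] k f(1))+
      also have "cnj (ip k f) = ip f k" by (rule ip_cnj[symmetric])
      finally show "ip (toeplitz_adj b (toeplitz_adj hb f)) k = ip f k" .
    qed
    thus ?thesis by (simp add: f(2) hardy_adj_abs[OF h f(1)] hardy_adj_abs[OF g Rf(1)])
  qed
  obtain x where "\<And>F y \<epsilon>. finite F \<Longrightarrow> (\<And>\<psi>. \<psi> \<in> F \<Longrightarrow> bounded_linear (\<psi> :: hardy \<Rightarrow> real)) \<Longrightarrow> \<epsilon> > 0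
      \<Longrightarrow> \<exists>n. \<forall>\<psi>\<in>F. \<bar>\<psi> ((hardy_adj b ^^ n) x) - \<psi> y\<bar> < \<epsilon>"
  proof (rule weakly_hypercyclic_criterion[of "hardy_adj b" "hardy_adj hb" u])
    show "bounded_linear (hardy_adj b)" by (rule bounded_linear_hardy_adj[OF g])
    show "(\<lambda>m. (hardy_adj hb ^^ m) y) \<longlonglongrightarrow> 0" for y by (rule hardy_adj_funpow_tendsto_0[OF h h1])
    show "(norm (\<Sum>m<N. c m *\<^sub>R (hardy_adj b ^^ m) (u i)))\<^sup>2 \<le> ((B i)\<^sup>2 * (2 + 4 / (1 - (cmod (h 0))\<^sup>2))) * (\<Sum>m<N. (c m)\<^sup>2)" for i N c
      unfolding u_def by (rule hardy_Bessel[OF g h h1' _ A hA \<psi>(1,2)]) (use h1[of 0] in simp_all)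
  qed (use TR dense that in auto)
  thus ?thesis unfolding b_def[symmetric] by (rule weakly_hypercyclic_H2_transfer[OF g])
qed

end
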